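(* Let $k,n\ge 2$ be integers, $p>3$, and $\phi>0$. Let $\mathcal{Z}=(\mathbb{R}^n,\|\cdot\|_1)$ and let $U:[0,1]^2\to\mathcal{Z}$ be an $L^p_{\mathcal{Z}}$-kernel. Let $X=(X_1,\dots,X_k)$ be a uniform random vector in $[0,1]^k$. Then with probability at least $$1-2^{n+2}\,n\,k^{-\phi p+\frac{(n-1)(p-1)}{4p}},$$ the upper bound $$\|\mathcal{U}_X\|_\square-\|U\|_\square\le 10\left[\|U\|_\square+30\|U\|_p+6\sqrt{2\phi p}\,(\|U\|_1+2\|U\|_p)\,\frac{\sqrt{\ln k}}{k^{\frac{p-3}{4p}-\phi}}\right]k^{-\frac14+\frac1{4p}}$$ is satisfied.
   Context: $\mathcal{Z}=(\mathbb{R}^n,\|\cdot\|_1)$ is regarded as the dual of $Z=(\mathbb{R}^n,\|\cdot\|_\infty)$ with the standard pairing $\langle f,w\rangle$. A symmetric function $W:[0,1]^2\to\mathcal{Z}$ is an $L^p_{\mathcal{Z}}$-kernel if it is (weak-* ) measurable and $(x,y)\mapsto\|W(x,y)\|_{\mathcal{Z}}$ lies in $L^p([0,1]^2)$. Put $\|W\|_r=\left(\int_{[0,1]^2}\|W(x,y)\|_{\mathcal{Z}}^r\right)^{1/r}$ for $r\ge 1$. For real-valued $V\in L^1([0,1]^2)$, $\|V\|_\square=\sup_{S,T\subseteq[0,1]}\left|\int_{S\times T}V\right|$ (supremum over measurable sets). For an $L^p_{\mathcal{Z}}$-kernel $W$ (or a $\mathcal{Z}$-valued step function), $\|W\|_\square=\sup_{f\in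 Z,\ \|f\|_Z=1}\|\langle f,W\rangle\|_\square$, where $\langle f,W\rangle(x,y)=\langle f,W(x,y)\rangle$. For $X=(X_1,\dots,X_k)$ with $X_1,\dots,X_k$ i.i.d. uniform on $[0,1]$, $\mathcal{U}_X$ is the $\mathcal{Z}$-valued step function on $[0,1]^2$ with uniform steps of length $1/k$ in each variable, taking on $[(i-1)/k,i/k]\times[(j-1)/k,j/k]$ the value $U(X_i,X_j)$ if $i\ne j$ and $0$ if $i=j$. *)

theory Defs
  imports "HOL-Probability.Probability"
begin

abbreviation unit_square :: "(real \<times> real) set" where
  "unit_square \<equiv> {0..1} \<times> {0..1}"

text \<open>The space \<open>\<Z> = (\<real>\<^sup>n, \<parallel>\<cdot>\<parallel>\<^sub>1)\<close> is \<open>real ^ 'n\<close> equipped with \<open>l1norm\<close>, not with the built-in (Euclidean)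
  \<open>norm\<close>; its predual \<open>(\<real>\<^sup>n, \<parallel>\<cdot>\<parallel>\<^sub>\<infinity>)\<close> is \<open>real ^ 'n\<close> with the library's \<open>infnorm\<close>, and the pairing is
  the standard inner product.\<close>

definition l1norm :: "real ^ 'n \<Rightarrow> real" where
  "l1norm w = (\<Sum>i\<in>UNIV. \<bar>w $ i\<bar>)"

text \<open>Kernels are total functions, but only their values on the unit square matter;
  measurability is Lebesgue measurability.\<close>

definition Lp_kernel :: "real \<Rightarrow> (real \<times> real \<Rightarrow> real ^ 'n) \<Rightarrow> bool" where
  "Lp_kernel p W \<longleftrightarrow>
     (\<forall>x\<in>{0..1}. \<forall>y\<in>{0..1}. W (x, y) = W (y, x)) \<and>
     (\<forall>f. (\<lambda>z. f \<bullet> W z) \<in> borel_measurable (lebesgue_on unit_square)) \<and>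
     integrable (lebesgue_on unit_square) (\<lambda>z. l1norm (W z) powr p)"

definition Lr_norm :: "real \<Rightarrow> (real \<times> real \<Rightarrow> real ^ 'n) \<Rightarrow> real" where
  "Lr_norm r W = (LINT z|lebesgue_on unit_square. l1norm (W z) powr r) powr (1 / r)"

definition cut_norm_real :: "(real \<times> real \<Rightarrow> real) \<Rightarrow> real" where
  "cut_norm_real V =
     (SUP (S, T) \<in> {S \<in> sets lebesgue. S \<subseteq> {0..1}} \<times> {T \<in> sets lebesgue. T \<subseteq> {0..1}}.
        \<bar>LINT z:S \<times> T|lebesgue. V z\<bar>)"

definition cut_norm :: "(real \<times> real \<Rightarrow> real ^ 'n) \<Rightarrow> real" where
  "cut_norm W = (SUP f \<in> {f. infnorm f = 1}. cut_norm_real (\<lambda>z. f \<bullet> W z))"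

text \<open>The steps are half-open so that they are disjoint; the values on the boundaries
  of the steps (a null set) are irrelevant.\<close>

definition sampled_step ::
    "nat \<Rightarrow> (real \<times> real \<Rightarrow> real ^ 'n) \<Rightarrow> (nat \<Rightarrow> real) \<Rightarrow> real \<times> real \<Rightarrow> real ^ 'n" where
  "sampled_step k U x z =
     (\<Sum>i\<in>{1..k}. \<Sum>j\<in>{1..k}.
        indicator ({(real i - 1) / real k..<real i / real k} \<times>
                   {(real j - 1) / real k..<real j / real k}) z *\<^sub>R
        (if i = j then 0 else U (x i, x j)))"

end

theory Submission imports Defs begin

text \<open>The \<open>\<ell>\<^sub>1\<close> norm is a maximum over sign vectors \<open>s\<close>, so a union bound over the
  \<open>2\<^sup>n\<close> signs reduces everything to the scalar kernels \<open>V = s \<bullet> U\<close>; no net of the unit sphere is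
  needed. The kernel is first truncated at a level that sampled entries exceed with negligible
  probability. For the scalar kernel, decoupling turns the cut norm of the sampled matrix into an
  average of cut norms of matrices whose rows and columns are sampled independently.
  Conditionally on the columns, the maximum over row sets is a supremum of sums of positive parts
  of independent variables. Symmetrization and the contraction principle remove the positive
  parts, and what remains is linear in the set, so that its supremum is bounded by \<open>L\<^sup>1\<close> norms of
  Rademacher sums, which Khintchine's inequality controls. The same argument in the column
  variable arrives at the cut norm of \<open>V\<close>. All steps hold for
  \<open>r\<close>-th moments, so Markov's inequality with \<open>r = min p (\<phi> p ln k)\<close> gives the tail bound.\<close>

text \<open>The excess over the cut norm has to be of lower order, so \<open>cut_norm U\<close> must
  pass through every step with coefficient 1. Hence moments are taken of positive parts of centred
  quantities such as \<open>max_mass J \<omega> - real (card J) * B\<close>, never of the maxima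
  themselves. Decoupling costs a factor 4, but the part belonging to a split of the \<open>k\<close>
  indices into \<open>R\<close> and its complement is centred at
  \<open>card R * card (I - R) * B\<close>, and this product of cardinalities is at most
  \<open>k\<^sup>2 / 4\<close>. The loss cancels in the main term and survives only in the
  fluctuation. The kernel has p moments only, and a bound on the truncated entries grows like
  \<open>k powr (\<phi> + 2 / p)\<close>, so this bound must not enter the fluctuation. It secures
  integrability, while the moment estimates contain nothing but moments of the kernel. In the
  failure probability each of the 2^n sign vectors contributes
  \<open>2 * k powr (- \<phi> * p)\<close> and the large entries contribute
  \<open>k powr (- \<phi> * p)\<close> altogether, which is less than the claimed amount.\<close>

section \<open>Rademacher sums\<close>

text \<open>Weak majorization for pairs. Once both pairs are sorted, the larger entry may be raised
  to \<open>c + d - b\<close>; then \<open>b\<close> and \<open>c + d - b\<close> lie between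
  \<open>d\<close> and \<open>c\<close> with the weights \<open>u\<close> and \<open>1 - u\<close>
  exchanged, and the two convexity bounds add up to \<open>F c + F d\<close>.\<close>

lemma convex_mono_majorization:
  fixes F :: "real \<Rightarrow> real"
  assumes F: "convex_on UNIV F" "mono F"
    and sum: "a + b \<le> a' + b'" and le: "a \<le> max a' b'" "b \<le> max a' b'"
  shows "F a + F b \<le> F a' + F b'"
proof -
  have main: "F a + F b \<le> F c + F d"
    if *: "a + b \<le> c + d" "b \<le> a" "d \<le> c" "a \<le> c" for a b c d
  proof (cases "b \<le> d")
    case True
    then show ?thesis using monoD[OF F(2), of a c] monoD[OF F(2), of b d] * by linarith
  next
    case False
    define u where "u = (b - d) / (c - d)"
    have cd: "c - d > 0" using False * by linarith
    have u: "0 \<le> u" "u \<le> 1" using False * cd by (auto simp: u_def)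
    have uc: "u * (c - d) = b - d" using cd by (simp add: u_def)
    have "F b \<le> (1 - u) * F d + u * F c"
      using convex_onD[OF F(1) u, of d c] uc by (simp add: algebra_simps)
    moreover have "F (c + d - b) \<le> (1 - u) * F c + u * F d"
    proof -
      have "(1 - u) * c + u * d = c + d - b" using uc by (simp add: algebra_simps)
      then show ?thesis using convex_onD[OF F(1) u, of c d] by simp
    qed
    moreover have "F a \<le> F (c + d - b)" using * by (intro monoD[OF F(2)]) linarith
    ultimately show ?thesis by (simp add: algebra_simps)
  qed
  show ?thesis
    using main[of a b a' b'] main[of b a a' b'] main[of a b b' a'] main[of b a b' a'] sum le
    by (cases "b \<le> a"; cases "b' \<le> a'") (auto simp: max_def add.commute split: if_splits)
qed

text \<open>A subset stands for a vector of signs. Rademacher averages thus become finite sums over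
  \<open>Pow J\<close>, with the normalization \<open>2 ^ card J\<close> carried along
  explicitly.\<close>

definition rsign :: "'j set \<Rightarrow> 'j \<Rightarrow> real" where
  "rsign E j = (if j \<in> E then 1 else - 1)"

lemma sum_Pow_insert:
  assumes "finite J" "j \<notin> J"
  shows "(\<Sum>E\<in>Pow (insert j J). g E) = (\<Sum>E\<in>Pow J. g (insert j E) + g E :: 'b::comm_monoid_add)"
proof -
  have inj: "inj_on (insert j) (Pow J)"
    using assms(2) by (intro inj_onI) (metis Diff_insert_absorb PowD in_mono)
  have "(\<Sum>E\<in>Pow (insert j J). g E) = (\<Sum>E\<in>Pow J. g E) + (\<Sum>E\<in>insert j ` Pow J. g E)"
    unfolding Pow_insert using assms by (intro sum.union_disjoint) auto
  also have "(\<Sum>E\<in>insert j ` Pow J. g E) = (\<Sum>E\<in>Pow J. g (insert j E))"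
    by (simp add: sum.reindex[OF inj])
  finally show ?thesis by (simp add: sum.distrib add.commute)
qed

lemma rsign_sum_insert:
  assumes "finite J" "j \<notin> J" "E \<subseteq> J"
  shows "(\<Sum>i\<in>insert j J. rsign (insert j E) i * f i) = f j + (\<Sum>i\<in>J. rsign E i * f i)"
    and "(\<Sum>i\<in>insert j J. rsign E i * f i) = - f j + (\<Sum>i\<in>J. rsign E i * f i)"
  using assms by (auto simp: rsign_def intro!: sum.cong)

text \<open>One sign is averaged. For maximizers \<open>a\<close> and \<open>b\<close> of the
  left-hand side the Lipschitz bound gives a sum of at most
  \<open>c a + c b + \<bar>t a - t b\<bar>\<close>, which the right-hand maxima dominate whichever
  of \<open>t a\<close> and \<open>t b\<close> is larger. Because \<phi> vanishes at 0, each left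
  maximum is also below the larger right one, and weak majorization applies.\<close>

lemma contraction_step:
  fixes F \<phi> :: "real \<Rightarrow> real"
  assumes F: "convex_on UNIV F" "mono F" and A: "finite A" "A \<noteq> {}"
    and \<phi>: "\<And>u v. \<bar>\<phi> u - \<phi> v\<bar> \<le> \<bar>u - v\<bar>" "\<phi> 0 = 0"
  shows "F (Max ((\<lambda>a. c a + \<phi> (t a)) ` A)) + F (Max ((\<lambda>a. c a - \<phi> (t a)) ` A))
       \<le> F (Max ((\<lambda>a. c a + t a) ` A)) + F (Max ((\<lambda>a. c a - t a) ` A))"
proof (rule convex_mono_majorization[OF F])
  have ex: "\<exists>a\<in>A. Max (g ` A) = g a" for g :: "_ \<Rightarrow> real"
  proof -
    have "Max (g ` A) \<in> g ` A" using A by (intro Max_in) auto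
    then show ?thesis by auto
  qed
  obtain a where a: "a \<in> A" "Max ((\<lambda>a. c a + \<phi> (t a)) ` A) = c a + \<phi> (t a)"
    using ex[of "\<lambda>a. c a + \<phi> (t a)"] by auto
  obtain b where b: "b \<in> A" "Max ((\<lambda>a. c a - \<phi> (t a)) ` A) = c b - \<phi> (t b)"
    using ex[of "\<lambda>a. c a - \<phi> (t a)"] by auto
  have p: "c x + t x \<le> Max ((\<lambda>a. c a + t a) ` A)" and m: "c x - t x \<le> Max ((\<lambda>a. c a - t a) ` A)"
    if "x \<in> A" for x using that A by (auto intro!: Max_ge)
  show "Max ((\<lambda>a. c a + \<phi> (t a)) ` A) + Max ((\<lambda>a. c a - \<phi> (t a)) ` A)
     \<le> Max ((\<lambda>a. c a + t a) ` A) + Max ((\<lambda>a. c a - t a) ` A)"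
    using p[OF a(1)] m[OF a(1)] p[OF b(1)] m[OF b(1)] \<phi>(1)[of "t a" "t b"] a(2) b(2) by linarith
  show "Max ((\<lambda>a. c a + \<phi> (t a)) ` A) \<le> max (Max ((\<lambda>a. c a + t a) ` A)) (Max ((\<lambda>a. c a - t a) ` A))"
    using p[OF a(1)] m[OF a(1)] \<phi>(1)[of "t a" 0] \<phi>(2) a(2) by linarith
  show "Max ((\<lambda>a. c a - \<phi> (t a)) ` A) \<le> max (Max ((\<lambda>a. c a + t a) ` A)) (Max ((\<lambda>a. c a - t a) ` A))"
    using p[OF b(1)] m[OF b(1)] \<phi>(1)[of "t b" 0] \<phi>(2) b(2) by linarith
qed

text \<open>The contraction principle of Ledoux and Talagrand, one index at a time. The offset
  \<open>c\<close> is generalized because the term of the index split off moves into it; in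
  \<open>contraction_step\<close> the offset is then \<open>c\<close> plus the sum over the other
  indices.\<close>

lemma rademacher_contraction:
  fixes F \<phi> :: "real \<Rightarrow> real"
  assumes F: "convex_on UNIV F" "mono F" and A: "finite A" "A \<noteq> {}" and J: "finite J"
    and \<phi>: "\<And>u v. \<bar>\<phi> u - \<phi> v\<bar> \<le> \<bar>u - v\<bar>" "\<phi> 0 = 0"
  shows "(\<Sum>E\<in>Pow J. F (Max ((\<lambda>a. c a + (\<Sum>j\<in>J. rsign E j * \<phi> (t a j))) ` A)))
       \<le> (\<Sum>E\<in>Pow J. F (Max ((\<lambda>a. c a + (\<Sum>j\<in>J. rsign E j * t a j)) ` A)))"
  using J
proof (induction J arbitrary: c)
  case (insert j J)
  let ?S = "\<lambda>E a. \<Sum>i\<in>J. rsign E i * t a i" and ?P = "\<lambda>E a. \<Sum>i\<in>J. rsign E i * \<phi> (t a i)"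
  have split: "(\<Sum>E\<in>Pow (insert j J). F (Max ((\<lambda>a. c a + (\<Sum>i\<in>insert j J. rsign E i * s a i)) ` A)))
      = (\<Sum>E\<in>Pow J. F (Max ((\<lambda>a. (c a + s a j) + (\<Sum>i\<in>J. rsign E i * s a i)) ` A))
                  + F (Max ((\<lambda>a. (c a - s a j) + (\<Sum>i\<in>J. rsign E i * s a i)) ` A)))" for s
    unfolding sum_Pow_insert[OF insert.hyps]
  proof (intro sum.cong refl)
    fix E assume "E \<in> Pow J"
    then have "E \<subseteq> J" by simp
    note rsign_sum_insert[OF insert.hyps this]
    then show "F (Max ((\<lambda>a. c a + (\<Sum>i\<in>insert j J. rsign (insert j E) i * s a i)) ` A))
        + F (Max ((\<lambda>a. c a + (\<Sum>i\<in>insert j J. rsign E i * s a i)) ` A))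
        = F (Max ((\<lambda>a. (c a + s a j) + (\<Sum>i\<in>J. rsign E i * s a i)) ` A))
        + F (Max ((\<lambda>a. (c a - s a j) + (\<Sum>i\<in>J. rsign E i * s a i)) ` A))"
      by (simp only: add.assoc diff_conv_add_uminus)
  qed
  have "(\<Sum>E\<in>Pow (insert j J). F (Max ((\<lambda>a. c a + (\<Sum>i\<in>insert j J. rsign E i * \<phi> (t a i))) ` A)))
      = (\<Sum>E\<in>Pow J. F (Max ((\<lambda>a. (c a + \<phi> (t a j)) + ?P E a) ` A))
                  + F (Max ((\<lambda>a. (c a - \<phi> (t a j)) + ?P E a) ` A)))"
    by (rule split)
  also have "\<dots> \<le> (\<Sum>E\<in>Pow J. F (Max ((\<lambda>a. (c a + \<phi> (t a j)) + ?S E a) ` A))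
                  + F (Max ((\<lambda>a. (c a - \<phi> (t a j)) + ?S E a) ` A)))"
    unfolding sum.distrib by (intro add_mono insert.IH)
  also have "\<dots> \<le> (\<Sum>E\<in>Pow J. F (Max ((\<lambda>a. (c a + t a j) + ?S E a) ` A))
                  + F (Max ((\<lambda>a. (c a - t a j) + ?S E a) ` A)))"
    using contraction_step[OF F A \<phi>, of "\<lambda>a. c a + ?S _ a" "\<lambda>a. t a j"]
    by (intro sum_mono) (simp add: algebra_simps)
  also have "\<dots> = (\<Sum>E\<in>Pow (insert j J). F (Max ((\<lambda>a. c a + (\<Sum>i\<in>insert j J. rsign E i * t a i)) ` A)))"
    by (rule split[symmetric])
  finally show ?case .
qed simp

text \<open>Termwise comparison of power series: the odd terms cancel, and
  \<open>fact (2 * n)\<close> is at least \<open>2 ^ n * fact n\<close>.\<close>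

lemma exp_add_exp_minus_le: "exp x + exp (- x) \<le> 2 * exp (x\<^sup>2 / 2 :: real)"
proof -
  have fact: "2 ^ n * fact n \<le> (fact (2 * n) :: real)" for n
  proof (induction n)
    case (Suc n)
    have "2 ^ Suc n * fact (Suc n) = (2 * (real n + 1)) * (2 ^ n * fact n)" by simp
    also have "\<dots> \<le> ((2 * real n + 2) * (2 * real n + 1)) * fact (2 * n)"
      using Suc by (intro mult_mono) (auto simp: algebra_simps)
    also have "\<dots> = fact (2 * Suc n)" by (simp add: algebra_simps)
    finally show ?case .
  qed simp
  have "(\<lambda>n. x ^ n /\<^sub>R fact n + (- x) ^ n /\<^sub>R fact n) sums (exp x + exp (- x))"
    by (intro sums_add exp_converges)
  then have "(\<lambda>n. x ^ (2 * n) /\<^sub>R fact (2 * n) + (- x) ^ (2 * n) /\<^sub>R fact (2 * n)) sums (exp x + exp (- x))"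
    by (subst sums_mono_reindex[of "\<lambda>n. 2 * n" "\<lambda>n. x ^ n /\<^sub>R fact n + (- x) ^ n /\<^sub>R fact n"])
       (auto simp: strict_mono_def power_minus_odd dvd_def image_iff)
  moreover have "(\<lambda>n. 2 * ((x\<^sup>2 / 2) ^ n /\<^sub>R fact n)) sums (2 * exp (x\<^sup>2 / 2))"
    by (intro sums_mult exp_converges)
  ultimately show ?thesis
  proof (rule sums_le[rotated])
    fix n
    have "x ^ (2 * n) / fact (2 * n) \<le> x ^ (2 * n) / (2 ^ n * fact n)"
      by (intro divide_left_mono fact) auto
    moreover have "x ^ (2 * n) /\<^sub>R fact (2 * n) + (- x) ^ (2 * n) /\<^sub>R fact (2 * n)
        = 2 * (x ^ (2 * n) / fact (2 * n))"
    proof -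
      have "(- x) ^ (2 * n) = x ^ (2 * n)" by simp
      then show ?thesis by (simp only: real_scaleR_def divide_inverse_commute)
    qed
    moreover have "(x\<^sup>2 / 2) ^ n /\<^sub>R fact n = x ^ (2 * n) / (2 ^ n * fact n)"
    proof -
      have "(x\<^sup>2 / 2) ^ n = x ^ (2 * n) / 2 ^ n" by (simp add: power_divide flip: power_mult)
      then show ?thesis
        by (simp only: real_scaleR_def divide_inverse inverse_mult_distrib mult.left_commute mult.commute)
    qed
    ultimately show "x ^ (2 * n) /\<^sub>R fact (2 * n) + (- x) ^ (2 * n) /\<^sub>R fact (2 * n)
        \<le> 2 * ((x\<^sup>2 / 2) ^ n /\<^sub>R fact n)"
      by linarith
  qed
qed

lemma rademacher_exp_moment:
  assumes "finite J"
  shows "(\<Sum>E\<in>Pow J. exp (\<Sum>j\<in>J. rsign E j * a j)) \<le> 2 ^ card J * exp ((\<Sum>j\<in>J. (a j)\<^sup>2) / 2)"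
  using assms
proof (induction J)
  case (insert j J)
  let ?T = "\<Sum>E\<in>Pow J. exp (\<Sum>j\<in>J. rsign E j * a j)"
  have "(\<Sum>E\<in>Pow (insert j J). exp (\<Sum>i\<in>insert j J. rsign E i * a i))
      = (\<Sum>E\<in>Pow J. (exp (a j) + exp (- a j)) * exp (\<Sum>j\<in>J. rsign E j * a j))"
    unfolding sum_Pow_insert[OF insert.hyps] using insert.hyps
    by (intro sum.cong refl) (simp add: rsign_sum_insert exp_add[symmetric] distrib_right del: sum.insert)
  also have "\<dots> = (exp (a j) + exp (- a j)) * ?T" by (simp add: sum_distrib_left)
  also have "\<dots> \<le> (2 * exp ((a j)\<^sup>2 / 2)) * (2 ^ card J * exp ((\<Sum>j\<in>J. (a j)\<^sup>2) / 2))"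
    by (intro mult_mono insert.IH exp_add_exp_minus_le) (auto intro!: sum_nonneg)
  also have "\<dots> = 2 ^ card (insert j J) * exp ((\<Sum>j\<in>insert j J. (a j)\<^sup>2) / 2)"
    using insert.hyps by (simp add: exp_add[symmetric] add_divide_distrib)
  finally show ?case .
qed simp

text \<open>Follows from the exponential moment at \<open>\<lambda> = \<surd>r / \<sigma>\<close>, because \<open>y \<le> exp y\<close>
  gives \<open>\<bar>s\<bar> powr r \<le> (r / \<lambda>) powr r * exp (\<lambda> * \<bar>s\<bar>)\<close>.\<close>

lemma khintchine:
  assumes J: "finite J" and r: "r > 0"
  shows "(\<Sum>E\<in>Pow J. \<bar>\<Sum>j\<in>J. rsign E j * a j\<bar> powr r)
       \<le> 2 ^ card J * (2 * (exp 1 * r) powr (r / 2) * (\<Sum>j\<in>J. (a j)\<^sup>2) powr (r / 2))"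
proof (cases "(\<Sum>j\<in>J. (a j)\<^sup>2) = 0")
  case True
  then have "\<forall>j\<in>J. a j = 0" using J by (subst (asm) sum_nonneg_eq_0_iff) auto
  then show ?thesis by simp
next
  case False
  define v where "v = (\<Sum>j\<in>J. (a j)\<^sup>2)"
  define l where "l = sqrt (r / v)"
  have v: "v > 0" using False sum_nonneg[of J "\<lambda>j. (a j)\<^sup>2"] by (auto simp: v_def less_le)
  have l: "l > 0" "l\<^sup>2 = r / v" using v r by (auto simp: l_def)
  have bound: "\<bar>s\<bar> powr r \<le> (r / l) powr r * (exp (l * s) + exp (l * (- s)))" for s
  proof -
    have "\<bar>s\<bar> = (r / l) * (l * \<bar>s\<bar> / r)" using l r by simp
    also have "\<dots> powr r = (r / l) powr r * (l * \<bar>s\<bar> / r) powr r"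
      by (rule powr_mult)
    also have "\<dots> \<le> (r / l) powr r * exp (l * \<bar>s\<bar> / r) powr r"
      using l r by (intro mult_left_mono powr_mono2)
        (auto intro: order.trans[OF _ exp_ge_add_one_self])
    also have "exp (l * \<bar>s\<bar> / r) powr r = exp (l * \<bar>s\<bar>)" using r by (simp add: powr_def)
    also have "\<dots> \<le> exp (l * s) + exp (l * (- s))" by (cases "s \<ge> 0") (auto simp: add_increasing)
    finally show ?thesis by (simp add: mult_left_mono)
  qed
  \<comment> \<open>\<open>c\<close> stands for 1 or -1, so that one computation covers both
    exponentials in \<open>bound\<close>.\<close>
  have half: "(\<Sum>E\<in>Pow J. exp (l * (c * (\<Sum>j\<in>J. rsign E j * a j)))) \<le> 2 ^ card J * exp (r / 2)"
    if "c\<^sup>2 = 1" for c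
  proof -
    have "(\<Sum>E\<in>Pow J. exp (l * (c * (\<Sum>j\<in>J. rsign E j * a j))))
        = (\<Sum>E\<in>Pow J. exp (\<Sum>j\<in>J. rsign E j * (l * c * a j)))"
      by (simp add: sum_distrib_left algebra_simps)
    also have "\<dots> \<le> 2 ^ card J * exp ((\<Sum>j\<in>J. (l * c * a j)\<^sup>2) / 2)"
      by (rule rademacher_exp_moment[OF J])
    also have "(\<Sum>j\<in>J. (l * c * a j)\<^sup>2) = (r / v) * v"
    proof -
      have "(\<Sum>j\<in>J. (l * c * a j)\<^sup>2) = (\<Sum>j\<in>J. (r / v) * (a j)\<^sup>2)"
        using that l(2) by (simp add: power_mult_distrib)
      then show ?thesis by (simp only: sum_distrib_left[symmetric] v_def[symmetric])
    qed
    also have "(r / v) * v = r" using v by simp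
    finally show ?thesis .
  qed
  have "(\<Sum>E\<in>Pow J. \<bar>\<Sum>j\<in>J. rsign E j * a j\<bar> powr r)
      \<le> (\<Sum>E\<in>Pow J. (r / l) powr r * (exp (l * (1 * (\<Sum>j\<in>J. rsign E j * a j)))
            + exp (l * ((-1) * (\<Sum>j\<in>J. rsign E j * a j)))))"
    using bound by (intro sum_mono) simp
  also have "\<dots> = (r / l) powr r * ((\<Sum>E\<in>Pow J. exp (l * (1 * (\<Sum>j\<in>J. rsign E j * a j))))
      + (\<Sum>E\<in>Pow J. exp (l * ((-1) * (\<Sum>j\<in>J. rsign E j * a j)))))"
    by (simp only: sum_distrib_left[symmetric] sum.distrib)
  also have "\<dots> \<le> (r / l) powr r * (2 ^ card J * exp (r / 2) + 2 ^ card J * exp (r / 2))"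
    by (intro mult_left_mono add_mono half) auto
  \<comment> \<open>At this \<open>l\<close> the prefactor and \<open>exp (r / 2)\<close> combine to
    the constant \<open>exp 1 * r\<close> of the statement.\<close>
  also have "(r / l) powr r = (r * v) powr (r / 2)"
  proof -
    have "r / l = sqrt (r * v)"
      using v r by (simp add: l_def real_sqrt_divide real_sqrt_mult field_simps)
    also have "\<dots> = (r * v) powr (1 / 2)" using v r by (simp add: powr_half_sqrt)
    finally show ?thesis by (simp add: powr_powr)
  qed
  also have "(r * v) powr (r / 2) * (2 ^ card J * exp (r / 2) + 2 ^ card J * exp (r / 2))
      = 2 ^ card J * (2 * (exp 1 * r) powr (r / 2) * v powr (r / 2))"
    using v r by (simp add: powr_mult exp_powr_real)
  finally show ?thesis by (simp add: v_def)
qed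

text \<open>These are the test functions \<open>F\<close> of all moment arguments below. Absolute
  powers would be convex but not monotone, and both the contraction principle and the comparison of
  maxima need monotonicity.\<close>

lemma convex_on_pos_part_powr:
  assumes "s \<ge> 1"
  shows "convex_on UNIV (\<lambda>x::real. max 0 x powr s)"
proof (rule convex_onI)
  fix t x y :: real
  assume t: "0 < t" "t < 1"
  \<comment> \<open>\<open>powr_convex\<close> is applied to positive arguments only; if one
    argument vanishes, this scaling bound takes its place.\<close>
  have scale: "(u * z) powr s \<le> u * z powr s" if "0 < u" "u < 1" "z \<ge> 0" for u z :: real
  proof -
    have "u powr s \<le> u powr 1" using that assms by (intro powr_mono') auto
    then show ?thesis using that by (simp add: powr_mult mult_right_mono)
  qed
  define a b where "a = max 0 x" and "b = max 0 y"
  have ab: "a \<ge> 0" "b \<ge> 0" by (auto simp: a_def b_def)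
  have "max 0 ((1 - t) * x + t * y) \<le> (1 - t) * a + t * b"
  proof -
    have "(1 - t) * x \<le> (1 - t) * a" "t * y \<le> t * b" "0 \<le> (1 - t) * a" "0 \<le> t * b"
      using t ab by (auto simp: a_def b_def intro: mult_left_mono)
    then show ?thesis by linarith
  qed
  then have "max 0 ((1 - t) * x + t * y) powr s \<le> ((1 - t) * a + t * b) powr s"
    using assms by (intro powr_mono2) auto
  also have "\<dots> \<le> (1 - t) * a powr s + t * b powr s"
  proof (cases "a = 0 \<or> b = 0")
    case True
    then show ?thesis using scale[of t b] scale[of "1 - t" a] t ab by auto
  next
    case False
    then show ?thesis
      using convex_onD[OF powr_convex[OF assms], of t a b] t ab by auto
  qed
  finally show "max 0 ((1 - t) *\<^sub>R x + t *\<^sub>R y) powr s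
      \<le> (1 - t) * max 0 x powr s + t * max 0 y powr s"
    by (simp add: a_def b_def)
qed simp

lemma mono_pos_part_powr: "s \<ge> 0 \<Longrightarrow> mono (\<lambda>x::real. max 0 x powr s)"
  by (intro monoI powr_mono2) auto

text \<open>The power mean inequality: Jensen's inequality with the equal weights
  \<open>1 / card J\<close>, multiplied by \<open>m powr s\<close>.\<close>

lemma sum_powr_le:
  assumes J: "finite J" "J \<noteq> {}" and s: "s \<ge> 1" and f: "\<And>j. j \<in> J \<Longrightarrow> f j \<ge> (0::real)"
  shows "(\<Sum>j\<in>J. f j) powr s \<le> real (card J) powr (s - 1) * (\<Sum>j\<in>J. f j powr s)"
proof -
  define m where "m = real (card J)"
  have m: "m > 0" using J by (auto simp: m_def card_gt_0_iff)
  have "max 0 (\<Sum>j\<in>J. (1 / m) *\<^sub>R f j) powr s \<le> (\<Sum>j\<in>J. (1 / m) * max 0 (f j) powr s)"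
    using J m by (intro convex_on_sum[OF _ _ convex_on_pos_part_powr[OF s]]) (auto simp: m_def)
  moreover have "(\<Sum>j\<in>J. (1 / m) * max 0 (f j) powr s) = (1 / m) * (\<Sum>j\<in>J. f j powr s)"
    using f unfolding sum_distrib_left by (intro sum.cong) (auto simp: max_def)
  moreover have "max 0 (\<Sum>j\<in>J. (1 / m) *\<^sub>R f j) = (1 / m) * (\<Sum>j\<in>J. f j)"
  proof -
    have "(\<Sum>j\<in>J. (1 / m) *\<^sub>R f j) = (1 / m) * (\<Sum>j\<in>J. f j)" by (simp add: sum_distrib_left)
    moreover have "0 \<le> (1 / m) * (\<Sum>j\<in>J. f j)" using f m by (intro mult_nonneg_nonneg sum_nonneg) auto
    ultimately show ?thesis by linarith
  qed
  ultimately have "((1 / m) * (\<Sum>j\<in>J. f j)) powr s \<le> (1 / m) * (\<Sum>j\<in>J. f j powr s)" by simp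
  then have "m powr s * ((1 / m) * (\<Sum>j\<in>J. f j)) powr s \<le> m powr s * ((1 / m) * (\<Sum>j\<in>J. f j powr s))"
    by (intro mult_left_mono) auto
  moreover have "m powr s * ((1 / m) * (\<Sum>j\<in>J. f j)) powr s = (m * ((1 / m) * (\<Sum>j\<in>J. f j))) powr s"
    by (simp only: powr_mult)
  moreover have "m * ((1 / m) * (\<Sum>j\<in>J. f j)) = (\<Sum>j\<in>J. f j)" using m by simp
  moreover have "m powr s * ((1 / m) * (\<Sum>j\<in>J. f j powr s)) = m powr (s - 1) * (\<Sum>j\<in>J. f j powr s)"
    using m by (simp add: powr_diff)
  ultimately show ?thesis by (simp only: m_def)
qed

section \<open>Symmetrization\<close>

lemma borel_measurable_mono_comp:
  fixes F :: "real \<Rightarrow> real"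
  assumes "mono F" "g \<in> borel_measurable M"
  shows "(\<lambda>x. F (g x)) \<in> borel_measurable M"
  using measurable_compose[OF assms(2) borel_measurable_mono[OF assms(1)]] .

text \<open>With nonnegative integrals the moment bounds can be chained without asking for
  integrability at each stage; boundedness of \<open>g\<close> settles it for this one application
  of Jensen's inequality. A lower bound \<open>c\<close> is allowed in place of the expectation
  because the ghost argument knows the expectation only up to an inequality.\<close>

lemma (in prob_space) nn_jensen:
  fixes F :: "real \<Rightarrow> real"
  assumes F: "convex_on UNIV F" "mono F" "\<And>x. F x \<ge> 0"
    and g: "g \<in> borel_measurable M" "\<And>x. x \<in> space M \<Longrightarrow> \<bar>g x\<bar> \<le> C" and c: "c \<le> expectation g"
  shows "ennreal (F c) \<le> (\<integral>\<^sup>+ x. ennreal (F (g x)) \<partial>M)"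
proof -
  have [simp]: "integrable M g"
    using g by (intro integrable_const_bound[of _ C]) auto
  have Fg: "integrable M (\<lambda>x. F (g x))"
  proof (rule integrable_const_bound[of _ "F C"])
    show "AE x in M. norm (F (g x)) \<le> F C"
      using g(2) F(3) by (intro AE_I2) (auto intro!: monoD[OF F(2)] dest!: g(2))
  qed (rule borel_measurable_mono_comp[OF F(2) g(1)])
  have "F c \<le> F (expectation g)" using c by (rule monoD[OF F(2)])
  also have "\<dots> \<le> expectation (\<lambda>x. F (g x))"
    by (rule jensens_inequality[where I = UNIV]) (use Fg F in auto)
  finally show ?thesis using Fg F(3) by (simp add: nn_integral_eq_integral)
qed

text \<open>Serves to restrict a product to some of its coordinates, to rename coordinates, and to
  exchange sample and ghost points.\<close>

lemma nn_integral_PiM_reindex: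
  assumes Mu: "prob_space Mu" and f: "inj_on f I" "f \<in> I \<rightarrow> K"
    and g: "g \<in> borel_measurable (PiM I (\<lambda>_. Mu))"
  shows "(\<integral>\<^sup>+\<omega>. g (\<lambda>n\<in>I. \<omega> (f n)) \<partial>PiM K (\<lambda>_. Mu)) = (\<integral>\<^sup>+\<omega>. g \<omega> \<partial>PiM I (\<lambda>_. Mu))"
proof -
  have "(\<integral>\<^sup>+\<omega>. g \<omega> \<partial>PiM I (\<lambda>_. Mu))
      = (\<integral>\<^sup>+\<omega>. g \<omega> \<partial>distr (PiM K (\<lambda>_. Mu)) (PiM I (\<lambda>_. Mu)) (\<lambda>\<omega>. \<lambda>n\<in>I. \<omega> (f n)))"
    using distr_PiM_reindex[of K "\<lambda>_. Mu", OF Mu f] by simp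
  also have "\<dots> = (\<integral>\<^sup>+\<omega>. g (\<lambda>n\<in>I. \<omega> (f n)) \<partial>PiM K (\<lambda>_. Mu))"
    using f g by (intro nn_integral_distr) (auto intro!: measurable_restrict measurable_component_singleton)
  finally show ?thesis ..
qed

lemma nn_integral_PiM_component:
  assumes "prob_space Mu" "j \<in> J" "g \<in> borel_measurable Mu"
  shows "(\<integral>\<^sup>+\<omega>. g (\<omega> j) \<partial>PiM J (\<lambda>_. Mu)) = (\<integral>\<^sup>+y. g y \<partial>Mu)"
proof -
  interpret prob_space Mu by fact
  interpret product_prob_space "\<lambda>_. Mu" J by unfold_locales
  have "(\<integral>\<^sup>+y. g y \<partial>Mu) = (\<integral>\<^sup>+y. g y \<partial>distr (PiM J (\<lambda>_. Mu)) Mu (\<lambda>\<omega>. \<omega> j))"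
    by (simp add: PiM_component[OF assms(2)])
  also have "\<dots> = (\<integral>\<^sup>+\<omega>. g (\<omega> j) \<partial>PiM J (\<lambda>_. Mu))"
    using assms by (intro nn_integral_distr) auto
  finally show ?thesis ..
qed

lemma convex_on_comp_scale:
  fixes F :: "real \<Rightarrow> real"
  assumes "convex_on UNIV F"
  shows "convex_on UNIV (\<lambda>x. F (c * x))"
proof (rule convex_onI)
  fix t x y :: real assume "0 < t" "t < 1"
  then show "F (c * ((1 - t) *\<^sub>R x + t *\<^sub>R y)) \<le> (1 - t) * F (c * x) + t * F (c * y)"
    using convex_onD[OF assms, of t "c * x" "c * y"] by (simp add: algebra_simps)
qed simp

text \<open>The factor \<open>N\<close> is averaged and \<open>Mu\<close> is sampled. They are kept
  apart because the locale is used twice: with \<open>N = Mu\<close> for the sample of columns, and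
  then, with these columns fixed, with \<open>N\<close> the uniform measure on the finite set of
  columns. \<open>K\<close> secures integrability and enters none of the moment bounds.\<close>

locale bounded_field =
  N: prob_space N + Mu: prob_space Mu for N :: "'x measure" and Mu :: "'y measure" +
  fixes W :: "'x \<times> 'y \<Rightarrow> real" and K :: real
  assumes W_meas [measurable]: "W \<in> borel_measurable (N \<Otimes>\<^sub>M Mu)"
    and W_bound: "\<bar>W z\<bar> \<le> K"
begin

lemma W_section [measurable]: "y \<in> space Mu \<Longrightarrow> (\<lambda>x. W (x, y)) \<in> borel_measurable N"
  by measurable

lemma sum_W_bound: "finite T \<Longrightarrow> \<bar>\<Sum>j\<in>T. c j * W (x, \<omega> j)\<bar> \<le> (\<Sum>j\<in>T. \<bar>c j\<bar>) * K"
proof -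
  have "\<bar>\<Sum>j\<in>T. c j * W (x, \<omega> j)\<bar> \<le> (\<Sum>j\<in>T. \<bar>c j\<bar> * \<bar>W (x, \<omega> j)\<bar>)"
    by (rule order.trans[OF sum_abs]) (simp add: abs_mult)
  also have "\<dots> \<le> (\<Sum>j\<in>T. \<bar>c j\<bar> * K)" by (intro sum_mono mult_left_mono W_bound) auto
  finally show ?thesis by (simp add: sum_distrib_right)
qed

lemma K_nonneg: "K \<ge> 0" using W_bound[of undefined] by linarith

text \<open>The supremum over row sets of their mass against the columns in \<open>T\<close>: the
  best row set collects the rows with positive sum.\<close>

definition pos_mass :: "'j set \<Rightarrow> ('j \<Rightarrow> 'y) \<Rightarrow> real" where
  "pos_mass T \<omega> = (\<integral>x. max 0 (\<Sum>j\<in>T. W (x, \<omega> j)) \<partial>N)"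

definition max_mass :: "'j set \<Rightarrow> ('j \<Rightarrow> 'y) \<Rightarrow> real" where
  "max_mass J \<omega> = Max ((\<lambda>T. pos_mass T \<omega>) ` Pow J)"

definition rademacher_mass :: "'j set \<Rightarrow> 'j set \<Rightarrow> ('j \<Rightarrow> 'y) \<Rightarrow> real" where
  "rademacher_mass J E \<omega> = (\<integral>x. \<bar>\<Sum>j\<in>J. rsign E j * W (x, \<omega> j)\<bar> \<partial>N)"

text \<open>The column \<open>y\<close> tested against the row set that is optimal for
  \<open>A\<close>. The value \<open>max_mass\<close> is attained at such a row set, and there are
  finitely many of them, indexed by subsets of the sample.\<close>

definition cut_mass :: "'k set \<Rightarrow> ('k \<Rightarrow> 'y) \<Rightarrow> 'y \<Rightarrow> real" where
  "cut_mass A \<omega> y = (\<integral>x. (if 0 < (\<Sum>k\<in>A. W (x, \<omega> k)) then W (x, y) else 0) \<partial>N)"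

definition cut_set :: "'k set \<Rightarrow> ('k \<Rightarrow> 'y) \<Rightarrow> 'x set" where
  "cut_set A \<omega> = {x \<in> space N. 0 < (\<Sum>k\<in>A. W (x, \<omega> k))}"

lemma measurable_W_component:
  "k \<in> I \<Longrightarrow> (\<lambda>(\<omega>, x). W (x, \<omega> k)) \<in> borel_measurable (PiM I (\<lambda>_. Mu) \<Otimes>\<^sub>M N)"
  by measurable

lemma measurable_pos_mass: "finite J \<Longrightarrow> T \<subseteq> J \<Longrightarrow> pos_mass T \<in> borel_measurable (PiM J (\<lambda>_. Mu))"
  unfolding pos_mass_def[abs_def]
  by (rule N.borel_measurable_lebesgue_integral) (use measurable_W_component[of _ J] in \<open>auto simp: split_beta' intro!: borel_measurable_max borel_measurable_sum\<close>)

lemma measurable_max_mass: "finite J \<Longrightarrow> max_mass J \<in> borel_measurable (PiM J (\<lambda>_. Mu))"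
  unfolding max_mass_def[abs_def] by (intro borel_measurable_Max measurable_pos_mass) auto

lemma measurable_rademacher_mass:
  "finite J \<Longrightarrow> rademacher_mass J E \<in> borel_measurable (PiM J (\<lambda>_. Mu))"
  unfolding rademacher_mass_def[abs_def]
  by (rule N.borel_measurable_lebesgue_integral) (use measurable_W_component[of _ J] in \<open>auto simp: split_beta' intro!: borel_measurable_abs borel_measurable_sum borel_measurable_times\<close>)

lemma measurable_cut_mass:
  assumes "finite I" "A \<subseteq> I" "k \<in> I"
  shows "(\<lambda>\<omega>. cut_mass A \<omega> (\<omega> k)) \<in> borel_measurable (PiM I (\<lambda>_. Mu))"
proof -
  have [measurable]: "(\<lambda>z. W (snd z, fst z k)) \<in> borel_measurable (PiM I (\<lambda>_. Mu) \<Otimes>\<^sub>M N)" if "k \<in> I" for k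
    using measurable_W_component[OF that] by (simp add: split_beta')
  have [measurable]: "(\<lambda>z. \<Sum>k\<in>A. W (snd z, fst z k)) \<in> borel_measurable (PiM I (\<lambda>_. Mu) \<Otimes>\<^sub>M N)"
    using assms by (intro borel_measurable_sum) auto
  have [simp]: "k \<in> I" by fact
  show ?thesis unfolding cut_mass_def[abs_def]
    by (rule N.borel_measurable_lebesgue_integral) (simp add: split_beta')
qed

lemma cut_mass_section:
  assumes "finite A" "\<And>k. k \<in> A \<Longrightarrow> \<omega> k \<in> space Mu" and y [simp]: "y \<in> space Mu"
  shows "cut_set A \<omega> \<in> sets N"
    and "cut_mass A \<omega> y = (\<integral>x. indicator (cut_set A \<omega>) x * W (x, y) \<partial>N)"
    and "\<bar>cut_mass A \<omega> y\<bar> \<le> K"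
    and "integrable N (\<lambda>x. if 0 < (\<Sum>k\<in>A. W (x, \<omega> k)) then W (x, y) else 0)"
proof -
  have [measurable]: "(\<lambda>x. \<Sum>k\<in>A. W (x, \<omega> k)) \<in> borel_measurable N"
    using assms by (intro borel_measurable_sum W_section) auto
  show "cut_set A \<omega> \<in> sets N" unfolding cut_set_def by measurable
  show *: "integrable N (\<lambda>x. if 0 < (\<Sum>k\<in>A. W (x, \<omega> k)) then W (x, y) else 0)"
    using W_bound K_nonneg by (intro N.integrable_const_bound[of _ K]) auto
  show "cut_mass A \<omega> y = (\<integral>x. indicator (cut_set A \<omega>) x * W (x, y) \<partial>N)"
    unfolding cut_mass_def cut_set_def by (intro Bochner_Integration.integral_cong) (auto simp: indicator_def)
  have "\<bar>cut_mass A \<omega> y\<bar> \<le> (\<integral>x. K \<partial>N)"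
    unfolding cut_mass_def using * W_bound K_nonneg
    by (intro order.trans[OF integral_abs_bound] integral_mono integrable_abs) auto
  then show "\<bar>cut_mass A \<omega> y\<bar> \<le> K" by (simp add: N.prob_space)
qed

section \<open>Ghost sample and symmetrization\<close>

definition double_set :: "'j set \<Rightarrow> ('j \<times> bool) set" where
  "double_set J = J \<times> UNIV"

text \<open>For a fixed row set, the maximum over column sets of the sample sum is the sum of
  positive parts. The deviation of these parts from their ghost values is maximized here over row
  sets; for \<open>E = J\<close> all signs are 1 and sample minus ghost remains.\<close>

definition ghost_dev :: "'j set \<Rightarrow> 'j set \<Rightarrow> ('j \<times> bool \<Rightarrow> 'y) \<Rightarrow> real" where
  "ghost_dev J E \<omega> = Max ((\<lambda>A. \<Sum>j\<in>J. rsign E j *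
     (max 0 (cut_mass A \<omega> (\<omega> (j, True))) - max 0 (cut_mass A \<omega> (\<omega> (j, False))))) ` Pow (double_set J))"

lemma finite_double_set [simp]: "finite J \<Longrightarrow> finite (double_set J)"
  by (simp add: double_set_def)

lemma measurable_ghost_dev:
  assumes "finite J"
  shows "ghost_dev J E \<in> borel_measurable (PiM (double_set J) (\<lambda>_. Mu))"
  unfolding ghost_dev_def[abs_def] using assms
  by (intro borel_measurable_Max borel_measurable_sum borel_measurable_times borel_measurable_diff
      borel_measurable_max measurable_cut_mass borel_measurable_const) (auto simp: double_set_def)

text \<open>Swapping a sample point with its ghost merely permutes the finite family of sets
  \<open>cut_set A \<omega>\<close>; this is why that family is used instead of all measurable sets.\<close>

lemma ghost_dev_swap:
  assumes J: "finite J" and F: "mono F"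
  shows "(\<integral>\<^sup>+\<omega>. ennreal (F (ghost_dev J J \<omega>)) \<partial>PiM (double_set J) (\<lambda>_. Mu))
       = (\<integral>\<^sup>+\<omega>. ennreal (F (ghost_dev J E \<omega>)) \<partial>PiM (double_set J) (\<lambda>_. Mu))"
proof -
  define I where "I = double_set J"
  \<comment> \<open>\<open>f\<close> exchanges \<open>(j, True)\<close> and
    \<open>(j, False)\<close> exactly for the \<open>j\<close> outside \<open>E\<close>, where
    \<open>rsign E j\<close> is -1.\<close>
  define f where "f = (\<lambda>(j, b). (j, b = (j \<in> E)))"
  have inv: "f (f k) = k" for k by (auto simp: f_def split: prod.splits)
  have inj: "inj_on f A" for A by (rule inj_on_inverseI[of _ f]) (rule inv)
  have fI: "f k \<in> I" if "k \<in> I" for k using that by (auto simp: f_def I_def double_set_def)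
  have img: "f ` I = I" using inv fI by (auto simp: image_iff) metis
  have eq: "ghost_dev J J (\<lambda>n\<in>I. \<omega> (f n)) = ghost_dev J E \<omega>" for \<omega> :: "_ \<Rightarrow> 'y"
  proof -
    have cut: "cut_mass A (\<lambda>n\<in>I. \<omega> (f n)) = cut_mass (f ` A) \<omega>" if "A \<in> Pow I" for A
    proof -
      have "(\<Sum>k\<in>A. W (x, (\<lambda>n\<in>I. \<omega> (f n)) k)) = (\<Sum>k\<in>f ` A. W (x, \<omega> k))" for x
        unfolding sum.reindex[OF inj] using that by (intro sum.cong) auto
      then show ?thesis unfolding cut_mass_def[abs_def] by simp
    qed
    have pt: "(\<Sum>j\<in>J. rsign J j *
        (max 0 (cut_mass A (\<lambda>n\<in>I. \<omega> (f n)) ((\<lambda>n\<in>I. \<omega> (f n)) (j, True)))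
         - max 0 (cut_mass A (\<lambda>n\<in>I. \<omega> (f n)) ((\<lambda>n\<in>I. \<omega> (f n)) (j, False)))))
      = (\<Sum>j\<in>J. rsign E j *
        (max 0 (cut_mass (f ` A) \<omega> (\<omega> (j, True))) - max 0 (cut_mass (f ` A) \<omega> (\<omega> (j, False)))))"
      if "A \<in> Pow I" for A
      unfolding cut[OF that]
      by (intro sum.cong refl) (auto simp: I_def double_set_def rsign_def f_def)
    have "Pow I = (\<lambda>A. f ` A) ` Pow I" using image_Pow_surj[OF img] by simp
    then have "(\<lambda>A. \<Sum>j\<in>J. rsign E j *
        (max 0 (cut_mass A \<omega> (\<omega> (j, True))) - max 0 (cut_mass A \<omega> (\<omega> (j, False))))) ` Pow I
      = (\<lambda>A. \<Sum>j\<in>J. rsign E j *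
        (max 0 (cut_mass A \<omega> (\<omega> (j, True))) - max 0 (cut_mass A \<omega> (\<omega> (j, False))))) ` (\<lambda>A. f ` A) ` Pow I"
      by simp
    then show ?thesis
      unfolding ghost_dev_def I_def[symmetric] by (simp only: image_image pt cong: image_cong)
  qed
  have "(\<integral>\<^sup>+\<omega>. ennreal (F (ghost_dev J J \<omega>)) \<partial>PiM I (\<lambda>_. Mu))
      = (\<integral>\<^sup>+\<omega>. ennreal (F (ghost_dev J J (\<lambda>n\<in>I. \<omega> (f n)))) \<partial>PiM I (\<lambda>_. Mu))"
    using J fI by (intro nn_integral_PiM_reindex[symmetric] Mu.prob_space_axioms inj measurable_compose[OF _ measurable_ennreal]
        borel_measurable_mono_comp[OF F] measurable_ghost_dev[of J, folded I_def]) auto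
  then show ?thesis unfolding eq by (simp only: I_def)
qed

text \<open>For a row set that does not depend on the ghosts, each ghost term has mean at most
  \<open>B\<close>. Hence \<open>real (card J) * B\<close> may be replaced by a ghost sum, and
  Jensen's inequality moves the average over the ghosts outside \<open>F\<close>.\<close>

lemma max_mass_le_ghost_dev:
  fixes B :: real
  assumes J: "finite J" and F: "convex_on UNIV F" "mono F" "\<And>x. F x \<ge> 0"
    and B: "\<And>S. S \<in> sets N \<Longrightarrow> (\<integral>y. max 0 (\<integral>x. indicator S x * W (x, y) \<partial>N) \<partial>Mu) \<le> B"
  shows "(\<integral>\<^sup>+\<omega>. ennreal (F (max_mass J \<omega> - real (card J) * B)) \<partial>PiM J (\<lambda>_. Mu))
       \<le> (\<integral>\<^sup>+\<omega>. ennreal (F (ghost_dev J J \<omega>)) \<partial>PiM (double_set J) (\<lambda>_. Mu))"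
proof -
  define It where "It = J \<times> {True}"
  define If where "If = J \<times> {False}"
  have I: "double_set J = It \<union> If" "It \<inter> If = {}" "finite It" "finite If"
    using J by (auto simp: double_set_def It_def If_def)
  interpret P: product_prob_space "\<lambda>_::'a \<times> bool. Mu" UNIV by unfold_locales
  interpret Pf: prob_space "PiM If (\<lambda>_. Mu)" by (intro prob_space_PiM Mu.prob_space_axioms)
  have sig: "product_sigma_finite (\<lambda>_::'a \<times> bool. Mu)" by unfold_locales
  have ghost_meas: "(\<lambda>\<omega>. ennreal (F (ghost_dev J J \<omega>))) \<in> borel_measurable (PiM (It \<union> If) (\<lambda>_. Mu))"
    using measurable_ghost_dev[OF J, of J] unfolding I(1)
    by (intro measurable_compose[OF _ measurable_ennreal] borel_measurable_mono_comp[OF F(2)])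
  have inner: "ennreal (F (max_mass J (\<lambda>j\<in>J. x (j, True)) - real (card J) * B))
      \<le> (\<integral>\<^sup>+y. ennreal (F (ghost_dev J J (merge It If (x, y)))) \<partial>PiM If (\<lambda>_. Mu))"
    if x: "x \<in> space (PiM It (\<lambda>_. Mu))" for x
  proof -
    let ?m = "\<lambda>y. merge It If (x, y)"
    have xs: "x (j, True) \<in> space Mu" if "j \<in> J" for j
      using x that by (auto simp: space_PiM It_def)
    have ys: "y (j, False) \<in> space Mu" if "j \<in> J" "y \<in> space (PiM If (\<lambda>_. Mu))" for y j
      using that by (auto simp: space_PiM If_def)
    have mT: "?m y (j, True) = x (j, True)" if "j \<in> J" for y j
      using that by (simp add: merge_def It_def)
    have mF: "?m y (j, False) = y (j, False)" if "j \<in> J" for y j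
      using that by (simp add: merge_def It_def If_def)
    have m_meas: "?m \<in> measurable (PiM If (\<lambda>_. Mu)) (PiM (It \<union> If) (\<lambda>_. Mu))"
      using x by measurable
    obtain T where T: "T \<subseteq> J" "max_mass J (\<lambda>j\<in>J. x (j, True)) = pos_mass T (\<lambda>j\<in>J. x (j, True))"
    proof -
      have "max_mass J (\<lambda>j\<in>J. x (j, True)) \<in> (\<lambda>T. pos_mass T (\<lambda>j\<in>J. x (j, True))) ` Pow J"
        unfolding max_mass_def using J by (intro Max_in) auto
      then show ?thesis using that by auto
    qed
    \<comment> \<open>The row set optimal for \<open>T\<close> is determined by the sample alone. It
      stays fixed while the ghosts are averaged, so the bound \<open>B\<close> applies to
      it.\<close>
    define A where "A = T \<times> {True}"
    have A: "A \<subseteq> double_set J" "finite A" using T J by (auto simp: A_def double_set_def intro: finite_subset)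
    have As: "x k \<in> space Mu" if "k \<in> A" for k using that xs T by (auto simp: A_def)
    let ?c = "cut_mass A x"
    have cut_eq: "cut_mass A (?m y) = ?c" for y
    proof -
      have "(\<Sum>k\<in>A. W (z, ?m y k)) = (\<Sum>k\<in>A. W (z, x k))" for z
        using T mT by (intro sum.cong) (auto simp: A_def)
      then show ?thesis unfolding cut_mass_def[abs_def] by simp
    qed
    have "pos_mass T (\<lambda>j\<in>J. x (j, True)) = (\<integral>z. (\<Sum>j\<in>T. if 0 < (\<Sum>k\<in>A. W (z, x k)) then W (z, x (j, True)) else 0) \<partial>N)"
      unfolding pos_mass_def
    proof (intro Bochner_Integration.integral_cong refl)
      fix z
      have "(\<Sum>k\<in>A. W (z, x k)) = (\<Sum>j\<in>T. W (z, x (j, True)))"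
        unfolding A_def by (intro sum.reindex_bij_witness[of _ "\<lambda>j. (j, True)" fst]) auto
      moreover have "(\<Sum>j\<in>T. W (z, (\<lambda>j\<in>J. x (j, True)) j)) = (\<Sum>j\<in>T. W (z, x (j, True)))"
        using T by (intro sum.cong) auto
      ultimately show "max 0 (\<Sum>j\<in>T. W (z, (\<lambda>j\<in>J. x (j, True)) j))
          = (\<Sum>j\<in>T. if 0 < (\<Sum>k\<in>A. W (z, x k)) then W (z, x (j, True)) else 0)"
        by (cases "0 < (\<Sum>k\<in>A. W (z, x k))") (simp_all add: max_def)
    qed
    also have "\<dots> = (\<Sum>j\<in>T. ?c (x (j, True)))"
      unfolding cut_mass_def using A As xs T
      by (intro Bochner_Integration.integral_sum cut_mass_section(4)) auto
    also have "\<dots> \<le> (\<Sum>j\<in>T. max 0 (?c (x (j, True))))" by (intro sum_mono) auto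
    also have "\<dots> \<le> (\<Sum>j\<in>J. max 0 (?c (x (j, True))))" using T J by (intro sum_mono2) auto
    finally have upper: "max_mass J (\<lambda>j\<in>J. x (j, True)) \<le> (\<Sum>j\<in>J. max 0 (?c (x (j, True))))"
      using T by simp
    let ?g = "\<lambda>y. (\<Sum>j\<in>J. max 0 (?c (x (j, True))) - max 0 (?c (y (j, False))))"
    have c_bound: "\<bar>?c y\<bar> \<le> K" if "y \<in> space Mu" for y
      using A As that by (intro cut_mass_section(3)) auto
    have c_meas: "?c \<in> borel_measurable Mu"
    proof -
      have [measurable]: "(\<lambda>z. \<Sum>k\<in>A. W (z, x k)) \<in> borel_measurable N"
        using As by (intro borel_measurable_sum W_section) auto
      show ?thesis unfolding cut_mass_def[abs_def]
        by (rule N.borel_measurable_lebesgue_integral) (simp add: split_beta')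
    qed
    have comp_int: "integrable (PiM If (\<lambda>_. Mu)) (\<lambda>y. max 0 (?c (y (j, False))))"
      and comp_le: "(\<integral>y. max 0 (?c (y (j, False))) \<partial>PiM If (\<lambda>_. Mu)) \<le> B" if j: "j \<in> J" for j
    proof -
      have jf: "(j, False) \<in> If" using j by (simp add: If_def)
      interpret PI: product_prob_space "\<lambda>_. Mu" If by unfold_locales
      have [measurable]: "(\<lambda>y. ?c (y (j, False))) \<in> borel_measurable (PiM If (\<lambda>_. Mu))"
        using jf by (intro measurable_compose[OF _ c_meas]) auto
      show "integrable (PiM If (\<lambda>_. Mu)) (\<lambda>y. max 0 (?c (y (j, False))))"
        using c_bound ys[OF j] K_nonneg
        by (intro Pf.integrable_const_bound[of _ K] AE_I2) (auto simp: abs_le_iff)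
      have "(\<integral>y. max 0 (?c (y (j, False))) \<partial>PiM If (\<lambda>_. Mu))
          = (\<integral>y. max 0 (?c y) \<partial>distr (PiM If (\<lambda>_. Mu)) Mu (\<lambda>y. y (j, False)))"
        using jf c_meas by (intro integral_distr[symmetric]) auto
      also have "\<dots> = (\<integral>y. max 0 (?c y) \<partial>Mu)" by (simp add: PI.PiM_component[OF jf])
      also have "\<dots> = (\<integral>y. max 0 (\<integral>z. indicator (cut_set A x) z * W (z, y) \<partial>N) \<partial>Mu)"
        using A As by (intro Bochner_Integration.integral_cong refl) (simp add: cut_mass_section(2))
      also have "\<dots> \<le> B"
        using cut_mass_section(1)[OF A(2) As xs[OF j]] by (intro B) auto
      finally show "(\<integral>y. max 0 (?c (y (j, False))) \<partial>PiM If (\<lambda>_. Mu)) \<le> B" .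
    qed
    have "(\<integral>y. ?g y \<partial>PiM If (\<lambda>_. Mu))
        = (\<Sum>j\<in>J. max 0 (?c (x (j, True))) - (\<integral>y. max 0 (?c (y (j, False))) \<partial>PiM If (\<lambda>_. Mu)))"
      using comp_int by (simp add: Bochner_Integration.integral_sum Pf.prob_space)
    also have "\<dots> \<ge> (\<Sum>j\<in>J. max 0 (?c (x (j, True))) - B)"
      using comp_le by (intro sum_mono) auto
    finally have E_ge: "max_mass J (\<lambda>j\<in>J. x (j, True)) - real (card J) * B \<le> (\<integral>y. ?g y \<partial>PiM If (\<lambda>_. Mu))"
      using upper by (simp add: sum_subtractf)
    have g_bound: "\<bar>?g y\<bar> \<le> (\<Sum>j\<in>J. 2 * K)" if "y \<in> space (PiM If (\<lambda>_. Mu))" for y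
    proof (rule order.trans[OF sum_abs sum_mono])
      fix j assume j: "j \<in> J"
      show "\<bar>max 0 (?c (x (j, True))) - max 0 (?c (y (j, False)))\<bar> \<le> 2 * K"
        using c_bound[OF xs[OF j]] c_bound[OF ys[OF j that]] by linarith
    qed
    have "ennreal (F (max_mass J (\<lambda>j\<in>J. x (j, True)) - real (card J) * B))
        \<le> (\<integral>\<^sup>+y. ennreal (F (?g y)) \<partial>PiM If (\<lambda>_. Mu))"
      using comp_int g_bound by (intro Pf.nn_jensen[OF F _ _ E_ge]) auto
    also have "\<dots> \<le> (\<integral>\<^sup>+y. ennreal (F (ghost_dev J J (?m y))) \<partial>PiM If (\<lambda>_. Mu))"
    proof (intro nn_integral_mono ennreal_leI monoD[OF F(2)])
      fix y
      have "?g y = (\<Sum>j\<in>J. rsign J j *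
          (max 0 (cut_mass A (?m y) (?m y (j, True))) - max 0 (cut_mass A (?m y) (?m y (j, False)))))"
        by (intro sum.cong) (auto simp: rsign_def mT mF cut_eq)
      also have "\<dots> \<le> ghost_dev J J (?m y)"
        unfolding ghost_dev_def using A J by (intro Max_ge) auto
      finally show "?g y \<le> ghost_dev J J (?m y)" .
    qed
    finally show ?thesis .
  qed
  have red: "(\<lambda>\<omega>. ennreal (F (max_mass J \<omega> - real (card J) * B))) \<in> borel_measurable (PiM J (\<lambda>_. Mu))"
    using J by (intro measurable_compose[OF _ measurable_ennreal] borel_measurable_mono_comp[OF F(2)]
        borel_measurable_diff measurable_max_mass) auto
  have "(\<integral>\<^sup>+\<omega>. ennreal (F (max_mass J \<omega> - real (card J) * B)) \<partial>PiM J (\<lambda>_. Mu))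
      = (\<integral>\<^sup>+x. ennreal (F (max_mass J (\<lambda>j\<in>J. x (j, True)) - real (card J) * B)) \<partial>PiM It (\<lambda>_. Mu))"
    by (rule nn_integral_PiM_reindex[OF Mu.prob_space_axioms _ _ red, symmetric]) (auto simp: It_def inj_on_def)
  also have "\<dots> \<le> (\<integral>\<^sup>+x. (\<integral>\<^sup>+y. ennreal (F (ghost_dev J J (merge It If (x, y)))) \<partial>PiM If (\<lambda>_. Mu)) \<partial>PiM It (\<lambda>_. Mu))"
    by (intro nn_integral_mono inner)
  also have "\<dots> = (\<integral>\<^sup>+\<omega>. ennreal (F (ghost_dev J J \<omega>)) \<partial>PiM (double_set J) (\<lambda>_. Mu))"
    unfolding I(1) by (rule product_sigma_finite.product_nn_integral_fold[OF sig I(2-4) ghost_meas, symmetric])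
  finally show ?thesis .
qed

text \<open>Convexity separates sample from ghosts; the minus sign of the ghosts turns
  \<open>E\<close> into its complement. Contraction with \<open>max 0\<close> then leaves sums that
  are linear in the indicator of the row set, so the maximum over row sets is at most the integral
  of the absolute value, in which no row set occurs any more.\<close>

lemma sum_ghost_dev_le:
  assumes J: "finite J" and F: "convex_on UNIV F" "mono F"
    and \<omega>: "\<And>k. k \<in> double_set J \<Longrightarrow> \<omega> k \<in> space Mu"
  shows "(\<Sum>E\<in>Pow J. F (ghost_dev J E \<omega>))
    \<le> (\<Sum>E\<in>Pow J. F (2 * rademacher_mass J E (\<lambda>j\<in>J. \<omega> (j, True)))) / 2
     + (\<Sum>E\<in>Pow J. F (2 * rademacher_mass J E (\<lambda>j\<in>J. \<omega> (j, False)))) / 2"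
proof -
  let ?A = "Pow (double_set J)"
  let ?h = "\<lambda>b A j. cut_mass A \<omega> (\<omega> (j, b))"
  let ?P = "\<lambda>b E. Max ((\<lambda>A. \<Sum>j\<in>J. rsign E j * max 0 (?h b A j)) ` ?A)"
  let ?Q = "\<lambda>b E. Max ((\<lambda>A. \<Sum>j\<in>J. rsign E j * ?h b A j) ` ?A)"
  have fin: "finite ?A" "?A \<noteq> {}" using J by auto
  \<comment> \<open>The factor 2 comes from
    \<open>F (a + b) \<le> (F (2 * a) + F (2 * b)) / 2\<close>.\<close>
  define G where "G x = F (2 * x)" for x
  have G: "convex_on UNIV G" "mono G"
    unfolding G_def[abs_def] by (rule convex_on_comp_scale[OF F(1)]) (auto intro!: monoI monoD[OF F(2)])
  have split: "F (ghost_dev J E \<omega>) \<le> G (?P True E) / 2 + G (?P False (J - E)) / 2" for E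
  proof -
    have "ghost_dev J E \<omega> \<le> ?P True E + ?P False (J - E)"
      unfolding ghost_dev_def
    proof (rule Max.boundedI)
      fix a assume "a \<in> (\<lambda>A. \<Sum>j\<in>J. rsign E j * (max 0 (?h True A j) - max 0 (?h False A j))) ` ?A"
      then obtain A where A: "A \<in> ?A" "a = (\<Sum>j\<in>J. rsign E j * (max 0 (?h True A j) - max 0 (?h False A j)))"
        by auto
      have "a = (\<Sum>j\<in>J. rsign E j * max 0 (?h True A j)) + (\<Sum>j\<in>J. rsign (J - E) j * max 0 (?h False A j))"
        unfolding A(2) sum.distrib[symmetric] by (intro sum.cong) (auto simp: rsign_def)
      also have "\<dots> \<le> ?P True E + ?P False (J - E)"
        using fin A(1) by (intro add_mono Max_ge) auto
      finally show "a \<le> ?P True E + ?P False (J - E)" .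
    qed (use fin in auto)
    then have "F (ghost_dev J E \<omega>) \<le> F (?P True E + ?P False (J - E))" by (rule monoD[OF F(2)])
    also have "\<dots> \<le> G (?P True E) / 2 + G (?P False (J - E)) / 2"
      using convex_onD[OF F(1), of "1/2" "2 * ?P True E" "2 * ?P False (J - E)"] by (simp add: G_def)
    finally show ?thesis .
  qed
  have contr: "(\<Sum>E\<in>Pow J. G (?P b E)) \<le> (\<Sum>E\<in>Pow J. F (2 * rademacher_mass J E (\<lambda>j\<in>J. \<omega> (j, b))))" for b
  proof -
    have "(\<Sum>E\<in>Pow J. G (?P b E)) \<le> (\<Sum>E\<in>Pow J. G (?Q b E))"
      using rademacher_contraction[OF G fin J, of "max 0" "\<lambda>_. 0" "?h b"] by (simp add: max_def)
    also have "\<dots> \<le> (\<Sum>E\<in>Pow J. F (2 * rademacher_mass J E (\<lambda>j\<in>J. \<omega> (j, b))))"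
    proof (rule sum_mono)
      fix E
      have "?Q b E \<le> rademacher_mass J E (\<lambda>j\<in>J. \<omega> (j, b))"
      proof (rule Max.boundedI)
        fix a assume "a \<in> (\<lambda>A. \<Sum>j\<in>J. rsign E j * ?h b A j) ` ?A"
        then obtain A where A: "A \<subseteq> double_set J" "a = (\<Sum>j\<in>J. rsign E j * ?h b A j)" by auto
        have fA: "finite A" using A J finite_subset by (metis finite_double_set)
        have wA: "\<omega> k \<in> space Mu" if "k \<in> A" for k using A that by (intro \<omega>) auto
        have wJ: "\<omega> (j, b) \<in> space Mu" if "j \<in> J" for j using that by (intro \<omega>) (auto simp: double_set_def)
        let ?f = "\<lambda>j x. if 0 < (\<Sum>k\<in>A. W (x, \<omega> k)) then W (x, \<omega> (j, b)) else 0"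
        have int: "integrable N (?f j)" if "j \<in> J" for j
          using fA wA wJ[OF that] by (intro cut_mass_section(4)) auto
        have "a = (\<integral>x. (\<Sum>j\<in>J. rsign E j * ?f j x) \<partial>N)"
          unfolding A(2) cut_mass_def using int by (simp add: Bochner_Integration.integral_sum)
        also have "\<dots> \<le> rademacher_mass J E (\<lambda>j\<in>J. \<omega> (j, b))"
          unfolding rademacher_mass_def
        proof (rule integral_mono)
          show "integrable N (\<lambda>x. \<Sum>j\<in>J. rsign E j * ?f j x)"
            using int by (intro Bochner_Integration.integrable_sum integrable_mult_right) auto
          show "integrable N (\<lambda>x. \<bar>\<Sum>j\<in>J. rsign E j * W (x, (\<lambda>j\<in>J. \<omega> (j, b)) j)\<bar>)"
            using wJ sum_W_bound[OF J, of "rsign E"]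
            by (intro N.integrable_const_bound[of _ "(\<Sum>j\<in>J. \<bar>rsign E j\<bar>) * K"])
               (auto intro!: borel_measurable_abs borel_measurable_sum borel_measurable_times W_section)
          fix x
          have "(\<Sum>j\<in>J. rsign E j * W (x, (\<lambda>j\<in>J. \<omega> (j, b)) j)) = (\<Sum>j\<in>J. rsign E j * W (x, \<omega> (j, b)))"
            by (intro sum.cong) auto
          then show "(\<Sum>j\<in>J. rsign E j * ?f j x) \<le> \<bar>\<Sum>j\<in>J. rsign E j * W (x, (\<lambda>j\<in>J. \<omega> (j, b)) j)\<bar>"
            by (cases "0 < (\<Sum>k\<in>A. W (x, \<omega> k))") auto
        qed
        finally show "a \<le> rademacher_mass J E (\<lambda>j\<in>J. \<omega> (j, b))" .
      qed (use fin in auto)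
      then show "G (?Q b E) \<le> F (2 * rademacher_mass J E (\<lambda>j\<in>J. \<omega> (j, b)))"
        unfolding G_def by (intro monoD[OF F(2)]) auto
    qed
    finally show ?thesis .
  qed
  have compl: "(\<Sum>E\<in>Pow J. G (?P False (J - E))) = (\<Sum>E\<in>Pow J. G (?P False E))"
    by (rule sum.reindex_bij_witness[of _ "\<lambda>E. J - E" "\<lambda>E. J - E"]) (auto simp: double_diff)
  have "(\<Sum>E\<in>Pow J. F (ghost_dev J E \<omega>)) \<le> (\<Sum>E\<in>Pow J. G (?P True E) / 2 + G (?P False (J - E)) / 2)"
    by (intro sum_mono split)
  also have "\<dots> = (\<Sum>E\<in>Pow J. G (?P True E)) / 2 + (\<Sum>E\<in>Pow J. G (?P False E)) / 2"
    unfolding compl[symmetric] by (simp only: sum.distrib sum_divide_distrib)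
  also have "\<dots> \<le> (\<Sum>E\<in>Pow J. F (2 * rademacher_mass J E (\<lambda>j\<in>J. \<omega> (j, True)))) / 2
     + (\<Sum>E\<in>Pow J. F (2 * rademacher_mass J E (\<lambda>j\<in>J. \<omega> (j, False)))) / 2"
    by (intro add_mono divide_right_mono contr) auto
  finally show ?thesis .
qed

text \<open>By \<open>ghost_dev_swap\<close>, \<open>2 ^ card J\<close> copies of the integral for
  \<open>E = J\<close> equal the sum over all sign patterns \<open>E\<close>. The two halves of the
  doubled sample have the same law, so their halved contributions add up to a single one.\<close>

lemma symmetrization:
  fixes B :: real
  assumes J: "finite J" and F: "convex_on UNIV F" "mono F" "\<And>x. F x \<ge> 0"
    and B: "\<And>S. S \<in> sets N \<Longrightarrow> (\<integral>y. max 0 (\<integral>x. indicator S x * W (x, y) \<partial>N) \<partial>Mu) \<le> B"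
  shows "2 ^ card J * (\<integral>\<^sup>+\<omega>. ennreal (F (max_mass J \<omega> - real (card J) * B)) \<partial>PiM J (\<lambda>_. Mu))
       \<le> (\<integral>\<^sup>+\<omega>. (\<Sum>E\<in>Pow J. ennreal (F (2 * rademacher_mass J E \<omega>))) \<partial>PiM J (\<lambda>_. Mu))"
proof -
  let ?D = "PiM (double_set J) (\<lambda>_. Mu)"
  let ?R = "\<lambda>\<omega>. \<Sum>E\<in>Pow J. F (2 * rademacher_mass J E \<omega>)"
  have Rm: "(\<lambda>\<omega>. ennreal (?R \<omega> / 2)) \<in> borel_measurable (PiM J (\<lambda>_. Mu))"
    using J by (intro measurable_compose[OF _ measurable_ennreal] borel_measurable_divide borel_measurable_sum
        borel_measurable_mono_comp[OF F(2)] borel_measurable_times borel_measurable_const measurable_rademacher_mass)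
  have R0: "?R \<omega> \<ge> 0" for \<omega> :: "_ \<Rightarrow> 'y" using F(3) by (intro sum_nonneg) auto
  have res: "(\<lambda>\<omega>. \<lambda>j\<in>J. \<omega> (j, b)) \<in> measurable ?D (PiM J (\<lambda>_. Mu))" for b
    by (intro measurable_restrict measurable_component_singleton) (auto simp: double_set_def)
  have half: "(\<integral>\<^sup>+\<omega>. ennreal (?R (\<lambda>j\<in>J. \<omega> (j, b)) / 2) \<partial>?D) = (\<integral>\<^sup>+\<omega>. ennreal (?R \<omega> / 2) \<partial>PiM J (\<lambda>_. Mu))" for b
    by (rule nn_integral_PiM_reindex[OF Mu.prob_space_axioms _ _ Rm]) (auto simp: inj_on_def double_set_def)
  have "2 ^ card J * (\<integral>\<^sup>+\<omega>. ennreal (F (max_mass J \<omega> - real (card J) * B)) \<partial>PiM J (\<lambda>_. Mu))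
      \<le> 2 ^ card J * (\<integral>\<^sup>+\<omega>. ennreal (F (ghost_dev J J \<omega>)) \<partial>?D)"
    by (intro mult_left_mono max_mass_le_ghost_dev[OF J F B]) auto
  also have "\<dots> = (\<Sum>E\<in>Pow J. (\<integral>\<^sup>+\<omega>. ennreal (F (ghost_dev J J \<omega>)) \<partial>?D))"
    using J by (simp add: card_Pow)
  also have "\<dots> = (\<Sum>E\<in>Pow J. (\<integral>\<^sup>+\<omega>. ennreal (F (ghost_dev J E \<omega>)) \<partial>?D))"
    by (intro sum.cong refl ghost_dev_swap J F)
  also have "\<dots> = (\<integral>\<^sup>+\<omega>. (\<Sum>E\<in>Pow J. ennreal (F (ghost_dev J E \<omega>))) \<partial>?D)"
    using J by (intro nn_integral_sum[symmetric] measurable_compose[OF _ measurable_ennreal]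
        borel_measurable_mono_comp[OF F(2)] measurable_ghost_dev)
  also have "\<dots> \<le> (\<integral>\<^sup>+\<omega>. ennreal (?R (\<lambda>j\<in>J. \<omega> (j, True)) / 2) + ennreal (?R (\<lambda>j\<in>J. \<omega> (j, False)) / 2) \<partial>?D)"
  proof (rule nn_integral_mono)
    fix \<omega> assume "\<omega> \<in> space ?D"
    then have w: "\<omega> k \<in> space Mu" if "k \<in> double_set J" for k using that by (auto simp: space_PiM)
    have "(\<Sum>E\<in>Pow J. ennreal (F (ghost_dev J E \<omega>))) = ennreal (\<Sum>E\<in>Pow J. F (ghost_dev J E \<omega>))"
      using F(3) by (simp add: sum_ennreal)
    also have "\<dots> \<le> ennreal (?R (\<lambda>j\<in>J. \<omega> (j, True)) / 2 + ?R (\<lambda>j\<in>J. \<omega> (j, False)) / 2)"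
      by (intro ennreal_leI sum_ghost_dev_le J F w)
    also have "\<dots> = ennreal (?R (\<lambda>j\<in>J. \<omega> (j, True)) / 2) + ennreal (?R (\<lambda>j\<in>J. \<omega> (j, False)) / 2)"
      using R0 by (intro ennreal_plus) auto
    finally show "(\<Sum>E\<in>Pow J. ennreal (F (ghost_dev J E \<omega>))) \<le> \<dots>" .
  qed
  also have "\<dots> = (\<integral>\<^sup>+\<omega>. ennreal (?R (\<lambda>j\<in>J. \<omega> (j, True)) / 2) \<partial>?D)
      + (\<integral>\<^sup>+\<omega>. ennreal (?R (\<lambda>j\<in>J. \<omega> (j, False)) / 2) \<partial>?D)"
    by (intro nn_integral_add measurable_compose[OF res Rm])
  also have "\<dots> = (\<integral>\<^sup>+\<omega>. ennreal (?R \<omega> / 2) + ennreal (?R \<omega> / 2) \<partial>PiM J (\<lambda>_. Mu))"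
    unfolding half using Rm by (intro nn_integral_add[symmetric])
  also have "\<dots> = (\<integral>\<^sup>+\<omega>. (\<Sum>E\<in>Pow J. ennreal (F (2 * rademacher_mass J E \<omega>))) \<partial>PiM J (\<lambda>_. Mu))"
    using R0 F(3) by (intro nn_integral_cong) (simp add: ennreal_plus[symmetric] sum_ennreal del: ennreal_plus)
  finally show ?thesis .
qed

text \<open>Jensen's inequality over \<open>N\<close> moves the power inside the row integral, where
  Khintchine's inequality applies to each row separately. The 4 is the square of the factor 2 of
  symmetrization. The power mean inequality, with exponent \<open>r / 2\<close>, turns the sum of
  squares into \<open>r\<close>-th powers; this is where \<open>r \<ge> 2\<close> enters.\<close>

lemma max_mass_moment:
  fixes B :: real
  assumes J: "finite J" "J \<noteq> {}" and r: "r \<ge> 2"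
    and B: "\<And>S. S \<in> sets N \<Longrightarrow> (\<integral>y. max 0 (\<integral>x. indicator S x * W (x, y) \<partial>N) \<partial>Mu) \<le> B"
  shows "(\<integral>\<^sup>+\<omega>. ennreal (max 0 (max_mass J \<omega> - real (card J) * B) powr r) \<partial>PiM J (\<lambda>_. Mu))
       \<le> ennreal (2 * (4 * exp 1 * r * card J) powr (r / 2))
         * (\<integral>\<^sup>+y. (\<integral>\<^sup>+x. ennreal (\<bar>W (x, y)\<bar> powr r) \<partial>N) \<partial>Mu)"
proof -
  let ?F = "\<lambda>x::real. max 0 x powr r"
  let ?m = "real (card J)"
  let ?M = "\<lambda>y. \<integral>\<^sup>+x. ennreal (\<bar>W (x, y)\<bar> powr r) \<partial>N"
  have F: "convex_on UNIV ?F" "mono ?F" "\<And>x. ?F x \<ge> 0"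
    using r by (auto intro: convex_on_pos_part_powr mono_pos_part_powr)
  have m: "?m > 0" using J by (auto simp: card_gt_0_iff)
  define C where "C = 2 ^ card J * (2 * (4 * exp 1 * r) powr (r / 2) * ?m powr (r / 2 - 1))"
  have C0: "C \<ge> 0" by (simp add: C_def)
  have Mm: "?M \<in> borel_measurable Mu"
    by (rule N.borel_measurable_nn_integral) (simp add: split_beta')
  have pt: "(\<Sum>E\<in>Pow J. ?F (2 * \<bar>\<Sum>j\<in>J. rsign E j * a j\<bar>)) \<le> C * (\<Sum>j\<in>J. \<bar>a j\<bar> powr r)" for a
  proof -
    have "(\<Sum>E\<in>Pow J. ?F (2 * \<bar>\<Sum>j\<in>J. rsign E j * a j\<bar>))
        = 2 powr r * (\<Sum>E\<in>Pow J. \<bar>\<Sum>j\<in>J. rsign E j * a j\<bar> powr r)"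
      unfolding sum_distrib_left by (intro sum.cong refl) (simp add: powr_mult max_def)
    also have "\<dots> \<le> 2 powr r * (2 ^ card J * (2 * (exp 1 * r) powr (r / 2) * (\<Sum>j\<in>J. (a j)\<^sup>2) powr (r / 2)))"
      using J r by (intro mult_left_mono khintchine) auto
    also have "\<dots> \<le> 2 powr r * (2 ^ card J * (2 * (exp 1 * r) powr (r / 2)
        * (?m powr (r / 2 - 1) * (\<Sum>j\<in>J. ((a j)\<^sup>2) powr (r / 2)))))"
      using J r by (intro mult_left_mono sum_powr_le) auto
    also have "(\<Sum>j\<in>J. ((a j)\<^sup>2) powr (r / 2)) = (\<Sum>j\<in>J. \<bar>a j\<bar> powr r)"
    proof (intro sum.cong refl)
      fix j
      have "((a j)\<^sup>2) powr (r / 2) = (\<bar>a j\<bar> powr 2) powr (r / 2)" by simp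
      then show "((a j)\<^sup>2) powr (r / 2) = \<bar>a j\<bar> powr r" by (simp only: powr_powr) simp
    qed
    also have "2 powr r = (4::real) powr (r / 2)"
    proof -
      have "(4::real) powr (r / 2) = (2 powr 2) powr (r / 2)" by simp
      then show ?thesis by (simp only: powr_powr) simp
    qed
    also have "4 powr (r / 2) * (2 ^ card J * (2 * (exp 1 * r) powr (r / 2)
        * (?m powr (r / 2 - 1) * (\<Sum>j\<in>J. \<bar>a j\<bar> powr r)))) = C * (\<Sum>j\<in>J. \<bar>a j\<bar> powr r)"
      by (simp add: C_def powr_mult mult_ac)
    finally show ?thesis .
  qed
  have "2 ^ card J * (\<integral>\<^sup>+\<omega>. ennreal (?F (max_mass J \<omega> - ?m * B)) \<partial>PiM J (\<lambda>_. Mu))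
      \<le> (\<integral>\<^sup>+\<omega>. (\<Sum>E\<in>Pow J. ennreal (?F (2 * rademacher_mass J E \<omega>))) \<partial>PiM J (\<lambda>_. Mu))"
    by (rule symmetrization[OF J(1) F B])
  also have "\<dots> \<le> (\<integral>\<^sup>+\<omega>. (\<Sum>j\<in>J. ennreal C * ?M (\<omega> j)) \<partial>PiM J (\<lambda>_. Mu))"
  proof (rule nn_integral_mono)
    fix \<omega> assume "\<omega> \<in> space (PiM J (\<lambda>_. Mu))"
    then have w: "\<omega> j \<in> space Mu" if "j \<in> J" for j using that by (auto simp: space_PiM)
    let ?s = "\<lambda>E x. \<bar>\<Sum>j\<in>J. rsign E j * W (x, \<omega> j)\<bar>"
    have sm [measurable]: "?s E \<in> borel_measurable N" for E
      using w by (intro borel_measurable_abs borel_measurable_sum borel_measurable_times W_section) auto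
    have Wm [measurable]: "(\<lambda>x. W (x, \<omega> j)) \<in> borel_measurable N" if "j \<in> J" for j
      using w[OF that] by (rule W_section)
    have sb: "?s E x \<le> (\<Sum>j\<in>J. \<bar>rsign E j\<bar>) * K" for E x
      by (rule sum_W_bound[OF J(1)])
    have "(\<Sum>E\<in>Pow J. ennreal (?F (2 * rademacher_mass J E \<omega>)))
        \<le> (\<Sum>E\<in>Pow J. (\<integral>\<^sup>+x. ennreal (?F (2 * ?s E x)) \<partial>N))"
    proof (rule sum_mono)
      fix E
      have [simp]: "integrable N (?s E)"
        using sb[of E] by (intro N.integrable_const_bound[of _ "(\<Sum>j\<in>J. \<bar>rsign E j\<bar>) * K"]) auto
      show "ennreal (?F (2 * rademacher_mass J E \<omega>)) \<le> (\<integral>\<^sup>+x. ennreal (?F (2 * ?s E x)) \<partial>N)"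
      proof (rule N.nn_jensen[OF F, where C = "2 * ((\<Sum>j\<in>J. \<bar>rsign E j\<bar>) * K)"])
        show "2 * rademacher_mass J E \<omega> \<le> (\<integral>x. 2 * ?s E x \<partial>N)" by (simp add: rademacher_mass_def)
      qed (use sb[of E] in auto)
    qed
    also have "\<dots> = (\<integral>\<^sup>+x. (\<Sum>E\<in>Pow J. ennreal (?F (2 * ?s E x))) \<partial>N)"
      by (rule nn_integral_sum[symmetric]) simp
    also have "\<dots> \<le> (\<integral>\<^sup>+x. (\<Sum>j\<in>J. ennreal C * ennreal (\<bar>W (x, \<omega> j)\<bar> powr r)) \<partial>N)"
    proof (rule nn_integral_mono)
      fix x
      have "(\<Sum>E\<in>Pow J. ennreal (?F (2 * ?s E x))) = ennreal (\<Sum>E\<in>Pow J. ?F (2 * ?s E x))"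
        by (simp add: sum_ennreal)
      also have "\<dots> \<le> ennreal (C * (\<Sum>j\<in>J. \<bar>W (x, \<omega> j)\<bar> powr r))"
        by (intro ennreal_leI pt)
      also have "\<dots> = (\<Sum>j\<in>J. ennreal C * ennreal (\<bar>W (x, \<omega> j)\<bar> powr r))"
        using C0 by (simp add: ennreal_mult sum_nonneg sum_ennreal[symmetric] sum_distrib_left)
      finally show "(\<Sum>E\<in>Pow J. ennreal (?F (2 * ?s E x))) \<le> \<dots>" .
    qed
    also have "\<dots> = (\<Sum>j\<in>J. ennreal C * ?M (\<omega> j))"
      by (subst nn_integral_sum) (auto intro!: sum.cong nn_integral_cmult)
    finally show "(\<Sum>E\<in>Pow J. ennreal (?F (2 * rademacher_mass J E \<omega>))) \<le> \<dots>" .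
  qed
  also have "\<dots> = (\<Sum>j\<in>J. (\<integral>\<^sup>+\<omega>. ennreal C * ?M (\<omega> j) \<partial>PiM J (\<lambda>_. Mu)))"
    using Mm by (intro nn_integral_sum borel_measurable_times_ennreal measurable_compose[OF _ Mm]) auto
  also have "\<dots> = (\<Sum>j\<in>J. ennreal C * (\<integral>\<^sup>+y. ?M y \<partial>Mu))"
    using Mm by (intro sum.cong refl)
      (simp add: nn_integral_cmult nn_integral_PiM_component[OF Mu.prob_space_axioms _ Mm])
  also have "\<dots> = 2 ^ card J * (ennreal (2 * (4 * exp 1 * r * ?m) powr (r / 2)) * (\<integral>\<^sup>+y. ?M y \<partial>Mu))"
  proof -
    have "?m * C = 2 ^ card J * (2 * (4 * exp 1 * r * ?m) powr (r / 2))"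
      using m by (simp add: C_def powr_mult powr_diff)
    then have "ennreal ?m * ennreal C = 2 ^ card J * ennreal (2 * (4 * exp 1 * r * ?m) powr (r / 2))"
    proof -
      have "(2::ennreal) ^ card J = ennreal (2 ^ card J)"
        by (simp add: ennreal_power[symmetric])
      then show ?thesis using C0 \<open>?m * C = _\<close> by (simp add: ennreal_mult[symmetric])
    qed
    then show ?thesis by (simp add: mult.assoc[symmetric] ennreal_of_nat_eq_real_of_nat)
  qed
  finally show ?thesis
    by (subst (asm) ennreal_mult_le_mult_iff) (auto simp: power_eq_top_ennreal)
qed

end
section \<open>Decoupling of rows and columns\<close>

text \<open>No absolute value is taken: the maximum over \<open>signs\<close> supplies it later,
  since with every \<open>s\<close> that set contains \<open>- s\<close>.\<close>

definition bip_cut :: "('y \<times> 'y \<Rightarrow> real) \<Rightarrow> 'i set \<Rightarrow> 'i set \<Rightarrow> ('i \<Rightarrow> 'y) \<Rightarrow> real" where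
  "bip_cut V R Q \<omega> = Max ((\<lambda>(S, T). \<Sum>i\<in>S. \<Sum>j\<in>T. V (\<omega> i, \<omega> j)) ` (Pow R \<times> Pow Q))"

definition diag_free_cut :: "('y \<times> 'y \<Rightarrow> real) \<Rightarrow> 'i set \<Rightarrow> ('i \<Rightarrow> 'y) \<Rightarrow> real" where
  "diag_free_cut V I \<omega> =
     Max ((\<lambda>(S, T). \<Sum>i\<in>S. \<Sum>j\<in>T. if i = j then 0 else V (\<omega> i, \<omega> j)) ` (Pow I \<times> Pow I))"

lemma measurable_kernel_component:
  assumes "V \<in> borel_measurable (Mu \<Otimes>\<^sub>M Mu)" "i \<in> I" "j \<in> I"
  shows "(\<lambda>\<omega>. V (\<omega> i, \<omega> j)) \<in> borel_measurable (PiM I (\<lambda>_. Mu))"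
proof -
  have "(\<lambda>\<omega>. (\<omega> i, \<omega> j)) \<in> measurable (PiM I (\<lambda>_. Mu)) (Mu \<Otimes>\<^sub>M Mu)"
    using assms by (intro measurable_Pair measurable_component_singleton) auto
  from measurable_compose[OF this assms(1)] show ?thesis .
qed

lemma measurable_bip_cut:
  assumes "V \<in> borel_measurable (Mu \<Otimes>\<^sub>M Mu)" "finite R" "finite Q" "R \<subseteq> I" "Q \<subseteq> I"
  shows "bip_cut V R Q \<in> borel_measurable (PiM I (\<lambda>_. Mu))"
  unfolding bip_cut_def[abs_def] using assms
  by (intro borel_measurable_Max) (auto intro!: borel_measurable_sum measurable_kernel_component)

lemma measurable_diag_free_cut:
  assumes "V \<in> borel_measurable (Mu \<Otimes>\<^sub>M Mu)" "finite I"
  shows "diag_free_cut V I \<in> borel_measurable (PiM I (\<lambda>_. Mu))"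
  unfolding diag_free_cut_def[abs_def]
proof (intro borel_measurable_Max)
  fix p assume p: "p \<in> Pow I \<times> Pow I"
  have "(\<lambda>\<omega>. if i = j then 0 else V (\<omega> i, \<omega> j)) \<in> borel_measurable (PiM I (\<lambda>_. Mu))"
    if "i \<in> fst p" "j \<in> snd p" for i j
  proof -
    have "i \<in> I" "j \<in> I" using that p by auto
    then show ?thesis using measurable_kernel_component[OF assms(1), of i I j] by (cases "i = j") auto
  qed
  then show "(\<lambda>\<omega>. case p of (S, T) \<Rightarrow> \<Sum>i\<in>S. \<Sum>j\<in>T. if i = j then 0 else V (\<omega> i, \<omega> j))
      \<in> borel_measurable (PiM I (\<lambda>_. Mu))"
    unfolding case_prod_beta by (intro borel_measurable_sum)
qed (use assms in auto)

lemma pos_part_powr_add_le: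
  fixes u v r :: real
  assumes "r \<ge> 1"
  shows "max 0 (u + v) powr r \<le> 2 powr (r - 1) * (max 0 u powr r + max 0 v powr r)"
proof -
  have "max 0 (u + v) powr r \<le> (1/2) * max 0 (2 * u) powr r + (1/2) * max 0 (2 * v) powr r"
    using convex_onD[OF convex_on_pos_part_powr[OF assms], of "1/2" "2 * u" "2 * v"] by simp
  moreover have "max 0 (2 * x) powr r = 2 powr r * max 0 x powr r" for x :: real
  proof -
    have "max 0 (2 * x) = 2 * max 0 x" by linarith
    then show ?thesis by (simp only: powr_mult)
  qed
  ultimately show ?thesis by (simp add: powr_diff algebra_simps)
qed

lemma max_0_mult: "c \<ge> 0 \<Longrightarrow> max 0 (c * x) = c * max 0 (x::real)"
  by (auto simp: max_def zero_le_mult_iff mult_le_0_iff not_le)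

text \<open>Membership is prescribed for \<open>i\<close> and \<open>j\<close> and free for the
  other indices.\<close>

lemma card_separating_subsets:
  assumes I: "finite I" "i \<in> I" "j \<in> I" "i \<noteq> j"
  shows "4 * card {R \<in> Pow I. i \<in> R \<and> j \<notin> R} = 2 ^ card I"
proof -
  have "{R \<in> Pow I. i \<in> R \<and> j \<notin> R} = insert i ` Pow (I - {i, j})"
  proof (intro equalityI subsetI)
    fix R assume "R \<in> {R \<in> Pow I. i \<in> R \<and> j \<notin> R}"
    then have "R = insert i (R - {i})" "R - {i} \<in> Pow (I - {i, j})" by auto
    then show "R \<in> insert i ` Pow (I - {i, j})" by (rule image_eqI)
  qed (use I in auto)
  moreover have "inj_on (insert i) (Pow (I - {i, j}))"
    by (intro inj_onI) (metis Diff_iff Diff_insert_absorb PowD insertI1 subset_iff)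
  ultimately have "card {R \<in> Pow I. i \<in> R \<and> j \<notin> R} = 2 ^ card (I - {i, j})"
    using I by (simp add: card_image card_Pow)
  moreover have "card I = Suc (Suc (card (I - {i, j})))"
  proof -
    have "I = insert i (insert j (I - {i, j}))" using I by auto
    then have "card I = card (insert i (insert j (I - {i, j})))" by simp
    then show ?thesis using I by simp
  qed
  ultimately show ?thesis by simp
qed

text \<open>In the assumption below, taking positive parts is the supremum over the second set of the cut norm.\<close>

locale bounded_kernel = bounded_field Mu Mu V K for Mu :: "'y measure" and V K +
  fixes B :: real
  assumes B: "S \<in> sets Mu \<Longrightarrow> (\<integral>y. max 0 (\<integral>x. indicator S x * V (x, y) \<partial>Mu) \<partial>Mu) \<le> B"
begin

lemma B_nonneg: "B \<ge> 0" using B[of "{}"] by simp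

definition moment :: "real \<Rightarrow> ennreal" where
  "moment r = (\<integral>\<^sup>+y. (\<integral>\<^sup>+x. ennreal (\<bar>V (x, y)\<bar> powr r) \<partial>Mu) \<partial>Mu)"

lemma row_moment_measurable:
  "(\<lambda>y. \<integral>\<^sup>+x. ennreal (\<bar>V (x, y)\<bar> powr r) \<partial>Mu) \<in> borel_measurable Mu"
  by (rule N.borel_measurable_nn_integral) (simp add: split_beta')

text \<open>With the columns \<open>y\<close> fixed, the rows are an independent sample in a field
  whose averaged factor is the uniform measure on \<open>Q\<close>. The centring constant of that
  field is \<open>max_mass Q y / card Q\<close>, which depends on \<open>y\<close>; its own excess
  over \<open>B\<close> is kept as the last summand and left to the sample of columns.\<close>

lemma bip_cut_given_columns:
  fixes R Q :: "'i set"
  assumes R: "finite R" "R \<noteq> {}" and Q: "finite Q" "Q \<noteq> {}" and disj: "Q \<inter> R = {}"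
    and r: "r \<ge> 2" and y: "y \<in> space (PiM Q (\<lambda>_. Mu))"
  shows "(\<integral>\<^sup>+x. ennreal (max 0 (bip_cut V R Q (merge Q R (y, x)) - real (card R) * real (card Q) * B) powr r)
            \<partial>PiM R (\<lambda>_. Mu))
      \<le> ennreal (2 powr (r - 1)) *
         (ennreal (real (card Q) powr r * (2 * (4 * exp 1 * r * card R) powr (r / 2)))
            * ((\<Sum>j\<in>Q. (\<integral>\<^sup>+x. ennreal (\<bar>V (x, y j)\<bar> powr r) \<partial>Mu)) / of_nat (card Q))
          + ennreal (real (card R) powr r) * ennreal (max 0 (max_mass Q y - real (card Q) * B) powr r))"
proof -
  let ?m = "real (card R)" and ?q = "real (card Q)"
  have q: "?q > 0" using Q by (auto simp: card_gt_0_iff)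
  define U where "U = uniform_count_measure Q"
  have U: "space U = Q" "sets U = Pow Q" by (auto simp: U_def space_uniform_count_measure sets_uniform_count_measure)
  have ys: "y j \<in> space Mu" if "j \<in> Q" for j using y that by (auto simp: space_PiM)
  interpret U: prob_space U unfolding U_def using Q by (intro prob_space_uniform_count_measure) auto
  have U_int: "(\<integral>j. f j \<partial>U) = (\<Sum>j\<in>Q. f j) / ?q" for f :: "'i \<Rightarrow> real"
    unfolding U_def uniform_count_measure_def
    using Q by (subst lebesgue_integral_point_measure_finite) (auto simp: sum_divide_distrib)
  have U_nn: "(\<integral>\<^sup>+j. f j \<partial>U) = (\<Sum>j\<in>Q. f j) / of_nat (card Q)" for f :: "'i \<Rightarrow> ennreal"
    unfolding U_def uniform_count_measure_def
    using Q q by (subst nn_integral_point_measure_finite)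
      (auto simp: sum_distrib_right[symmetric] divide_ennreal_def ennreal_of_nat_eq_real_of_nat
        inverse_ennreal inverse_eq_divide mult.commute)
  \<comment> \<open>Rows and columns change places: \<open>x\<close> is now the sampled variable,
    and the column index is averaged.\<close>
  define W1 where "W1 = (\<lambda>(j, x). V (x, y j))"
  interpret F: bounded_field U Mu W1 K
  proof
    have "(\<lambda>x. W1 (j, x)) \<in> borel_measurable Mu" if "j \<in> Q" for j
    proof -
      have "(\<lambda>x. (x, y j)) \<in> measurable Mu (Mu \<Otimes>\<^sub>M Mu)" using ys[OF that] by measurable
      from measurable_compose[OF this W_meas] show ?thesis by (simp add: W1_def)
    qed
    then have "W1 \<in> borel_measurable (count_space Q \<Otimes>\<^sub>M Mu)"
      using Q by (intro measurable_pair_measure_countable1) (auto intro: countable_finite)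
    also have "borel_measurable (count_space Q \<Otimes>\<^sub>M Mu) = borel_measurable (U \<Otimes>\<^sub>M Mu)"
      using U by (intro measurable_cong_sets sets_pair_measure_cong) auto
    finally show "W1 \<in> borel_measurable (U \<Otimes>\<^sub>M Mu)" .
    show "\<bar>W1 z\<bar> \<le> K" for z using W_bound by (auto simp: W1_def split: prod.splits)
  qed
  have FB: "(\<integral>x. max 0 (\<integral>j. indicator S j * W1 (j, x) \<partial>U) \<partial>Mu) \<le> max_mass Q y / ?q" if "S \<in> sets U" for S
  proof -
    have S: "S \<subseteq> Q" using that U by auto
    have "(\<integral>j. indicator S j * W1 (j, x) \<partial>U) = (1 / ?q) * (\<Sum>j\<in>S. V (x, y j))" for x
    proof -
      have "(\<Sum>j\<in>Q. indicator S j * W1 (j, x)) = (\<Sum>j\<in>S. V (x, y j))"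
        using S Q by (simp add: W1_def sum.inter_restrict[symmetric] Int_absorb1 indicator_def if_distrib flip: sum.inter_restrict)
      then show ?thesis by (simp add: U_int)
    qed
    then have "(\<integral>x. max 0 (\<integral>j. indicator S j * W1 (j, x) \<partial>U) \<partial>Mu) = (\<integral>x. (1 / ?q) * max 0 (\<Sum>j\<in>S. V (x, y j)) \<partial>Mu)"
      by (simp only: max_0_mult[of "1 / ?q"] zero_le_divide_1_iff of_nat_0_le_iff)
    also have "\<dots> = pos_mass S y / ?q" by (simp add: pos_mass_def)
    also have "\<dots> \<le> max_mass Q y / ?q"
      unfolding max_mass_def using S Q by (intro divide_right_mono Max_ge) auto
    finally show ?thesis .
  qed
  have cut_le: "bip_cut V R Q (merge Q R (y, x)) \<le> ?q * F.max_mass R x" for x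
    unfolding bip_cut_def
  proof (rule Max.boundedI)
    fix a assume "a \<in> (\<lambda>(S, T). \<Sum>i\<in>S. \<Sum>j\<in>T. V (merge Q R (y, x) i, merge Q R (y, x) j)) ` (Pow R \<times> Pow Q)"
    then obtain S T where ST: "S \<subseteq> R" "T \<subseteq> Q" "a = (\<Sum>i\<in>S. \<Sum>j\<in>T. V (merge Q R (y, x) i, merge Q R (y, x) j))"
      by auto
    have "a = (\<Sum>i\<in>S. \<Sum>j\<in>T. V (x i, y j))"
      unfolding ST(3) using ST(1,2) disj by (intro sum.cong) (auto simp: merge_def)
    also have "\<dots> = (\<Sum>j\<in>T. \<Sum>i\<in>S. V (x i, y j))" by (rule sum.swap)
    also have "\<dots> \<le> (\<Sum>j\<in>T. max 0 (\<Sum>i\<in>S. V (x i, y j)))" by (intro sum_mono) auto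
    also have "\<dots> \<le> (\<Sum>j\<in>Q. max 0 (\<Sum>i\<in>S. V (x i, y j)))" using ST Q by (intro sum_mono2) auto
    also have "\<dots> = ?q * F.pos_mass S x" using q unfolding F.pos_mass_def U_int by (simp add: W1_def)
    also have "\<dots> \<le> ?q * F.max_mass R x"
      unfolding F.max_mass_def using ST R by (intro mult_left_mono Max_ge) auto
    finally show "a \<le> ?q * F.max_mass R x" .
  qed (use R Q in auto)
  let ?b = "max 0 (max_mass Q y - ?q * B) powr r"
  let ?a = "\<lambda>x. max 0 (F.max_mass R x - ?m * (max_mass Q y / ?q)) powr r"
  have am: "(\<lambda>x. ennreal (?a x)) \<in> borel_measurable (PiM R (\<lambda>_. Mu))"
    using F.measurable_max_mass[OF R(1)] by measurable
  have pt: "max 0 (bip_cut V R Q (merge Q R (y, x)) - ?m * ?q * B) powr r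
      \<le> 2 powr (r - 1) * (?q powr r * ?a x + ?m powr r * ?b)" for x
  proof -
    \<comment> \<open>In \<open>?q * ?u + ?m * ?v\<close> the quantity \<open>max_mass Q y\<close>
      cancels: what the rows are centred at is what the columns let fluctuate.\<close>
    let ?u = "F.max_mass R x - ?m * (max_mass Q y / ?q)" and ?v = "max_mass Q y - ?q * B"
    have "bip_cut V R Q (merge Q R (y, x)) - ?m * ?q * B \<le> ?q * ?u + ?m * ?v"
      using cut_le[of x] q by (simp add: algebra_simps)
    then have "max 0 (bip_cut V R Q (merge Q R (y, x)) - ?m * ?q * B) powr r \<le> max 0 (?q * ?u + ?m * ?v) powr r"
      using r by (intro powr_mono2) auto
    also have "\<dots> \<le> 2 powr (r - 1) * (max 0 (?q * ?u) powr r + max 0 (?m * ?v) powr r)"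
      using r by (intro pos_part_powr_add_le) auto
    also have "\<dots> = 2 powr (r - 1) * (?q powr r * ?a x + ?m powr r * ?b)"
      by (simp add: max_0_mult powr_mult)
    finally show ?thesis .
  qed
  have "(\<integral>\<^sup>+x. ennreal (max 0 (bip_cut V R Q (merge Q R (y, x)) - ?m * ?q * B) powr r) \<partial>PiM R (\<lambda>_. Mu))
      \<le> (\<integral>\<^sup>+x. ennreal (2 powr (r - 1)) * (ennreal (?q powr r) * ennreal (?a x) + ennreal (?m powr r) * ennreal ?b) \<partial>PiM R (\<lambda>_. Mu))"
    using pt by (intro nn_integral_mono) (simp add: ennreal_mult[symmetric] ennreal_plus[symmetric] ennreal_leI del: ennreal_plus)
  also have "\<dots> = ennreal (2 powr (r - 1)) * (ennreal (?q powr r) * (\<integral>\<^sup>+x. ennreal (?a x) \<partial>PiM R (\<lambda>_. Mu))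
      + ennreal (?m powr r) * ennreal ?b)"
  proof -
    interpret PR: prob_space "PiM R (\<lambda>_. Mu)" by (intro prob_space_PiM N.prob_space_axioms)
    show ?thesis using am by (simp add: nn_integral_cmult nn_integral_add PR.emeasure_space_1)
  qed
  also have "\<dots> \<le> ennreal (2 powr (r - 1)) * (ennreal (?q powr r) *
       (ennreal (2 * (4 * exp 1 * r * ?m) powr (r / 2))
         * (\<integral>\<^sup>+x. (\<integral>\<^sup>+j. ennreal (\<bar>W1 (j, x)\<bar> powr r) \<partial>U) \<partial>Mu))
      + ennreal (?m powr r) * ennreal ?b)"
    by (intro mult_left_mono add_right_mono F.max_mass_moment R r FB) auto
  also have "(\<integral>\<^sup>+x. (\<integral>\<^sup>+j. ennreal (\<bar>W1 (j, x)\<bar> powr r) \<partial>U) \<partial>Mu)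
      = (\<Sum>j\<in>Q. (\<integral>\<^sup>+x. ennreal (\<bar>V (x, y j)\<bar> powr r) \<partial>Mu)) / of_nat (card Q)"
  proof -
    have m: "(\<lambda>x. ennreal (\<bar>V (x, y j)\<bar> powr r)) \<in> borel_measurable Mu" if "j \<in> Q" for j
      using W_section[OF ys[OF that]] by measurable
    then have sm: "(\<lambda>x. \<Sum>j\<in>Q. ennreal (\<bar>V (x, y j)\<bar> powr r)) \<in> borel_measurable Mu" by (intro borel_measurable_sum)
    show ?thesis
      unfolding U_nn W1_def prod.case nn_integral_divide[OF sm]
      using m by (subst nn_integral_sum) auto
  qed
  finally show ?thesis by (simp only: mult.assoc ennreal_mult powr_ge_zero mult_nonneg_nonneg)
qed

text \<open>Integration over the columns. The excess of \<open>max_mass Q\<close> is again an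
  instance of \<open>max_mass_moment\<close>, this time with \<open>Mu\<close> as the averaged
  factor.\<close>

lemma bip_cut_moment:
  assumes R: "finite R" "R \<noteq> {}" and Q: "finite Q" "Q \<noteq> {}" and disj: "Q \<inter> R = {}" and r: "r \<ge> 2"
  shows "(\<integral>\<^sup>+\<omega>. ennreal (max 0 (bip_cut V R Q \<omega> - real (card R) * real (card Q) * B) powr r)
            \<partial>PiM (Q \<union> R) (\<lambda>_. Mu))
      \<le> ennreal (2 powr (r - 1) * (real (card Q) powr r * (2 * (4 * exp 1 * r * card R) powr (r / 2))
          + real (card R) powr r * (2 * (4 * exp 1 * r * card Q) powr (r / 2)))) * moment r"
proof -
  let ?m = "real (card R)" and ?q = "real (card Q)" and ?c = "2 powr (r - 1)"
  let ?C = "?q powr r * (2 * (4 * exp 1 * r * ?m) powr (r / 2))"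
  let ?C' = "2 * (4 * exp 1 * r * ?q) powr (r / 2)"
  let ?row = "\<lambda>y. \<integral>\<^sup>+x. ennreal (\<bar>V (x, y)\<bar> powr r) \<partial>Mu"
  let ?b = "\<lambda>y. max 0 (max_mass Q y - ?q * B) powr r"
  let ?P = "PiM Q (\<lambda>_. Mu)"
  have q: "card Q > 0" using Q by (auto simp: card_gt_0_iff)
  have sig: "product_sigma_finite (\<lambda>_. Mu)" by unfold_locales
  have row_m: "(\<lambda>y. ?row (y j)) \<in> borel_measurable ?P" if "j \<in> Q" for j
    using that by (intro measurable_compose[OF _ row_moment_measurable]) auto
  have b_m: "(\<lambda>y. ennreal (?b y)) \<in> borel_measurable ?P"
    using measurable_max_mass[OF Q(1)] by measurable
  have f_m: "(\<lambda>\<omega>. ennreal (max 0 (bip_cut V R Q \<omega> - ?m * ?q * B) powr r)) \<in> borel_measurable (PiM (Q \<union> R) (\<lambda>_. Mu))"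
    using measurable_bip_cut[OF W_meas R(1) Q(1), of "Q \<union> R"] by measurable
  have "(\<integral>\<^sup>+\<omega>. ennreal (max 0 (bip_cut V R Q \<omega> - ?m * ?q * B) powr r) \<partial>PiM (Q \<union> R) (\<lambda>_. Mu))
      = (\<integral>\<^sup>+y. (\<integral>\<^sup>+x. ennreal (max 0 (bip_cut V R Q (merge Q R (y, x)) - ?m * ?q * B) powr r)
            \<partial>PiM R (\<lambda>_. Mu)) \<partial>?P)"
    by (rule product_sigma_finite.product_nn_integral_fold[OF sig disj Q(1) R(1) f_m])
  also have "\<dots> \<le> (\<integral>\<^sup>+y. ennreal ?c * (ennreal ?C * ((\<Sum>j\<in>Q. ?row (y j)) / of_nat (card Q))
          + ennreal (?m powr r) * ennreal (?b y)) \<partial>?P)"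
    by (intro nn_integral_mono bip_cut_given_columns R Q disj r)
  also have "\<dots> = ennreal ?c * (ennreal ?C * ((\<Sum>j\<in>Q. \<integral>\<^sup>+y. ?row (y j) \<partial>?P) / of_nat (card Q))
          + ennreal (?m powr r) * (\<integral>\<^sup>+y. ennreal (?b y) \<partial>?P))"
  proof -
    have s: "(\<lambda>y. \<Sum>j\<in>Q. ?row (y j)) \<in> borel_measurable ?P" by (intro borel_measurable_sum row_m)
    then have d: "(\<lambda>y. (\<Sum>j\<in>Q. ?row (y j)) / of_nat (card Q)) \<in> borel_measurable ?P"
      by (intro borel_measurable_divide_ennreal) auto
    show ?thesis
      using s d b_m row_m
      by (simp add: nn_integral_cmult nn_integral_add nn_integral_divide nn_integral_sum)
  qed
  also have "(\<Sum>j\<in>Q. \<integral>\<^sup>+y. ?row (y j) \<partial>?P) = of_nat (card Q) * moment r"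
    by (simp add: nn_integral_PiM_component[OF N.prob_space_axioms _ row_moment_measurable] moment_def)
  also have "of_nat (card Q) * moment r / of_nat (card Q) = moment r"
    using q ennreal_mult_divide_eq[of "of_nat (card Q)" "moment r"] by (simp add: mult.commute[of "of_nat (card Q)"])
  also have "ennreal ?c * (ennreal ?C * moment r + ennreal (?m powr r) * (\<integral>\<^sup>+y. ennreal (?b y) \<partial>?P))
      \<le> ennreal ?c * (ennreal ?C * moment r + ennreal (?m powr r) * (ennreal ?C' * moment r))"
    unfolding moment_def by (intro mult_left_mono add_left_mono max_mass_moment Q r B) auto
  also have "\<dots> = ennreal (?c * (?C + ?m powr r * ?C')) * moment r"
    by (simp add: ennreal_mult ennreal_plus distrib_right mult.assoc)
  finally show ?thesis by simp
qed

text \<open>Both cardinalities in the fluctuation are enlarged to that of \<open>I\<close>, which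
  makes the bound the same for all \<open>R\<close>. The centring keeps the exact product of
  cardinalities, from which the factor 4 of decoupling is recovered.\<close>

lemma bip_cut_moment_le:
  assumes I: "finite I" "R \<subseteq> I" and r: "r \<ge> 2"
  shows "(\<integral>\<^sup>+\<omega>. ennreal (max 0 (bip_cut V R (I - R) \<omega> - real (card R) * real (card (I - R)) * B) powr r)
            \<partial>PiM I (\<lambda>_. Mu))
      \<le> ennreal (2 powr (r + 1) * (real (card I) powr r * (4 * exp 1 * r * card I) powr (r / 2))) * moment r"
proof (cases "R = {} \<or> I - R = {}")
  \<comment> \<open>The bipartite cut is 0 here; \<open>bip_cut_moment\<close> asks for two nonempty
    sides.\<close>
  case True
  then have b0: "bip_cut V R (I - R) \<omega> = 0" for \<omega> :: "_ \<Rightarrow> 'y"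
    using I finite_subset[OF I(2,1)] unfolding bip_cut_def
    by (intro Max_eqI) (auto simp: image_iff)
  have c0: "real (card R) * real (card (I - R)) = 0"
    using True by (metis card.empty mult_zero_left mult_zero_right of_nat_0)
  show ?thesis unfolding b0 c0 by simp
next
  case False
  have fR: "finite R" using I finite_subset by auto
  have k: "card R \<le> card I" "card (I - R) \<le> card I" using I by (auto intro: card_mono)
  have "(I - R) \<union> R = I" using I by auto
  then have "(\<integral>\<^sup>+\<omega>. ennreal (max 0 (bip_cut V R (I - R) \<omega> - real (card R) * real (card (I - R)) * B) powr r)
            \<partial>PiM I (\<lambda>_. Mu))
     \<le> ennreal (2 powr (r - 1) * (real (card (I - R)) powr r * (2 * (4 * exp 1 * r * card R) powr (r / 2))
          + real (card R) powr r * (2 * (4 * exp 1 * r * card (I - R)) powr (r / 2)))) * moment r"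
    using bip_cut_moment[of R "I - R" r] False fR I r by auto
  also have "\<dots> \<le> ennreal (2 powr (r + 1) * (real (card I) powr r * (4 * exp 1 * r * card I) powr (r / 2))) * moment r"
  proof (intro mult_right_mono ennreal_leI)
    have "2 powr (r - 1) * (real (card (I - R)) powr r * (2 * (4 * exp 1 * r * card R) powr (r / 2))
          + real (card R) powr r * (2 * (4 * exp 1 * r * card (I - R)) powr (r / 2)))
      \<le> 2 powr (r - 1) * (real (card I) powr r * (2 * (4 * exp 1 * r * card I) powr (r / 2))
          + real (card I) powr r * (2 * (4 * exp 1 * r * card I) powr (r / 2)))"
      using k r by (intro mult_left_mono add_mono mult_mono powr_mono2) auto
    also have "\<dots> = 2 powr (r + 1) * (real (card I) powr r * (4 * exp 1 * r * card I) powr (r / 2))"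
      by (simp add: powr_diff powr_add)
    finally show "2 powr (r - 1) * (real (card (I - R)) powr r * (2 * (4 * exp 1 * r * card R) powr (r / 2))
          + real (card R) powr r * (2 * (4 * exp 1 * r * card (I - R)) powr (r / 2))) \<le> \<dots>" .
  qed auto
  finally show ?thesis .
qed

text \<open>Decoupling: a random subset \<open>R\<close> of \<open>I\<close> separates \<open>i\<close> from \<open>j\<close> with
  probability \<open>1 / 4\<close>.\<close>

lemma diag_free_cut_le:
  assumes I: "finite I"
  shows "2 ^ card I * diag_free_cut V I \<omega> \<le> 4 * (\<Sum>R\<in>Pow I. bip_cut V R (I - R) \<omega>)"
proof -
  let ?a = "\<lambda>i j. V (\<omega> i, \<omega> j)"
  have "diag_free_cut V I \<omega> \<in> (\<lambda>(S, T). \<Sum>i\<in>S. \<Sum>j\<in>T. if i = j then 0 else ?a i j) ` (Pow I \<times> Pow I)"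
    unfolding diag_free_cut_def using I by (intro Max_in) auto
  then obtain S T where ST: "S \<subseteq> I" "T \<subseteq> I"
    and eq: "diag_free_cut V I \<omega> = (\<Sum>i\<in>S. \<Sum>j\<in>T. if i = j then 0 else ?a i j)" by auto
  have fin: "finite S" "finite T" using ST I finite_subset by auto
  have "2 ^ card I * diag_free_cut V I \<omega> = (\<Sum>i\<in>S. \<Sum>j\<in>T. 2 ^ card I * (if i = j then 0 else ?a i j))"
    by (simp add: eq sum_distrib_left)
  also have "\<dots> = (\<Sum>i\<in>S. \<Sum>j\<in>T. 4 * (\<Sum>R\<in>Pow I. if i \<in> R \<and> j \<notin> R then ?a i j else 0))"
  proof (intro sum.cong refl)
    fix i j assume ij: "i \<in> S" "j \<in> T"
    have "(\<Sum>R\<in>Pow I. if i \<in> R \<and> j \<notin> R then ?a i j else 0) = (\<Sum>R\<in>{R\<in>Pow I. i \<in> R \<and> j \<notin> R}. ?a i j)"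
      using I by (subst sum.inter_filter) auto
    also have "\<dots> = real (card {R\<in>Pow I. i \<in> R \<and> j \<notin> R}) * ?a i j" by simp
    finally have c: "(\<Sum>R\<in>Pow I. if i \<in> R \<and> j \<notin> R then ?a i j else 0) = real (card {R\<in>Pow I. i \<in> R \<and> j \<notin> R}) * ?a i j" .
    show "2 ^ card I * (if i = j then 0 else ?a i j) = 4 * (\<Sum>R\<in>Pow I. if i \<in> R \<and> j \<notin> R then ?a i j else 0)"
    proof (cases "i = j")
      case False
      then have "4 * card {R\<in>Pow I. i \<in> R \<and> j \<notin> R} = 2 ^ card I"
        using ij ST I by (intro card_separating_subsets) auto
      then have "real (4 * card {R\<in>Pow I. i \<in> R \<and> j \<notin> R}) = real (2 ^ card I)"
        by (rule arg_cong)
      then have "4 * real (card {R\<in>Pow I. i \<in> R \<and> j \<notin> R}) = 2 ^ card I"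
        by (simp only: of_nat_mult of_nat_numeral of_nat_power)
      then have "4 * (real (card {R\<in>Pow I. i \<in> R \<and> j \<notin> R}) * ?a i j) = 2 ^ card I * ?a i j"
        by (simp only: mult.assoc[symmetric])
      then show ?thesis using False unfolding c by (simp only: if_False)
    qed auto
  qed
  also have "\<dots> = 4 * (\<Sum>i\<in>S. \<Sum>j\<in>T. \<Sum>R\<in>Pow I. if i \<in> R \<and> j \<notin> R then ?a i j else 0)"
    by (simp only: sum_distrib_left)
  also have "(\<Sum>i\<in>S. \<Sum>j\<in>T. \<Sum>R\<in>Pow I. if i \<in> R \<and> j \<notin> R then ?a i j else 0)
      = (\<Sum>i\<in>S. \<Sum>R\<in>Pow I. \<Sum>j\<in>T. if i \<in> R \<and> j \<notin> R then ?a i j else 0)"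
    by (intro sum.cong refl sum.swap)
  also have "\<dots> = (\<Sum>R\<in>Pow I. \<Sum>i\<in>S. \<Sum>j\<in>T. if i \<in> R \<and> j \<notin> R then ?a i j else 0)"
    by (rule sum.swap)
  also have "\<dots> = (\<Sum>R\<in>Pow I. \<Sum>i\<in>S \<inter> R. \<Sum>j\<in>T - R. ?a i j)"
  proof (rule sum.cong[OF refl])
    fix R
    have "(\<Sum>i\<in>S \<inter> R. \<Sum>j\<in>T - R. ?a i j) = (\<Sum>i\<in>S. if i \<in> R then (\<Sum>j\<in>T - R. ?a i j) else 0)"
      using fin by (simp add: sum.inter_restrict)
    also have "\<dots> = (\<Sum>i\<in>S. \<Sum>j\<in>T. if i \<in> R \<and> j \<notin> R then ?a i j else 0)"
    proof (intro sum.cong refl)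
      fix i
      have "T - R = T \<inter> {j. j \<notin> R}" by auto
      then show "(if i \<in> R then (\<Sum>j\<in>T - R. ?a i j) else 0) = (\<Sum>j\<in>T. if i \<in> R \<and> j \<notin> R then ?a i j else 0)"
        using fin by (simp add: sum.inter_restrict)
    qed
    finally show "(\<Sum>i\<in>S. \<Sum>j\<in>T. if i \<in> R \<and> j \<notin> R then ?a i j else 0) = (\<Sum>i\<in>S \<inter> R. \<Sum>j\<in>T - R. ?a i j)" ..
  qed
  also have "\<dots> \<le> (\<Sum>R\<in>Pow I. bip_cut V R (I - R) \<omega>)"
  proof (rule sum_mono)
    fix R assume "R \<in> Pow I"
    then have "(S \<inter> R, T - R) \<in> Pow R \<times> Pow (I - R)" "finite (Pow R \<times> Pow (I - R))"
      using ST I by (auto intro: finite_subset)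
    then show "(\<Sum>i\<in>S \<inter> R. \<Sum>j\<in>T - R. ?a i j) \<le> bip_cut V R (I - R) \<omega>"
      unfolding bip_cut_def by (intro Max_ge) (auto simp: image_iff intro!: bexI[of _ "(S \<inter> R, T - R)"])
  qed
  finally show ?thesis by simp
qed

text \<open>The splits \<open>R\<close> are averaged by the power mean inequality. As
  \<open>4 * (card R * card (I - R))\<close> is at most \<open>(card I)\<^sup>2\<close>, the
  coefficient of \<open>B\<close> per pair of indices remains 1. The constant is 256 = 4^2 * 2^2 *
  4: the decoupling factor 4 and the 2 of \<open>2 powr (r + 1)\<close> are squared under the
  exponent \<open>r / 2\<close>, and the last 4 stems from \<open>max_mass_moment\<close>.\<close>

lemma diag_free_cut_moment:
  assumes I: "finite I" and r: "r \<ge> 2"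
  shows "(\<integral>\<^sup>+\<omega>. ennreal (max 0 (diag_free_cut V I \<omega> - real (card I) ^ 2 * B) powr r) \<partial>PiM I (\<lambda>_. Mu))
      \<le> ennreal (2 * (256 * exp 1 * r * real (card I) ^ 3) powr (r / 2)) * moment r"
proof -
  let ?k = "real (card I)"
  let ?d = "\<lambda>R \<omega>. max 0 (bip_cut V R (I - R) \<omega> - real (card R) * real (card (I - R)) * B)"
  let ?n = "2 ^ card I :: real"
  let ?C = "2 powr (r + 1) * (?k powr r * (4 * exp 1 * r * ?k) powr (r / 2))"
  have nP: "real (card (Pow I)) = ?n" using I by (simp add: card_Pow)
  have pt: "max 0 (diag_free_cut V I \<omega> - ?k ^ 2 * B) powr r \<le> (4 powr r / ?n) * (\<Sum>R\<in>Pow I. ?d R \<omega> powr r)" for \<omega> :: "_ \<Rightarrow> 'y"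
  proof -
    have sq: "4 * (real (card R) * real (card (I - R))) \<le> ?k ^ 2" if "R \<in> Pow I" for R
    proof -
      have "?k = real (card R) + real (card (I - R))"
        using that I by (metis PowD card_Diff_subset card_mono finite_subset le_add_diff_inverse of_nat_add)
      then show ?thesis using zero_le_power2[of "real (card R) - real (card (I - R))"]
        by (simp add: power2_eq_square algebra_simps)
    qed
    have "?n * (diag_free_cut V I \<omega> - ?k ^ 2 * B) \<le> (\<Sum>R\<in>Pow I. 4 * bip_cut V R (I - R) \<omega> - ?k ^ 2 * B)"
      using diag_free_cut_le[OF I, of \<omega>] nP
      by (simp add: sum_subtractf sum_distrib_left right_diff_distrib)
    also have "\<dots> \<le> (\<Sum>R\<in>Pow I. 4 * ?d R \<omega>)"
    proof (rule sum_mono)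
      fix R assume "R \<in> Pow I"
      then have "4 * (real (card R) * real (card (I - R))) * B \<le> ?k ^ 2 * B"
        using B_nonneg by (intro mult_right_mono sq)
      then show "4 * bip_cut V R (I - R) \<omega> - ?k ^ 2 * B \<le> 4 * ?d R \<omega>" by (simp add: algebra_simps max_def)
    qed
    finally have "max 0 (?n * (diag_free_cut V I \<omega> - ?k ^ 2 * B)) \<le> (\<Sum>R\<in>Pow I. 4 * ?d R \<omega>)"
      by (auto intro!: sum_nonneg)
    then have "(?n * max 0 (diag_free_cut V I \<omega> - ?k ^ 2 * B)) powr r \<le> (\<Sum>R\<in>Pow I. 4 * ?d R \<omega>) powr r"
      using r by (intro powr_mono2) (auto simp: max_0_mult)
    also have "\<dots> \<le> ?n powr (r - 1) * (\<Sum>R\<in>Pow I. (4 * ?d R \<omega>) powr r)"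
      using I r unfolding nP[symmetric] by (intro sum_powr_le) auto
    also have "\<dots> = ?n powr (r - 1) * (4 powr r * (\<Sum>R\<in>Pow I. ?d R \<omega> powr r))"
      by (simp add: powr_mult sum_distrib_left)
    finally have "?n powr r * max 0 (diag_free_cut V I \<omega> - ?k ^ 2 * B) powr r
        \<le> ?n powr r * ((4 powr r / ?n) * (\<Sum>R\<in>Pow I. ?d R \<omega> powr r))"
      by (simp add: powr_mult powr_diff)
    then show ?thesis by (subst (asm) mult_le_cancel_left_pos) auto
  qed
  have dm: "(\<lambda>\<omega>. ennreal (?d R \<omega> powr r)) \<in> borel_measurable (PiM I (\<lambda>_. Mu))" if "R \<in> Pow I" for R
  proof -
    have [measurable]: "bip_cut V R (I - R) \<in> borel_measurable (PiM I (\<lambda>_. Mu))"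
      using that I by (intro measurable_bip_cut W_meas) (auto intro: finite_subset)
    show ?thesis by measurable
  qed
  have "(\<integral>\<^sup>+\<omega>. ennreal (max 0 (diag_free_cut V I \<omega> - ?k ^ 2 * B) powr r) \<partial>PiM I (\<lambda>_. Mu))
      \<le> (\<integral>\<^sup>+\<omega>. ennreal (4 powr r / ?n) * (\<Sum>R\<in>Pow I. ennreal (?d R \<omega> powr r)) \<partial>PiM I (\<lambda>_. Mu))"
  proof (rule nn_integral_mono)
    fix \<omega> :: "_ \<Rightarrow> 'y"
    have "ennreal (max 0 (diag_free_cut V I \<omega> - ?k ^ 2 * B) powr r)
        \<le> ennreal ((4 powr r / ?n) * (\<Sum>R\<in>Pow I. ?d R \<omega> powr r))" by (intro ennreal_leI pt)
    also have "\<dots> = ennreal (4 powr r / ?n) * (\<Sum>R\<in>Pow I. ennreal (?d R \<omega> powr r))"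
      by (subst ennreal_mult) (auto intro!: sum_nonneg simp: sum_ennreal)
    finally show "ennreal (max 0 (diag_free_cut V I \<omega> - ?k ^ 2 * B) powr r) \<le> \<dots>" .
  qed
  also have "\<dots> = ennreal (4 powr r / ?n) * (\<Sum>R\<in>Pow I. \<integral>\<^sup>+\<omega>. ennreal (?d R \<omega> powr r) \<partial>PiM I (\<lambda>_. Mu))"
    using dm by (subst nn_integral_cmult) (auto intro!: borel_measurable_sum simp only: nn_integral_sum)
  also have "\<dots> \<le> ennreal (4 powr r / ?n) * (\<Sum>R\<in>Pow I. ennreal ?C * moment r)"
    using I r by (intro mult_left_mono sum_mono bip_cut_moment_le) auto
  also have "\<dots> = ennreal (4 powr r / ?n) * (ennreal ?n * (ennreal ?C * moment r))"
    by (simp only: nP[symmetric] sum_constant) (simp add: ennreal_of_nat_eq_real_of_nat)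
  also have "\<dots> = ennreal (4 powr r / ?n * ?n * ?C) * moment r"
    by (subst ennreal_mult, simp, simp, subst ennreal_mult) (auto simp: mult.assoc)
  also have "4 powr r / ?n * ?n * ?C = 2 * (256 * exp 1 * r * ?k ^ 3) powr (r / 2)"
  proof -
    have sq: "x powr r = (x ^ 2) powr (r / 2)" if "x \<ge> 0" for x :: real
    proof -
      have "(x ^ 2) powr (r / 2) = (x powr 2) powr (r / 2)" using that by simp
      then show ?thesis by (simp only: powr_powr) simp
    qed
    have "4 powr r / ?n * ?n * ?C = 2 * (4 powr r * 2 powr r * ?k powr r * (4 * exp 1 * r * ?k) powr (r / 2))"
      by (simp add: powr_add)
    also have "4 powr r * 2 powr r * ?k powr r * (4 * exp 1 * r * ?k) powr (r / 2)
        = ((4 ^ 2) * (2 ^ 2) * ?k ^ 2 * (4 * exp 1 * r * ?k)) powr (r / 2)"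
      by (simp only: powr_mult sq[of 4] sq[of 2] sq[of ?k] zero_le_numeral of_nat_0_le_iff)
    also have "(4 ^ 2) * (2 ^ 2) * ?k ^ 2 * (4 * exp 1 * r * ?k) = 256 * exp 1 * r * ?k ^ 3"
      by (simp add: power2_eq_square power3_eq_cube)
    finally show ?thesis .
  qed
  finally show ?thesis .
qed

end
section \<open>The cut norm of a sampled step function\<close>

lemma AE_lborel_fst: "AE x in lborel. P x \<Longrightarrow> AE z in (lborel :: (real \<times> real) measure). P (fst z)"
  and AE_lborel_snd: "AE x in lborel. P x \<Longrightarrow> AE z in (lborel :: (real \<times> real) measure). P (snd z)"
proof -
  have null: "N \<times> UNIV \<in> null_sets (lborel :: (real \<times> real) measure)"
             "UNIV \<times> N \<in> null_sets (lborel :: (real \<times> real) measure)"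
    if "N \<in> null_sets lborel" for N :: "real set"
    using that by (auto simp: null_sets_def lborel_prod[symmetric] lborel.emeasure_pair_measure_Times)
  assume "AE x in lborel. P x"
  then obtain N where N: "{x. \<not> P x} \<subseteq> N" "N \<in> null_sets lborel" by (auto elim!: AE_E simp: null_sets_def)
  show "AE z in (lborel :: (real \<times> real) measure). P (fst z)"
    by (rule AE_I'[OF null(1)[OF N(2)]]) (use N(1) in auto)
  show "AE z in (lborel :: (real \<times> real) measure). P (snd z)"
    by (rule AE_I'[OF null(2)[OF N(2)]]) (use N(1) in auto)
qed

text \<open>Both factors are replaced by Borel sets up to null sets; the cylinders over these null
  sets are null in the plane, so the product changes only by a null set.\<close>

lemma lebesgue_Times:
  fixes S T :: "real set"
  assumes "S \<in> sets lebesgue" "T \<in> sets lebesgue"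
  shows "S \<times> T \<in> sets lebesgue"
    and "emeasure lebesgue (S \<times> T) = emeasure lebesgue S * emeasure lebesgue T"
proof -
  define S0 T0 where "S0 = main_part lborel S" and "T0 = main_part lborel T"
  have S0: "S0 \<in> sets lborel" "T0 \<in> sets lborel" "emeasure lebesgue S = emeasure lborel S0"
    "emeasure lebesgue T = emeasure lborel T0"
    using assms main_part_sets[of _ lborel] unfolding S0_def T0_def by auto
  have "AE x in lborel. x \<in> S \<longleftrightarrow> x \<in> S0" "AE x in lborel. x \<in> T \<longleftrightarrow> x \<in> T0"
    using AE_in_main_part[OF assms(1)] AE_in_main_part[OF assms(2)] by (auto simp: S0_def T0_def)
  from AE_lborel_fst[OF this(1)] AE_lborel_snd[OF this(2)]
  have ae: "AE z in lebesgue. z \<in> S \<times> T \<longleftrightarrow> z \<in> S0 \<times> T0"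
    unfolding AE_completion_iff by eventually_elim auto
  have 0: "S0 \<times> T0 \<in> sets (lborel :: (real \<times> real) measure)"
    using S0 unfolding lborel_prod[symmetric] by auto
  show 1: "S \<times> T \<in> sets lebesgue"
  proof (rule completion.in_sets_AE[of "S0 \<times> T0"])
    show "AE z in lebesgue. z \<in> S0 \<times> T0 \<longleftrightarrow> z \<in> S \<times> T" using ae by eventually_elim (rule sym)
  qed (use 0 in simp_all)
  have "emeasure lebesgue (S \<times> T) = emeasure lebesgue (S0 \<times> T0)"
    by (rule emeasure_eq_AE[OF ae 1]) (use 0 in simp)
  also have "\<dots> = emeasure lborel (S0 \<times> T0)" using 0 by simp
  also have "\<dots> = emeasure lborel S0 * emeasure lborel T0"
    unfolding lborel_prod[symmetric] using S0(1,2) by (rule lborel.emeasure_pair_measure_Times)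
  finally show "emeasure lebesgue (S \<times> T) = emeasure lebesgue S * emeasure lebesgue T"
    using S0 by simp
qed

section \<open>Steps, sign vectors and the duality of the two norms\<close>

definition step_interval :: "nat \<Rightarrow> nat \<Rightarrow> real set" where
  "step_interval k i = {(real i - 1) / real k..<real i / real k}"

text \<open>The extreme points of the unit ball of \<open>infnorm\<close>, at which linear forms
  attain their maximum over that ball.\<close>

definition signs :: "(real ^ 'n) set" where
  "signs = {s. \<forall>i. s $ i = 1 \<or> s $ i = - 1}"

lemma signs_eq: "signs = vec_lambda ` (UNIV \<rightarrow>\<^sub>E {1, - 1})"
proof (intro equalityI subsetI)
  fix s :: "real ^ 'n" assume "s \<in> signs"
  then have "vec_nth s \<in> UNIV \<rightarrow>\<^sub>E {1, - 1}" by (auto simp: signs_def)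
  then show "s \<in> vec_lambda ` (UNIV \<rightarrow>\<^sub>E {1, - 1})" by (rule image_eqI[rotated]) simp
qed (auto simp: signs_def PiE_iff)

lemma finite_signs [simp]: "finite signs"
  unfolding signs_eq by (intro finite_imageI finite_PiE) auto

lemma card_signs: "card (signs :: (real ^ 'n) set) = 2 ^ CARD('n)"
proof -
  have "inj_on vec_lambda (UNIV \<rightarrow>\<^sub>E {1, - 1 :: real} :: ('n \<Rightarrow> real) set)"
    by (intro inj_onI) (simp add: vec_lambda_inject)
  then show ?thesis unfolding signs_eq by (simp add: card_image card_PiE numeral_2_eq_2)
qed

lemma signs_nonempty [simp]: "signs \<noteq> {}"
  by (auto simp: signs_def intro!: exI[of _ "\<chi> i. 1"])

lemma infnorm_signs:
  assumes "s \<in> signs" shows "infnorm s = 1"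
proof -
  have "{\<bar>s $ i\<bar> | i. i \<in> UNIV} = {1}"   proof -
    have "\<bar>s $ i\<bar> = 1" for i using assms by (auto simp: signs_def dest: spec[of _ i])
    then show ?thesis by auto
  qed
  then show ?thesis by (simp add: infnorm_cart)
qed

lemma inner_le_infnorm_l1norm: "\<bar>f \<bullet> w\<bar> \<le> infnorm f * l1norm w"
proof -
  have "\<bar>f \<bullet> w\<bar> \<le> (\<Sum>i\<in>UNIV. \<bar>f $ i * w $ i\<bar>)" unfolding inner_vec_def by simp
  also have "\<dots> \<le> (\<Sum>i\<in>UNIV. infnorm f * \<bar>w $ i\<bar>)"
    by (intro sum_mono) (auto simp: abs_mult intro!: mult_right_mono component_le_infnorm_cart)
  finally show ?thesis by (simp add: l1norm_def sum_distrib_left)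
qed

lemma l1norm_eq_inner_sign:
  fixes w :: "real ^ 'n"
  shows "\<exists>s\<in>signs. l1norm w = s \<bullet> w"
proof
  let ?s = "\<chi> i. (if w $ i \<ge> 0 then 1 else (- 1 :: real))"
  show "?s \<in> signs" by (auto simp: signs_def)
  show "l1norm w = ?s \<bullet> w" by (auto simp: l1norm_def inner_vec_def intro!: sum.cong)
qed

lemma diag_free_cut_ge:
  assumes "finite I" "S \<subseteq> I" "T \<subseteq> I"
  shows "(\<Sum>i\<in>S. \<Sum>j\<in>T. if i = j then 0 else V (\<omega> i, \<omega> j)) \<le> diag_free_cut V I \<omega>"
  unfolding diag_free_cut_def using assms
  by (intro Max_ge) (auto simp: image_iff intro!: bexI[of _ "(S, T)"])

text \<open>A bilinear form on a box is maximal at a vertex. For fixed \<open>t\<close> the best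
  \<open>s\<close> equals \<open>c\<close> on the positive coefficients and 0 elsewhere; with this
  \<open>s\<close> the same holds for \<open>t\<close>, which is why \<open>T\<close> is defined
  through \<open>S\<close>.\<close>

lemma bilinear_le_subset_max:
  fixes a :: "'i \<Rightarrow> 'i \<Rightarrow> real"
  assumes I: "finite I" and c: "c \<ge> 0" and s: "\<And>i. i \<in> I \<Longrightarrow> 0 \<le> s i \<and> s i \<le> c"
    and t: "\<And>i. i \<in> I \<Longrightarrow> 0 \<le> t i \<and> t i \<le> c"
  obtains S T where "S \<subseteq> I" "T \<subseteq> I" "(\<Sum>i\<in>I. \<Sum>j\<in>I. s i * t j * a i j) \<le> c\<^sup>2 * (\<Sum>i\<in>S. \<Sum>j\<in>T. a i j)"
proof -
  have lin: "(\<Sum>i\<in>I. u i * b i) \<le> c * (\<Sum>i\<in>{i\<in>I. b i > 0}. b i)"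
    if "\<And>i. i \<in> I \<Longrightarrow> 0 \<le> u i \<and> u i \<le> c" for u b :: "'i \<Rightarrow> real"
  proof -
    have "(\<Sum>i\<in>I. u i * b i) \<le> (\<Sum>i\<in>I. if b i > 0 then c * b i else 0)"
      using that by (intro sum_mono) (auto intro: mult_right_mono mult_nonneg_nonpos)
    also have "\<dots> = (\<Sum>i\<in>{i\<in>I. b i > 0}. c * b i)" using I by (rule sum.inter_filter[symmetric])
    finally show ?thesis by (simp add: sum_distrib_left)
  qed
  define S where "S = {i\<in>I. (\<Sum>j\<in>I. t j * a i j) > 0}"
  define T where "T = {j\<in>I. (\<Sum>i\<in>S. a i j) > 0}"
  have "(\<Sum>i\<in>I. \<Sum>j\<in>I. s i * t j * a i j) = (\<Sum>i\<in>I. s i * (\<Sum>j\<in>I. t j * a i j))"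
    by (simp add: sum_distrib_left mult.assoc)
  also have "\<dots> \<le> c * (\<Sum>i\<in>S. \<Sum>j\<in>I. t j * a i j)" unfolding S_def by (rule lin[OF s])
  also have "(\<Sum>i\<in>S. \<Sum>j\<in>I. t j * a i j) = (\<Sum>j\<in>I. t j * (\<Sum>i\<in>S. a i j))"
    by (subst sum.swap) (simp add: sum_distrib_left)
  also have "c * (\<Sum>j\<in>I. t j * (\<Sum>i\<in>S. a i j)) \<le> c * (c * (\<Sum>j\<in>T. \<Sum>i\<in>S. a i j))"
    unfolding T_def using c by (intro mult_left_mono lin[OF t])
  also have "(\<Sum>j\<in>T. \<Sum>i\<in>S. a i j) = (\<Sum>i\<in>S. \<Sum>j\<in>T. a i j)" by (rule sum.swap)
  finally have "(\<Sum>i\<in>I. \<Sum>j\<in>I. s i * t j * a i j) \<le> c\<^sup>2 * (\<Sum>i\<in>S. \<Sum>j\<in>T. a i j)"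
    by (simp add: power2_eq_square mult.assoc)
  moreover have "S \<subseteq> I" "T \<subseteq> I" by (auto simp: S_def T_def)
  ultimately show ?thesis using that by blast
qed

lemma measure_step_interval:
  assumes k: "k > 0" and S: "S \<in> sets lebesgue"
  shows "S \<inter> step_interval k i \<in> sets lebesgue"
    and "emeasure lebesgue (S \<inter> step_interval k i) \<le> ennreal (1 / real k)"
    and "measure lebesgue (S \<inter> step_interval k i) \<le> 1 / real k"
    and "emeasure lebesgue (step_interval k i) = ennreal (1 / real k)"
proof -
  have m: "step_interval k i \<in> sets lborel" by (simp add: step_interval_def)
  then have ml: "step_interval k i \<in> sets lebesgue" by simp
  show "S \<inter> step_interval k i \<in> sets lebesgue" using S ml by blast
  have e: "(real i - 1) / real k \<le> real i / real k" by (intro divide_right_mono) auto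
  have "emeasure lebesgue (step_interval k i) = emeasure lborel (step_interval k i)"
    using m by simp
  also have "\<dots> = ennreal (1 / real k)"
    unfolding step_interval_def using e by (simp add: diff_divide_distrib)
  finally show eq: "emeasure lebesgue (step_interval k i) = ennreal (1 / real k)" .
  show le: "emeasure lebesgue (S \<inter> step_interval k i) \<le> ennreal (1 / real k)"
    unfolding eq[symmetric] using ml by (intro emeasure_mono) auto
  then show "measure lebesgue (S \<inter> step_interval k i) \<le> 1 / real k"
    unfolding measure_def using enn2real_leI by auto
qed

lemma set_integral_sampled_step:
  assumes k: "k > 0" and S: "S \<in> sets lebesgue" and T: "T \<in> sets lebesgue"
  shows "(LINT z:S \<times> T|lebesgue. f \<bullet> sampled_step k U x z)
    = (\<Sum>i\<in>{1..k}. \<Sum>j\<in>{1..k}. measure lebesgue (S \<inter> step_interval k i)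
        * measure lebesgue (T \<inter> step_interval k j) * (if i = j then 0 else f \<bullet> U (x i, x j)))"
proof -
  let ?A = "\<lambda>i j. (S \<inter> step_interval k i) \<times> (T \<inter> step_interval k j)"
  let ?c = "\<lambda>i j. if i = j then 0 else f \<bullet> U (x i, x j)"
  note mS = measure_step_interval[OF k S] and mT = measure_step_interval[OF k T]
  have sets: "?A i j \<in> sets lebesgue"
    and em: "emeasure lebesgue (?A i j) = emeasure lebesgue (S \<inter> step_interval k i) * emeasure lebesgue (T \<inter> step_interval k j)" for i j
    using lebesgue_Times[OF mS(1) mT(1)] by auto
  have fin: "emeasure lebesgue (?A i j) < \<infinity>" for i j
  proof -
    have "emeasure lebesgue (?A i j) \<le> ennreal (1 / real k) * ennreal (1 / real k)"
      unfolding em by (intro mult_mono mS mT) auto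
    then show ?thesis by (simp add: ennreal_mult[symmetric] le_less_trans)
  qed
  have int: "integrable lebesgue (\<lambda>z. ?c i j * indicator (?A i j) z)" for i j
    using sets fin by (intro integrable_mult_right integrable_real_indicator) auto
  have "(LINT z:S \<times> T|lebesgue. f \<bullet> sampled_step k U x z)
      = (LINT z|lebesgue. (\<Sum>i\<in>{1..k}. \<Sum>j\<in>{1..k}. ?c i j * indicator (?A i j) z))"
    unfolding set_lebesgue_integral_def
  proof (intro Bochner_Integration.integral_cong refl)
    fix z
    have "f \<bullet> sampled_step k U x z = (\<Sum>i\<in>{1..k}. \<Sum>j\<in>{1..k}.
        indicator (step_interval k i \<times> step_interval k j) z * ?c i j)"
      unfolding sampled_step_def inner_sum_right step_interval_def
      by (intro sum.cong refl) auto
    then show "indicator (S \<times> T) z *\<^sub>R (f \<bullet> sampled_step k U x z)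
        = (\<Sum>i\<in>{1..k}. \<Sum>j\<in>{1..k}. ?c i j * indicator (?A i j) z)"
      by (simp only: real_scaleR_def sum_distrib_left) (intro sum.cong refl, auto simp: indicator_def)
  qed
  also have "\<dots> = (\<Sum>i\<in>{1..k}. \<Sum>j\<in>{1..k}. ?c i j * measure lebesgue (?A i j))"
  proof -
    have "(LINT z|lebesgue. ?c i j * indicator (?A i j) z) = ?c i j * measure lebesgue (?A i j)" for i j
      using sets fin by simp
    then show ?thesis using int by (simp only: Bochner_Integration.integral_sum Bochner_Integration.integrable_sum)
  qed
  also have "\<dots> = (\<Sum>i\<in>{1..k}. \<Sum>j\<in>{1..k}. measure lebesgue (S \<inter> step_interval k i)
        * measure lebesgue (T \<inter> step_interval k j) * ?c i j)"
    by (intro sum.cong refl) (simp add: measure_def em enn2real_mult)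
  finally show ?thesis .
qed

text \<open>Equality holds because neither larger family gains anything: sets that meet the steps in
  fractions are no better than unions of steps, by \<open>bilinear_le_subset_max\<close>, and
  functionals of norm 1 are no better than sign vectors, by the duality of \<open>l1norm\<close> and
  \<open>infnorm\<close>.\<close>

lemma cut_norm_sampled_step:
  fixes U :: "real \<times> real \<Rightarrow> real ^ 'n"
  assumes k: "k > 0"
  shows "cut_norm (sampled_step k U x)
    = Max ((\<lambda>s. diag_free_cut (\<lambda>z. s \<bullet> U z) {1..k} x) ` signs) / (real k)\<^sup>2"
proof -
  let ?I = "{1..k}"
  let ?M = "Max ((\<lambda>s. diag_free_cut (\<lambda>z. s \<bullet> U z) ?I x) ` signs)"
  let ?LS = "{S \<in> sets lebesgue. S \<subseteq> {0..1::real}}"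
  let ?int = "\<lambda>f p. \<bar>LINT z:fst p \<times> snd p|lebesgue. f \<bullet> sampled_step k U x z\<bar>"
  have cnr: "cut_norm_real (\<lambda>z. f \<bullet> sampled_step k U x z) = (SUP p\<in>?LS \<times> ?LS. ?int f p)" for f
    unfolding cut_norm_real_def by (intro SUP_cong) auto
  have sum_le: "(\<Sum>i\<in>S. \<Sum>j\<in>T. if i = j then 0 else f \<bullet> U (x i, x j)) \<le> ?M"
    if f: "infnorm f = 1" and ST: "S \<subseteq> ?I" "T \<subseteq> ?I" for f S T
  proof -
    \<comment> \<open>For fixed \<open>S\<close> and \<open>T\<close> the functional acts linearly
      on the single vector \<open>?w\<close>, so the sign pattern of \<open>?w\<close> is the best
      choice.\<close>
    let ?w = "\<Sum>i\<in>S. \<Sum>j\<in>T. if i = j then 0 else U (x i, x j)"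
    have inner: "g \<bullet> ?w = (\<Sum>i\<in>S. \<Sum>j\<in>T. if i = j then 0 else g \<bullet> U (x i, x j))" for g
      by (auto simp: inner_sum_right intro!: sum.cong)
    obtain s where s: "s \<in> signs" "l1norm ?w = s \<bullet> ?w" using l1norm_eq_inner_sign by blast
    have "f \<bullet> ?w \<le> s \<bullet> ?w" using inner_le_infnorm_l1norm[of f ?w] f s by simp
    also have "\<dots> \<le> diag_free_cut (\<lambda>z. s \<bullet> U z) ?I x"
      unfolding inner using ST by (intro diag_free_cut_ge) auto
    also have "\<dots> \<le> ?M" using s by (intro Max_ge) auto
    finally show ?thesis unfolding inner .
  qed
  have upper: "?int f p \<le> ?M / (real k)\<^sup>2" if f: "infnorm f = 1" and p: "p \<in> ?LS \<times> ?LS" for f p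
  proof -
    have one: "(LINT z:fst p \<times> snd p|lebesgue. g \<bullet> sampled_step k U x z) \<le> ?M / (real k)\<^sup>2"
      if g: "infnorm g = 1" for g
    proof -
      have ps: "fst p \<in> sets lebesgue" "snd p \<in> sets lebesgue" using p by auto
      obtain S T where ST: "S \<subseteq> ?I" "T \<subseteq> ?I"
        and le: "(\<Sum>i\<in>?I. \<Sum>j\<in>?I. measure lebesgue (fst p \<inter> step_interval k i)
          * measure lebesgue (snd p \<inter> step_interval k j) * (if i = j then 0 else g \<bullet> U (x i, x j)))
          \<le> (1 / real k)\<^sup>2 * (\<Sum>i\<in>S. \<Sum>j\<in>T. if i = j then 0 else g \<bullet> U (x i, x j))"
        by (rule bilinear_le_subset_max[of ?I "1 / real k" "\<lambda>i. measure lebesgue (fst p \<inter> step_interval k i)"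
            "\<lambda>j. measure lebesgue (snd p \<inter> step_interval k j)" "\<lambda>i j. if i = j then 0 else g \<bullet> U (x i, x j)"])
           (use measure_step_interval(3)[OF k] ps in auto)
      note le
      also have "(1 / real k)\<^sup>2 * (\<Sum>i\<in>S. \<Sum>j\<in>T. if i = j then 0 else g \<bullet> U (x i, x j)) \<le> (1 / real k)\<^sup>2 * ?M"
        using sum_le[OF g ST] by (intro mult_left_mono) auto
      finally show ?thesis
        unfolding set_integral_sampled_step[OF k ps] by (simp add: power_divide)
    qed
    \<comment> \<open>The bound \<open>one\<close> is one-sided; applied to \<open>- f\<close>,
      which has norm 1 as well, it gives the absolute value.\<close>
    have "(LINT z:fst p \<times> snd p|lebesgue. (- f) \<bullet> sampled_step k U x z)
        = - (LINT z:fst p \<times> snd p|lebesgue. f \<bullet> sampled_step k U x z)"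
      by (simp add: set_lebesgue_integral_def)
    then show ?thesis using one[of f] one[of "- f"] f by (auto simp: infnorm_neg abs_le_iff)
  qed
  have bdd: "bdd_above (?int f ` (?LS \<times> ?LS))" if "infnorm f = 1" for f
    using upper[OF that] by (intro bdd_aboveI[of _ "?M / (real k)\<^sup>2"]) auto
  have LS: "({}, {}) \<in> ?LS \<times> ?LS" by auto
  have real_le: "cut_norm_real (\<lambda>z. f \<bullet> sampled_step k U x z) \<le> ?M / (real k)\<^sup>2" if "infnorm f = 1" for f
    unfolding cnr using LS upper[OF that] by (intro cSUP_least) auto
  have norm_one: "\<exists>f :: real ^ 'n. infnorm f = 1" using signs_nonempty infnorm_signs by blast
  show ?thesis
  proof (rule antisym)
    show "cut_norm (sampled_step k U x) \<le> ?M / (real k)\<^sup>2"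
      unfolding cut_norm_def using norm_one real_le by (intro cSUP_least) auto
    have "?M \<in> (\<lambda>s. diag_free_cut (\<lambda>z. s \<bullet> U z) ?I x) ` signs" by (intro Max_in) auto
    then obtain s where s: "s \<in> signs" "?M = diag_free_cut (\<lambda>z. s \<bullet> U z) ?I x" by (rule imageE)
    have "diag_free_cut (\<lambda>z. s \<bullet> U z) ?I x
        \<in> (\<lambda>(S, T). \<Sum>i\<in>S. \<Sum>j\<in>T. if i = j then 0 else s \<bullet> U (x i, x j)) ` (Pow ?I \<times> Pow ?I)"
      unfolding diag_free_cut_def by (intro Max_in) auto
    then obtain S T where ST: "S \<subseteq> ?I" "T \<subseteq> ?I"
      and M: "?M = (\<Sum>i\<in>S. \<Sum>j\<in>T. if i = j then 0 else s \<bullet> U (x i, x j))" using s(2) by auto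
    define steps where "steps A = (\<Union>i\<in>A. step_interval k i)" for A
    have disj: "step_interval k i \<inter> step_interval k j = {}" if "i \<noteq> j" for i j
    proof -
      have "z \<notin> step_interval k j" if "z \<in> step_interval k i" "i < j" for z i j
      proof -
        have "real i / real k \<le> (real j - 1) / real k" using that by (intro divide_right_mono) auto
        then show ?thesis using that by (auto simp: step_interval_def)
      qed
      then show ?thesis using \<open>i \<noteq> j\<close> by (metis disjoint_iff nat_neq_iff)
    qed
    have steps_meas: "measure lebesgue (steps A \<inter> step_interval k i) = (if i \<in> A then 1 / real k else 0)" for A i
    proof -
      have "steps A \<inter> step_interval k i = (if i \<in> A then step_interval k i else {})"
      proof (cases "i \<in> A")
        case False
        then have "step_interval k j \<inter> step_interval k i = {}" if "j \<in> A" for j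
          using that by (intro disj) auto
        then show ?thesis using False unfolding steps_def by simp blast
      qed (auto simp: steps_def)
      then show ?thesis using measure_step_interval(4)[OF k sets.empty_sets, of i] by (simp add: measure_def)
    qed
    have steps_LS: "steps A \<in> ?LS" if "A \<subseteq> ?I" for A
    proof -
      have "step_interval k i \<in> sets lborel" for i by (simp add: step_interval_def)
      then have "step_interval k i \<in> sets lebesgue" for i by simp
      moreover have "step_interval k i \<subseteq> {0..1}" if "i \<in> ?I" for i
      proof -
        have "0 \<le> (real i - 1) / real k" "real i / real k \<le> 1" using that k by auto
        then show ?thesis unfolding step_interval_def by (meson atLeastAtMost_iff atLeastLessThan_iff less_le_trans less_imp_le order_trans subsetI)
      qed
      ultimately have "steps A \<in> sets lebesgue" "steps A \<subseteq> {0..1}"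
        unfolding steps_def using that finite_subset[OF that]
        by (auto simp only: intro!: sets.finite_UN UN_least)
      then show ?thesis by simp
    qed
    have p: "(steps S, steps T) \<in> ?LS \<times> ?LS" using steps_LS ST by auto
    have "(LINT z:steps S \<times> steps T|lebesgue. s \<bullet> sampled_step k U x z)
        = (\<Sum>i\<in>?I. \<Sum>j\<in>?I. (if i \<in> S then 1 / real k else 0) * (if j \<in> T then 1 / real k else 0)
            * (if i = j then 0 else s \<bullet> U (x i, x j)))"
      using p by (subst set_integral_sampled_step[OF k]) (auto simp: steps_meas)
    also have "\<dots> = (\<Sum>i\<in>?I. if i \<in> S then (\<Sum>j\<in>?I. if j \<in> T then
        (if i = j then 0 else s \<bullet> U (x i, x j)) / (real k)\<^sup>2 else 0) else 0)"
      by (intro sum.cong refl) (auto simp: power2_eq_square intro!: sum.cong)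
    also have "\<dots> = (\<Sum>i\<in>S. \<Sum>j\<in>T. (if i = j then 0 else s \<bullet> U (x i, x j)) / (real k)\<^sup>2)"
      using ST by (simp add: sum.inter_restrict[symmetric] Int_absorb1)
    also have "\<dots> = ?M / (real k)\<^sup>2" unfolding M by (simp only: sum_divide_distrib)
    finally have "?int s (steps S, steps T) = \<bar>?M / (real k)\<^sup>2\<bar>" by (simp only: fst_conv snd_conv)
    then have "?M / (real k)\<^sup>2 \<le> ?int s (steps S, steps T)" by (simp only: abs_ge_self)
    also have "\<dots> \<le> cut_norm_real (\<lambda>z. s \<bullet> sampled_step k U x z)"
      unfolding cnr by (rule cSUP_upper[OF p bdd[OF infnorm_signs[OF s(1)]]])
    also have "\<dots> \<le> cut_norm (sampled_step k U x)"
      unfolding cut_norm_def using infnorm_signs[OF s(1)] real_le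
      by (intro cSUP_upper2[of _ _ s]) (auto intro!: bdd_aboveI[of _ "?M / (real k)\<^sup>2"])
    finally show "?M / (real k)\<^sup>2 \<le> cut_norm (sampled_step k U x)" .
  qed
qed

section \<open>Truncation of kernels\<close>

abbreviation unif :: "real measure" where
  "unif \<equiv> uniform_measure lborel {0..1}"

lemma unif_eq_density: "unif = density lborel (\<lambda>x. ennreal (indicator {0..1} x))"
  unfolding uniform_measure_def by (intro density_cong) (auto simp: indicator_def)

lemma prob_space_unif: "prob_space unif"
  by (rule prob_space_uniform_measure) auto

lemma sets_unif [simp, measurable_cong]: "sets unif = sets borel" and space_unif [simp]: "space unif = UNIV"
  by (simp_all add: uniform_measure_def)

lemma sets_unif_pair: "sets (unif \<Otimes>\<^sub>M unif) = sets (borel :: (real \<times> real) measure)"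
  unfolding borel_prod[symmetric] by (intro sets_pair_measure_cong) auto

lemma nn_integral_unif_pair:
  fixes f :: "real \<times> real \<Rightarrow> ennreal"
  assumes [measurable]: "f \<in> borel_measurable borel"
  shows "(\<integral>\<^sup>+y. (\<integral>\<^sup>+x. f (x, y) \<partial>unif) \<partial>unif) = (\<integral>\<^sup>+z. f z * indicator unit_square z \<partial>lborel)"
proof -
  have [measurable]: "f \<in> borel_measurable (borel \<Otimes>\<^sub>M borel)" by (simp add: borel_prod)
  have "(\<integral>\<^sup>+y. (\<integral>\<^sup>+x. f (x, y) \<partial>unif) \<partial>unif)
      = (\<integral>\<^sup>+y. ennreal (indicator {0..1} y) * (\<integral>\<^sup>+x. ennreal (indicator {0..1} x) * f (x, y) \<partial>lborel) \<partial>lborel)"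
    unfolding unif_eq_density by (subst nn_integral_density; (subst nn_integral_density)?) auto
  also have "\<dots> = (\<integral>\<^sup>+y. (\<integral>\<^sup>+x. f (x, y) * indicator unit_square (x, y) \<partial>lborel) \<partial>lborel)"
    by (subst nn_integral_cmult[symmetric]) (auto intro!: nn_integral_cong simp: indicator_def)
  also have "\<dots> = (\<integral>\<^sup>+z. f z * indicator unit_square z \<partial>(lborel \<Otimes>\<^sub>M lborel))"
    by (subst lborel_pair.nn_integral_snd[symmetric]) auto
  finally show ?thesis by (simp add: lborel_prod)
qed

lemma integral_unif_pair:
  fixes f :: "real \<times> real \<Rightarrow> real"
  assumes [measurable]: "f \<in> borel_measurable borel" and b: "\<And>z. \<bar>f z\<bar> \<le> C"
  shows "(\<integral>y. (\<integral>x. f (x, y) \<partial>unif) \<partial>unif) = (\<integral>z. f z * indicator unit_square z \<partial>lborel)"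
proof -
  have [measurable]: "f \<in> borel_measurable (borel \<Otimes>\<^sub>M borel)" by (simp add: borel_prod)
  have sq: "unit_square \<in> sets (lborel :: (real \<times> real) measure)"
    by (simp add: borel_closed closed_Times)
  have em: "emeasure (lborel :: (real \<times> real) measure) unit_square < \<infinity>"
    by (simp add: lborel_prod[symmetric] lborel.emeasure_pair_measure_Times)
  have int: "integrable lborel (\<lambda>z. f z * indicator unit_square z)"
  proof (rule Bochner_Integration.integrable_bound[of _ "\<lambda>z. C * indicator unit_square z"])
    show "integrable lborel (\<lambda>z::real\<times>real. C * indicator unit_square z)"
      using sq em by (intro integrable_mult_right integrable_real_indicator) auto
    show "AE z in lborel. norm (f z * indicator unit_square z) \<le> norm (C * indicator unit_square z)"
      using order.trans[OF b abs_ge_self[of C]] by (auto simp: indicator_def)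
  qed (use sq in measurable)
  have "(\<integral>y. (\<integral>x. f (x, y) \<partial>unif) \<partial>unif)
      = (\<integral>y. indicator {0..1} y * (\<integral>x. indicator {0..1} x * f (x, y) \<partial>lborel) \<partial>lborel)"
    unfolding unif_eq_density by (subst integral_density; (subst integral_density)?) auto
  also have "\<dots> = (\<integral>y. (\<integral>x. f (x, y) * indicator unit_square (x, y) \<partial>lborel) \<partial>lborel)"
    by (subst integral_mult_right_zero[symmetric]) (auto intro!: Bochner_Integration.integral_cong simp: indicator_def)
  also have "\<dots> = (\<integral>z. f z * indicator unit_square z \<partial>(lborel \<Otimes>\<^sub>M lborel))"
    using lborel_pair.integral_snd[of "\<lambda>x y. f (x, y) * indicator unit_square (x, y)"] int
    by (simp add: lborel_prod split_beta')
  finally show ?thesis by (simp add: lborel_prod)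
qed

lemma nn_integral_PiM_pair:
  assumes Mu: "prob_space Mu" and ij: "i \<in> I" "j \<in> I" "i \<noteq> j"
    and f: "f \<in> borel_measurable (Mu \<Otimes>\<^sub>M Mu)"
  shows "(\<integral>\<^sup>+\<omega>. f (\<omega> i, \<omega> j) \<partial>PiM I (\<lambda>_. Mu)) = (\<integral>\<^sup>+y. (\<integral>\<^sup>+x. f (x, y) \<partial>Mu) \<partial>Mu)"
proof -
  interpret prob_space Mu by fact
  interpret P: product_sigma_finite "\<lambda>_. Mu" by unfold_locales
  interpret PP: pair_sigma_finite Mu Mu by unfold_locales
  have m: "(\<lambda>\<omega>. f (\<omega> i, \<omega> j)) \<in> borel_measurable (PiM {i, j} (\<lambda>_. Mu))"
    by (intro measurable_compose[OF _ f] measurable_Pair measurable_component_singleton) auto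
  have "(\<integral>\<^sup>+\<omega>. f (\<omega> i, \<omega> j) \<partial>PiM I (\<lambda>_. Mu)) = (\<integral>\<^sup>+\<omega>. f (\<omega> i, \<omega> j) \<partial>PiM {i, j} (\<lambda>_. Mu))"
    using nn_integral_PiM_reindex[OF Mu _ _ m, of id I] ij by auto
  also have "\<dots> = (\<integral>\<^sup>+z. f z \<partial>(Mu \<Otimes>\<^sub>M Mu))"
    using P.product_nn_integral_pair[of "\<lambda>x y. f (x, y)" i j] ij f by (simp add: split_beta')
  also have "\<dots> = (\<integral>\<^sup>+y. (\<integral>\<^sup>+x. f (x, y) \<partial>Mu) \<partial>Mu)"
    using f by (subst PP.nn_integral_snd[symmetric]) auto
  finally show ?thesis .
qed

text \<open>A kernel is only Lebesgue measurable, whereas products of \<open>unif\<close> carry the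
  Borel sets. Testing with \<open>axis i 1\<close> gives one real function per coordinate, and each
  of these has a Borel version.\<close>

lemma Lp_kernel_borel_version:
  fixes U :: "real \<times> real \<Rightarrow> real ^ 'n"
  assumes "Lp_kernel p U"
  obtains U0 :: "real \<times> real \<Rightarrow> real ^ 'n" where "\<And>i. (\<lambda>z. U0 z $ i) \<in> borel_measurable borel"
    "AE z in lborel. z \<in> unit_square \<longrightarrow> U z = U0 z"
proof -
  have sq: "unit_square \<in> sets (lebesgue :: (real \<times> real) measure)"
    by (intro lebesgue_Times) auto
  have "\<exists>g. g \<in> borel_measurable borel \<and> (AE z in lborel. z \<in> unit_square \<longrightarrow> U z $ i = g z)" for i
  proof -
    have "(\<lambda>z. axis i 1 \<bullet> U z) \<in> borel_measurable (lebesgue_on unit_square)"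
      using assms unfolding Lp_kernel_def by blast
    then have "(\<lambda>z. U z $ i) \<in> borel_measurable (lebesgue_on unit_square)" by (simp add: inner_axis')
    then have "(\<lambda>z. if z \<in> unit_square then U z $ i else 0) \<in> borel_measurable lebesgue"
      using sq by (rule borel_measurable_if_I)
    from completion_ex_borel_measurable_real[OF this]
    obtain g where "g \<in> borel_measurable lborel" "AE z in lborel. (if z \<in> unit_square then U z $ i else 0) = g z"
      by auto
    then show ?thesis by (intro exI[of _ g]) (auto elim: eventually_mono)
  qed
  then have "\<forall>i. \<exists>g. g \<in> borel_measurable borel \<and> (AE z in lborel. z \<in> unit_square \<longrightarrow> U z $ i = g z)" by (rule allI)
  from choice[OF this] obtain g where g: "\<And>i. g i \<in> borel_measurable borel"
      "\<And>i. AE z in lborel. z \<in> unit_square \<longrightarrow> U z $ i = g i z" by blast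
  have "AE z in lborel. \<forall>i\<in>UNIV. z \<in> unit_square \<longrightarrow> U z $ i = g i z"
    using g(2) by (intro AE_finite_allI finite)
  then have "AE z in lborel. z \<in> unit_square \<longrightarrow> U z = (\<chi> i. g i z)"
    by eventually_elim (auto simp: vec_eq_iff)
  with g(1) show ?thesis by (intro that[of "\<lambda>z. \<chi> i. g i z"]) (simp_all only: vec_lambda_beta)
qed

section \<open>The Borel version of a kernel and its moments\<close>

lemma l1norm_nonneg [simp]: "l1norm w \<ge> 0"
  by (auto simp: l1norm_def intro: sum_nonneg)

locale kernel_version =
  fixes U U0 :: "real \<times> real \<Rightarrow> real ^ 'n" and p :: real
  assumes p: "p \<ge> 1" and U: "Lp_kernel p U"
    and U0_component: "(\<lambda>z. U0 z $ i) \<in> borel_measurable borel"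
    and U0_eq: "AE z in lborel. z \<in> unit_square \<longrightarrow> U z = U0 z"
begin

abbreviation N :: real where "N \<equiv> Lr_norm p U"

lemma N_nonneg: "N \<ge> 0" by (simp add: Lr_norm_def)

lemma l1_U0_measurable [measurable]: "(\<lambda>z. l1norm (U0 z)) \<in> borel_measurable borel"
  unfolding l1norm_def by (intro borel_measurable_sum borel_measurable_abs U0_component)

lemma inner_U0_measurable [measurable]: "(\<lambda>z. f \<bullet> U0 z) \<in> borel_measurable borel"
  unfolding inner_vec_def using U0_component by simp

lemma sq_lebesgue: "unit_square \<in> sets (lebesgue :: (real \<times> real) measure)"
  by (intro lebesgue_Times) auto

lemma sq_borel [measurable]: "unit_square \<in> sets (borel :: (real \<times> real) measure)"
  by (simp add: borel_closed closed_Times)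

lemma nn_moment: "(\<integral>\<^sup>+z. ennreal (l1norm (U0 z) powr p) * indicator unit_square z \<partial>lborel) = ennreal (N powr p)"
proof -
  let ?I = "LINT z|lebesgue_on unit_square. l1norm (U z) powr p"
  have "?I \<ge> 0" by (rule integral_nonneg_AE) auto
  then have "N powr p = ?I" using p by (simp add: Lr_norm_def powr_powr)
  then have "ennreal (N powr p) = (\<integral>\<^sup>+z. ennreal (l1norm (U z) powr p) \<partial>lebesgue_on unit_square)"
    using U by (subst nn_integral_eq_integral) (auto simp: Lp_kernel_def)
  also have "\<dots> = (\<integral>\<^sup>+z. ennreal (l1norm (U z) powr p) * indicator unit_square z \<partial>lebesgue)"
    using sq_lebesgue by (intro nn_integral_restrict_space) auto
  also have "\<dots> = (\<integral>\<^sup>+z. ennreal (l1norm (U z) powr p) * indicator unit_square z \<partial>lborel)"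
    by (rule nn_integral_completion)
  also have "\<dots> = (\<integral>\<^sup>+z. ennreal (l1norm (U0 z) powr p) * indicator unit_square z \<partial>lborel)"
    using U0_eq by (intro nn_integral_cong_AE) (auto simp: indicator_def elim: eventually_mono)
  finally show ?thesis by simp
qed

lemma emeasure_sq: "emeasure (lborel :: (real \<times> real) measure) unit_square = 1"
  by (simp add: lborel_prod[symmetric] lborel.emeasure_pair_measure_Times)

text \<open>Monotonicity of \<open>L\<^sup>r\<close> norms on a probability space, by integrating
  Young's inequality for \<open>(x / N) powr p\<close> and 1 with weights \<open>r / p\<close> and
  \<open>1 - r / p\<close>. For \<open>N = 0\<close> the quotient is meaningless, but then
  \<open>U0\<close> vanishes almost everywhere on the square.\<close>

lemma nn_moment_le:
  assumes r: "0 < r" "r \<le> p"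
  shows "(\<integral>\<^sup>+z. ennreal (l1norm (U0 z) powr r) * indicator unit_square z \<partial>lborel) \<le> ennreal (N powr r)"
proof (cases "N = 0")
  case True
  have "AE z in lborel. ennreal (l1norm (U0 z) powr p) * indicator unit_square z = 0"
  proof -
    have "(\<integral>\<^sup>+z. ennreal (l1norm (U0 z) powr p) * indicator unit_square z \<partial>lborel) = 0"
      using nn_moment True by simp
    then show ?thesis by (subst (asm) nn_integral_0_iff_AE) auto
  qed
  then have "AE z in lborel. ennreal (l1norm (U0 z) powr r) * indicator unit_square z = 0"
    by (rule eventually_mono) (auto simp: indicator_def split: if_splits)
  then have "(\<integral>\<^sup>+z. ennreal (l1norm (U0 z) powr r) * indicator unit_square z \<partial>lborel) = (\<integral>\<^sup>+z. 0 \<partial>(lborel :: (real \<times> real) measure))"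
    by (rule nn_integral_cong_AE)
  then show ?thesis by simp
next
  case False
  then have N: "N > 0" using N_nonneg by linarith
  have young: "x powr r \<le> N powr r * ((r / p) * (x powr p / N powr p) + (1 - r / p))" if "x \<ge> 0" for x
  proof -
    have "x powr r / N powr r = ((x / N) powr p) powr (r / p) * 1 powr (1 - r / p)"
      using r N that by (simp add: powr_powr powr_divide)
    also have "\<dots> \<le> (r / p) * (x / N) powr p + (1 - r / p) * 1"
    proof (cases "x = 0")
      case False
      then show ?thesis
        using Youngs_inequality_0[of "r / p" "1 - r / p" "(x / N) powr p" 1] r N that by simp
    qed (use r in simp)
    finally show ?thesis using N that by (simp add: powr_divide field_simps)
  qed
  let ?ind = "indicator unit_square :: _ \<Rightarrow> ennreal"
  define a b where "a = N powr r * (r / p) / N powr p" and "b = N powr r * (1 - r / p)"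
  have ab: "a \<ge> 0" "b \<ge> 0" using r by (auto simp: a_def b_def)
  have "(\<integral>\<^sup>+z. ennreal (l1norm (U0 z) powr r) * ?ind z \<partial>lborel)
      \<le> (\<integral>\<^sup>+z. ennreal a * (ennreal (l1norm (U0 z) powr p) * ?ind z) + ennreal b * ?ind z \<partial>lborel)"
  proof (rule nn_integral_mono)
    fix z
    have "l1norm (U0 z) powr r \<le> a * l1norm (U0 z) powr p + b"
      using young[of "l1norm (U0 z)"] by (simp add: a_def b_def algebra_simps)
    then have "ennreal (l1norm (U0 z) powr r) \<le> ennreal a * ennreal (l1norm (U0 z) powr p) + ennreal b"
      using ab by (simp flip: ennreal_mult ennreal_plus add: ennreal_leI)
    then show "ennreal (l1norm (U0 z) powr r) * ?ind z
        \<le> ennreal a * (ennreal (l1norm (U0 z) powr p) * ?ind z) + ennreal b * ?ind z"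
      by (auto simp: indicator_def)
  qed
  also have "\<dots> = ennreal a * ennreal (N powr p) + ennreal b"
    by (simp add: nn_integral_add nn_integral_cmult nn_moment emeasure_sq)
  also have "\<dots> = ennreal (a * N powr p + b)"
    using ab by (simp flip: ennreal_mult ennreal_plus)
  also have "a * N powr p + b = N powr r" using N by (simp add: a_def b_def algebra_simps)
  finally show ?thesis .
qed

lemma integrable_l1_U: "integrable lebesgue (\<lambda>z. indicator unit_square z * l1norm (U z))"
  and integrable_l1_U0: "integrable lborel (\<lambda>z. indicator unit_square z * l1norm (U0 z))"
proof -
  have "(\<integral>\<^sup>+z. ennreal (norm (indicator unit_square z * l1norm (U0 z))) \<partial>lborel)
      = (\<integral>\<^sup>+z. ennreal (l1norm (U0 z) powr 1) * indicator unit_square z \<partial>lborel)"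
    by (intro nn_integral_cong) (auto simp: indicator_def)
  also have "\<dots> < \<infinity>" using nn_moment_le[of 1] p by (simp add: le_less_trans)
  finally show 1: "integrable lborel (\<lambda>z. indicator unit_square z * l1norm (U0 z))"
    by (intro integrableI_bounded) auto
  have 2: "integrable lebesgue (\<lambda>z. indicator unit_square z * l1norm (U0 z))"
    using 1 by (subst integrable_completion) auto
  have ae: "AE z in lebesgue. indicator unit_square z * l1norm (U0 z) = indicator unit_square z * l1norm (U z)"
    unfolding AE_completion_iff using U0_eq by eventually_elim (auto simp: indicator_def)
  have "(\<lambda>z. axis i 1 \<bullet> U z) \<in> borel_measurable (lebesgue_on unit_square)" for i
    using U unfolding Lp_kernel_def by blast
  then have "(\<lambda>z. l1norm (U z)) \<in> borel_measurable (lebesgue_on unit_square)"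
    unfolding l1norm_def by (intro borel_measurable_sum borel_measurable_abs) (simp add: inner_axis')
  then have "(\<lambda>z. if z \<in> unit_square then l1norm (U z) else 0) \<in> borel_measurable lebesgue"
    using sq_lebesgue by (rule borel_measurable_if_I)
  also have "(\<lambda>z. if z \<in> unit_square then l1norm (U z) else 0) = (\<lambda>z. indicator unit_square z * l1norm (U z))"
    by (auto simp: indicator_def)
  finally have m: "(\<lambda>z. indicator unit_square z * l1norm (U z)) \<in> borel_measurable lebesgue" .
  show "integrable lebesgue (\<lambda>z. indicator unit_square z * l1norm (U z))"
    using integrable_cong_AE_imp[OF 2 m ae] .
qed

text \<open>The norm of the whole vector decides, so that one truncation serves all sign
  vectors.\<close>

definition trunc :: "real \<Rightarrow> real \<times> real \<Rightarrow> real ^ 'n" where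
  "trunc K z = (if l1norm (U0 z) \<le> K then U0 z else 0)"

lemma inner_trunc_measurable [measurable]: "(\<lambda>z. f \<bullet> trunc K z) \<in> borel_measurable borel"
proof -
  have "(\<lambda>z. f \<bullet> trunc K z) = (\<lambda>z. if l1norm (U0 z) \<le> K then f \<bullet> U0 z else 0)"
    by (auto simp: trunc_def)
  then show ?thesis by simp
qed

lemma inner_signs_le: "s \<in> signs \<Longrightarrow> \<bar>s \<bullet> w\<bar> \<le> l1norm w"
  using inner_le_infnorm_l1norm[of s w] infnorm_signs[of s] by simp

lemma inner_trunc_le:
  assumes "s \<in> signs"
  shows "\<bar>s \<bullet> trunc K z\<bar> \<le> l1norm (U0 z)" and "K \<ge> 0 \<Longrightarrow> \<bar>s \<bullet> trunc K z\<bar> \<le> K"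
  using inner_signs_le[OF assms, of "U0 z"] by (auto simp: trunc_def)

lemma set_integral_le_L1:
  assumes f: "infnorm f = 1" and ST: "S \<subseteq> {0..1}" "T \<subseteq> {0..1}"
  shows "\<bar>LINT z:S \<times> T|lebesgue. f \<bullet> U z\<bar> \<le> (LINT z|lebesgue. indicator unit_square z * l1norm (U z))"
proof -
  have "\<bar>LINT z:S \<times> T|lebesgue. f \<bullet> U z\<bar> \<le> (LINT z|lebesgue. \<bar>indicator (S \<times> T) z *\<^sub>R (f \<bullet> U z)\<bar>)"
    unfolding set_lebesgue_integral_def by (rule integral_abs_bound)
  also have "\<dots> \<le> (LINT z|lebesgue. indicator unit_square z * l1norm (U z))"
  proof (rule integral_mono'[OF integrable_l1_U])
    fix z show "\<bar>indicator (S \<times> T) z *\<^sub>R (f \<bullet> U z)\<bar> \<le> indicator unit_square z * l1norm (U z)"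
      using inner_le_infnorm_l1norm[of f "U z"] f ST by (auto simp: indicator_def)
  qed auto
  finally show ?thesis .
qed

text \<open>A real supremum bounds its members only for a bounded family; the
  \<open>L\<^sup>1\<close> norm of the kernel is the common bound for both suprema in
  \<open>cut_norm\<close>.\<close>

lemma cut_norm_ge:
  assumes f: "infnorm f = 1" and S: "S \<in> sets lebesgue" "S \<subseteq> {0..1}" and T: "T \<in> sets lebesgue" "T \<subseteq> {0..1}"
  shows "\<bar>LINT z:S \<times> T|lebesgue. f \<bullet> U z\<bar> \<le> cut_norm U"
proof -
  let ?LS = "{S \<in> sets lebesgue. S \<subseteq> {0..1::real}}"
  let ?C = "LINT z|lebesgue. indicator unit_square z * l1norm (U z)"
  let ?int = "\<lambda>g p. case p of (S, T) \<Rightarrow> \<bar>LINT z:S \<times> T|lebesgue. g \<bullet> U z\<bar>"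
  have le: "?int g q \<le> ?C" if "infnorm g = 1" "q \<in> ?LS \<times> ?LS" for g q
    using that set_integral_le_L1[of g] by (cases q) auto
  have ne: "({}, {}) \<in> ?LS \<times> ?LS" by auto
  have "?int f (S, T) \<le> cut_norm_real (\<lambda>z. f \<bullet> U z)"
    unfolding cut_norm_real_def using S T le[OF f]
    by (intro cSUP_upper bdd_aboveI[of _ ?C]) auto
  also have "\<dots> \<le> cut_norm U"
  proof -
    have "cut_norm_real (\<lambda>z. g \<bullet> U z) \<le> ?C" if "infnorm g = 1" for g
      unfolding cut_norm_real_def by (rule cSUP_least) (use ne le[OF that] in auto)
    then show ?thesis unfolding cut_norm_def using f
      by (intro cSUP_upper bdd_aboveI[of _ ?C]) auto
  qed
  finally show ?thesis by simp
qed

lemma cut_norm_nonneg: "cut_norm U \<ge> 0"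
proof -
  obtain s :: "real ^ 'n" where "s \<in> signs" using signs_nonempty by blast
  then have "\<bar>LINT z:{} \<times> {}|lebesgue. s \<bullet> U z\<bar> \<le> cut_norm U"
    by (intro cut_norm_ge infnorm_signs) auto
  then show ?thesis by linarith
qed

text \<open>Sampling sees \<open>U0\<close> under \<open>lborel\<close>, while the cut norm is
  defined by \<open>U\<close> under \<open>lebesgue\<close>; inside the square the two agree almost
  everywhere.\<close>

lemma lborel_integral_le_cut_norm:
  assumes s: "s \<in> signs" and S: "S \<in> sets borel" "S \<subseteq> {0..1}" and T: "T \<in> sets borel" "T \<subseteq> {0..1}"
  shows "(\<integral>z. indicator (S \<times> T) z * (s \<bullet> U0 z) \<partial>lborel) \<le> cut_norm U"
    and "integrable lborel (\<lambda>z. indicator (S \<times> T) z * (s \<bullet> U0 z))"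
proof -
  have ST: "S \<times> T \<in> sets (borel :: (real \<times> real) measure)"
    using S T unfolding borel_prod[symmetric] by auto
  have STl: "S \<times> T \<in> sets lebesgue" using ST by simp
  have [measurable]: "(\<lambda>z. indicator (S \<times> T) z * (s \<bullet> U0 z)) \<in> borel_measurable borel" using ST by measurable
  show "integrable lborel (\<lambda>z. indicator (S \<times> T) z * (s \<bullet> U0 z))"
  proof (rule Bochner_Integration.integrable_bound[OF integrable_l1_U0])
    show "AE z in lborel. norm (indicator (S \<times> T) z * (s \<bullet> U0 z)) \<le> norm (indicator unit_square z * l1norm (U0 z))"
    proof (rule AE_I2)
      fix z
      show "norm (indicator (S \<times> T) z * (s \<bullet> U0 z)) \<le> norm (indicator unit_square z * l1norm (U0 z))"
        using inner_signs_le[OF s, of "U0 z"] S(2) T(2) by (auto simp: indicator_def)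
    qed
  qed simp
  have "(\<lambda>z. s \<bullet> U z) \<in> borel_measurable (lebesgue_on unit_square)"
    using U unfolding Lp_kernel_def by blast
  then have "(\<lambda>z. if z \<in> unit_square then s \<bullet> U z else 0) \<in> borel_measurable lebesgue"
    using sq_lebesgue by (rule borel_measurable_if_I)
  then have "(\<lambda>z. indicator (S \<times> T) z * (if z \<in> unit_square then s \<bullet> U z else 0)) \<in> borel_measurable lebesgue"
    using STl by (intro borel_measurable_times borel_measurable_indicator)
  also have "(\<lambda>z. indicator (S \<times> T) z * (if z \<in> unit_square then s \<bullet> U z else 0)) = (\<lambda>z. indicator (S \<times> T) z * (s \<bullet> U z))"
  proof (rule ext)
    fix z
    have "z \<in> S \<times> T \<Longrightarrow> z \<in> unit_square" using S(2) T(2) by auto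
    then show "indicator (S \<times> T) z * (if z \<in> unit_square then s \<bullet> U z else 0) = indicator (S \<times> T) z * (s \<bullet> U z)"
      by (auto simp: indicator_def)
  qed
  finally have m: "(\<lambda>z. indicator (S \<times> T) z * (s \<bullet> U z)) \<in> borel_measurable lebesgue" .
  have "(\<integral>z. indicator (S \<times> T) z * (s \<bullet> U0 z) \<partial>lborel) = (\<integral>z. indicator (S \<times> T) z * (s \<bullet> U0 z) \<partial>lebesgue)"
    by (rule integral_completion[symmetric]) simp
  also have "\<dots> = (\<integral>z. indicator (S \<times> T) z * (s \<bullet> U z) \<partial>lebesgue)"
  proof (rule integral_cong_AE)
    show "AE z in lebesgue. indicator (S \<times> T) z * (s \<bullet> U0 z) = indicator (S \<times> T) z * (s \<bullet> U z)"
      unfolding AE_completion_iff using U0_eq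
    proof eventually_elim
      case (elim z)
      then show ?case using S(2) T(2) by (cases "z \<in> S \<times> T") auto
    qed
  qed (use m in \<open>auto intro!: measurable_completion\<close>)
  also have "\<dots> = (LINT z:S \<times> T|lebesgue. s \<bullet> U z)" by (simp add: set_lebesgue_integral_def)
  also have "\<dots> \<le> cut_norm U"
    using cut_norm_ge[of s S T] infnorm_signs[OF s] S T by auto
  finally show "(\<integral>z. indicator (S \<times> T) z * (s \<bullet> U0 z) \<partial>lborel) \<le> cut_norm U" .
qed

section \<open>Cut norm and moments after truncation\<close>

definition tail_mass :: "real \<Rightarrow> real" where
  "tail_mass K = (\<integral>z. indicator unit_square z * (if l1norm (U0 z) \<le> K then 0 else l1norm (U0 z)) \<partial>lborel)"

lemma integrable_tail: "integrable lborel (\<lambda>z. indicator unit_square z * (if l1norm (U0 z) \<le> K then 0 else l1norm (U0 z)))"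
  by (rule Bochner_Integration.integrable_bound[OF integrable_l1_U0]) (auto simp: indicator_def)

text \<open>Above the level, \<open>u = u powr (1 - p) * u powr p\<close>, and the first factor is
  at most \<open>K powr (1 - p)\<close>.\<close>

lemma tail_mass_le:
  assumes K: "K > 0"
  shows "tail_mass K \<le> N powr p * K powr (1 - p)"
proof -
  have "ennreal (tail_mass K) = (\<integral>\<^sup>+z. ennreal (indicator unit_square z * (if l1norm (U0 z) \<le> K then 0 else l1norm (U0 z))) \<partial>lborel)"
    unfolding tail_mass_def by (rule nn_integral_eq_integral[OF integrable_tail, symmetric]) (auto simp: indicator_def)
  also have "\<dots> \<le> (\<integral>\<^sup>+z. ennreal (K powr (1 - p)) * (ennreal (l1norm (U0 z) powr p) * indicator unit_square z) \<partial>lborel)"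
  proof (rule nn_integral_mono)
    fix z
    have "u \<le> K powr (1 - p) * u powr p" if "u > K" for u
    proof -
      have "u powr (1 - p) \<le> K powr (1 - p)" using that K p by (intro powr_mono2') auto
      then have "u powr (1 - p) * u powr p \<le> K powr (1 - p) * u powr p" by (intro mult_right_mono) auto
      then show ?thesis using that K by (simp flip: powr_add)
    qed
    then show "ennreal (indicator unit_square z * (if l1norm (U0 z) \<le> K then 0 else l1norm (U0 z)))
        \<le> ennreal (K powr (1 - p)) * (ennreal (l1norm (U0 z) powr p) * indicator unit_square z)"
      by (auto simp: indicator_def not_le simp flip: ennreal_mult intro!: ennreal_leI)
  qed
  also have "\<dots> = ennreal (K powr (1 - p)) * ennreal (N powr p)"
    by (simp add: nn_integral_cmult nn_moment)
  finally have "ennreal (tail_mass K) \<le> ennreal (N powr p * K powr (1 - p))"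
    by (simp add: ennreal_mult mult.commute)
  then show ?thesis by (subst (asm) ennreal_le_iff) auto
qed

text \<open>The positive part selects the column set \<open>T\<close>, so the left-hand side is a
  single integral over a product set. Replacing the truncated kernel by \<open>U0\<close> there
  costs at most the mass above the level.\<close>

lemma trunc_cut_bound:
  assumes s: "s \<in> signs" and K: "K \<ge> 0" and S [measurable]: "S \<in> sets borel"
  shows "(\<integral>y. max 0 (\<integral>x. indicator S x * (s \<bullet> trunc K (x, y)) \<partial>unif) \<partial>unif) \<le> cut_norm U + tail_mass K"
proof -
  interpret u: prob_space unif by (rule prob_space_unif)
  let ?f = "\<lambda>z. s \<bullet> trunc K z"
  let ?h = "\<lambda>y. \<integral>x. indicator S x * ?f (x, y) \<partial>unif"
  have [measurable]: "?f \<in> borel_measurable (borel \<Otimes>\<^sub>M borel)" by (simp add: borel_prod)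
  have [measurable]: "?h \<in> borel_measurable borel"
  proof -
    have "(\<lambda>(y, x). indicator S x * ?f (x, y)) \<in> borel_measurable (borel \<Otimes>\<^sub>M unif)" by measurable
    from u.borel_measurable_lebesgue_integral[OF this] show ?thesis .
  qed
  define T where "T = {y. 0 < ?h y}"
  have T [measurable]: "T \<in> sets borel" unfolding T_def by measurable
  let ?S = "S \<inter> {0..1}" and ?T = "T \<inter> {0..1}"
  let ?g = "\<lambda>z. indicator T (snd z) * indicator S (fst z) * ?f z"
  have gb: "\<bar>?g z\<bar> \<le> K" for z
    using inner_trunc_le(2)[OF s K, of z] K by (auto simp: indicator_def)
  have gm: "?g \<in> borel_measurable borel"
    unfolding borel_prod[symmetric] by measurable
  have "(\<integral>y. max 0 (?h y) \<partial>unif) = (\<integral>y. (\<integral>x. ?g (x, y) \<partial>unif) \<partial>unif)"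
  proof (intro Bochner_Integration.integral_cong refl)
    fix y
    have "(\<integral>x. ?g (x, y) \<partial>unif) = indicator T y * ?h y"
      by (simp add: mult.assoc)
    then show "max 0 (?h y) = (\<integral>x. ?g (x, y) \<partial>unif)"
      by (auto simp: T_def indicator_def)
  qed
  also have "\<dots> = (\<integral>z. ?g z * indicator unit_square z \<partial>lborel)"
    by (rule integral_unif_pair[OF gm gb])
  also have "\<dots> \<le> (\<integral>z. indicator (?S \<times> ?T) z * (s \<bullet> U0 z)
      + indicator unit_square z * (if l1norm (U0 z) \<le> K then 0 else l1norm (U0 z)) \<partial>lborel)"
  proof (rule integral_mono)
    have ST: "?S \<in> sets borel" "?T \<in> sets borel" by auto
    show "integrable lborel (\<lambda>z. indicator (?S \<times> ?T) z * (s \<bullet> U0 z)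
        + indicator unit_square z * (if l1norm (U0 z) \<le> K then 0 else l1norm (U0 z)))"
      by (intro Bochner_Integration.integrable_add lborel_integral_le_cut_norm(2)[OF s] integrable_tail ST) auto
    show "integrable lborel (\<lambda>z. ?g z * indicator unit_square z)"
    proof (rule Bochner_Integration.integrable_bound[OF integrable_l1_U0])
      show "(\<lambda>z. ?g z * indicator unit_square z) \<in> borel_measurable lborel" using gm by measurable
      show "AE z in lborel. norm (?g z * indicator unit_square z) \<le> norm (indicator unit_square z * l1norm (U0 z))"
        using inner_trunc_le(1)[OF s, of K] by (intro AE_I2) (auto simp: indicator_def)
    qed
    fix z
    show "?g z * indicator unit_square z \<le> indicator (?S \<times> ?T) z * (s \<bullet> U0 z)
        + indicator unit_square z * (if l1norm (U0 z) \<le> K then 0 else l1norm (U0 z))"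
      using inner_signs_le[OF s, of "U0 z"] by (cases z) (auto simp: indicator_def trunc_def)
  qed
  also have "\<dots> = (\<integral>z. indicator (?S \<times> ?T) z * (s \<bullet> U0 z) \<partial>lborel) + tail_mass K"
    unfolding tail_mass_def
    by (intro Bochner_Integration.integral_add lborel_integral_le_cut_norm(2)[OF s] integrable_tail) auto
  also have "\<dots> \<le> cut_norm U + tail_mass K"
    by (intro add_right_mono lborel_integral_le_cut_norm(1)[OF s]) auto
  finally show ?thesis .
qed

lemma bounded_kernel_trunc:
  assumes s: "s \<in> signs" and K: "K \<ge> 0"
  shows "bounded_kernel unif (\<lambda>z. s \<bullet> trunc K z) K (cut_norm U + tail_mass K)"
proof -
  interpret u: prob_space unif by (rule prob_space_unif)
  show ?thesis
  proof
    show "(\<lambda>z. s \<bullet> trunc K z) \<in> borel_measurable (unif \<Otimes>\<^sub>M unif)"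
      unfolding measurable_cong_sets[OF sets_unif_pair refl] by simp
  qed (use trunc_cut_bound[OF s K] inner_trunc_le(2)[OF s K] in auto)
qed

lemma moment_trunc_le:
  assumes s: "s \<in> signs" and K: "K \<ge> 0" and r: "0 < r" "r \<le> p"
  shows "bounded_kernel.moment unif (\<lambda>z. s \<bullet> trunc K z) r \<le> ennreal (N powr r)"
proof -
  interpret bounded_kernel unif "\<lambda>z. s \<bullet> trunc K z" K "cut_norm U + tail_mass K"
    by (rule bounded_kernel_trunc[OF s K])
  have "moment r = (\<integral>\<^sup>+z. ennreal (\<bar>s \<bullet> trunc K z\<bar> powr r) * indicator unit_square z \<partial>lborel)"
    unfolding moment_def by (rule nn_integral_unif_pair) simp
  also have "\<dots> \<le> (\<integral>\<^sup>+z. ennreal (l1norm (U0 z) powr r) * indicator unit_square z \<partial>lborel)"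
    using r inner_trunc_le(1)[OF s] by (intro nn_integral_mono mult_right_mono ennreal_leI powr_mono2) auto
  also have "\<dots> \<le> ennreal (N powr r)" by (rule nn_moment_le[OF r])
  finally show ?thesis .
qed

end
section \<open>Tail bounds\<close>

text \<open>The moment \<open>r = min p (\<phi> * p * ln k)\<close> keeps \<open>sqrt r\<close> below \<open>sqrt (\<phi> * p * ln k)\<close>, while
  the loss \<open>k powr (\<phi> * p / r)\<close> in Markov's inequality stays below \<open>exp 1 * k powr \<phi>\<close>.\<close>

lemma (in kernel_version) sampled_tail:
  assumes k: "k > 0" and p2: "p \<ge> 2" and L: "\<phi> * p * ln (real k) \<ge> 2" and K: "K \<ge> 0" and s: "s \<in> signs"
    and t: "t = 16 * exp 1 * sqrt (exp 1) * sqrt (\<phi> * p * ln (real k)) * real k powr (\<phi> - 1 / 2) * N"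
  shows "emeasure (PiM {1..k} (\<lambda>_. unif)) {x \<in> space (PiM {1..k} (\<lambda>_. unif)).
      (real k)\<^sup>2 * (cut_norm U + tail_mass K + t) < diag_free_cut (\<lambda>z. s \<bullet> trunc K z) {1..k} x}
    \<le> ennreal (2 * real k powr (- \<phi> * p))"
proof -
  note One_nat_def [simp del]
  interpret bounded_kernel unif "\<lambda>z. s \<bullet> trunc K z" K "cut_norm U + tail_mass K"
    by (rule bounded_kernel_trunc[OF s K])
  let ?P = "PiM {1..k} (\<lambda>_::nat. unif)" and ?Z = "diag_free_cut (\<lambda>z. s \<bullet> trunc K z) {1..k}"
  let ?B = "cut_norm U + tail_mass K"
  define l where "l = \<phi> * p * ln (real k)"
  define r where "r = min p l"
  have r: "r \<ge> 2" "r \<le> p" "r \<le> l" using p2 L by (auto simp: r_def l_def)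
  let ?u = "\<lambda>x. max 0 (?Z x - (real k)\<^sup>2 * ?B) powr r"
  let ?C = "2 * (256 * exp 1 * r * real k ^ 3) powr (r / 2)"
  have [measurable]: "?Z \<in> borel_measurable ?P" by (rule measurable_diag_free_cut[OF W_meas]) simp
  have mom: "(\<integral>\<^sup>+x. ennreal (?u x) \<partial>?P) \<le> ennreal (?C * N powr r)"
  proof -
    have "(\<integral>\<^sup>+x. ennreal (?u x) \<partial>?P) \<le> ennreal ?C * moment r"
      using diag_free_cut_moment[of "{1..k}" r] r by simp
    also have "\<dots> \<le> ennreal ?C * ennreal (N powr r)"
      using r by (intro mult_left_mono moment_trunc_le[OF s K]) auto
    finally show ?thesis by (simp add: ennreal_mult)
  qed
  show ?thesis
  \<comment> \<open>For \<open>N = 0\<close> also \<open>t = 0\<close>, and Markov's inequality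
    would divide by 0; the vanishing moment then excludes the event almost surely.\<close>
  proof (cases "N = 0")
    case True
    then have "(\<integral>\<^sup>+x. ennreal (?u x) \<partial>?P) = 0" using mom by simp
    then have "AE x in ?P. ennreal (?u x) = 0" by (subst (asm) nn_integral_0_iff_AE) auto
    then have "AE x in ?P. \<not> (real k)\<^sup>2 * (?B + t) < ?Z x"
      by (rule eventually_mono) (use True t in \<open>auto simp: max_def split: if_splits\<close>)
    then have "emeasure ?P {x \<in> space ?P. (real k)\<^sup>2 * (?B + t) < ?Z x} = 0"
      by (rule emeasure_eq_0_AE)
    then show ?thesis by simp
  next
    case False
    then have N: "N > 0" using N_nonneg by linarith
    have l: "l \<ge> 2" using L by (simp add: l_def)
    have tp: "t > 0" using N k l unfolding t l_def[symmetric] by simp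
    define d where "d = (real k)\<^sup>2 * t"
    have d: "d > 0" using tp k by (simp add: d_def)
    have "emeasure ?P {x \<in> space ?P. (real k)\<^sup>2 * (?B + t) < ?Z x}
        \<le> emeasure ?P {x \<in> space ?P. 1 \<le> ennreal (1 / d powr r) * ennreal (?u x)}"
    proof (intro emeasure_mono subsetI)
      fix x assume x: "x \<in> {x \<in> space ?P. (real k)\<^sup>2 * (?B + t) < ?Z x}"
      then have "d < ?Z x - (real k)\<^sup>2 * ?B"
        unfolding d_def distrib_left[of "(real k)\<^sup>2" ?B t] by simp
      then have "d \<le> max 0 (?Z x - (real k)\<^sup>2 * ?B)" by linarith
      then have "d powr r \<le> ?u x" using d r by (intro powr_mono2) auto
      then have "1 \<le> 1 / d powr r * ?u x" using d by simp
      then have "ennreal 1 \<le> ennreal (1 / d powr r) * ennreal (?u x)"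
        by (simp only: ennreal_mult[symmetric] divide_nonneg_nonneg zero_le_one powr_ge_zero ennreal_leI)
      then show "x \<in> {x \<in> space ?P. 1 \<le> ennreal (1 / d powr r) * ennreal (?u x)}" using x by simp
    qed measurable
    also have "\<dots> \<le> ennreal (1 / d powr r) * (\<integral>\<^sup>+x. ennreal (?u x) * indicator (space ?P) x \<partial>?P)"
      by (rule nn_integral_Markov_inequality) auto
    also have "\<dots> = ennreal (1 / d powr r) * (\<integral>\<^sup>+x. ennreal (?u x) \<partial>?P)"
      by (intro arg_cong2[where f = times] refl nn_integral_cong) simp
    also have "\<dots> \<le> ennreal (1 / d powr r) * ennreal (?C * N powr r)"
      by (intro mult_left_mono mom) auto
    also have "\<dots> = ennreal (1 / d powr r * (?C * N powr r))" by (subst ennreal_mult[symmetric]) auto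
    also have "\<dots> \<le> ennreal (2 * real k powr (- \<phi> * p))"
    proof (rule ennreal_leI)
      \<comment> \<open>\<open>a\<close> is the root of the moment bound: \<open>?C\<close> becomes
        \<open>2 * a powr r\<close>.\<close>
      define a where "a = 16 * sqrt (exp 1) * sqrt r * real k powr (3 / 2)"
      have a: "a \<ge> 0" using r by (simp add: a_def)
      have "a\<^sup>2 = 256 * exp 1 * r * real k ^ 3"
      proof -
        have "(real k powr (3 / 2))\<^sup>2 = real k ^ 3"
          using k by (simp add: power2_eq_square flip: powr_add)
        then show ?thesis using r by (simp add: a_def power_mult_distrib)
      qed
      then have "(256 * exp 1 * r * real k ^ 3) powr (r / 2) = (a powr 2) powr (r / 2)"
        using a by simp
      also have "\<dots> = a powr r" by (simp add: powr_powr)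
      finally have C: "?C = 2 * a powr r" by simp
      have d_eq: "d = a * N * (exp 1 * real k powr \<phi> * (sqrt l / sqrt r))"
      proof -
        have "(real k)\<^sup>2 * real k powr (\<phi> - 1 / 2) = real k powr (3 / 2) * real k powr \<phi>"
        proof -
          have "(real k)\<^sup>2 = real k powr 2" using k by simp
          then show ?thesis by (simp only: powr_add[symmetric]) simp
        qed
        then have "d = (real k powr (3 / 2) * real k powr \<phi>) * (16 * exp 1 * sqrt (exp 1) * sqrt l * N)"
          unfolding d_def t l_def[symmetric] by (simp only: mult_ac)
        then show ?thesis using r by (simp add: a_def)
      qed
      \<comment> \<open>The threshold \<open>d\<close> is at least \<open>e\<close> times
        \<open>a * N\<close>, so Markov's inequality leaves \<open>2 * e powr (- r)\<close>.\<close>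
      define e where "e = exp 1 * real k powr \<phi>"
      have e: "e > 0" using k by (simp add: e_def)
      have ap: "a > 0" using r k by (simp add: a_def)
      have "a * N * e \<le> d"
      proof -
        have "1 \<le> sqrt l / sqrt r" using r by simp
        then have "a * N * e * 1 \<le> a * N * e * (sqrt l / sqrt r)"
          using ap N e by (intro mult_left_mono) auto
        then show ?thesis unfolding d_eq e_def by (simp add: mult_ac)
      qed
      then have "(a * N * e) powr r \<le> d powr r" using ap N e r by (intro powr_mono2) auto
      then have "(a powr r * N powr r) * e powr r \<le> d powr r" by (simp add: powr_mult mult_ac)
      then have "a powr r * N powr r \<le> d powr r / e powr r" using e by (simp add: pos_le_divide_eq)
      then have "1 / d powr r * (?C * N powr r) \<le> 1 / d powr r * (2 * (d powr r / e powr r))"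
        unfolding C using d by (intro mult_left_mono) auto
      also have "\<dots> = 2 * e powr (- r)" using d by (simp add: powr_minus_divide)
      also have "e powr (- r) \<le> real k powr (- \<phi> * p)"
      proof -
        have "ln e = 1 + \<phi> * ln (real k)" using k by (simp add: e_def ln_mult ln_powr)
        \<comment> \<open>The 1 comes from the factor \<open>exp 1\<close> in \<open>t\<close> and
          suffices for \<open>r = l\<close>; for \<open>r = p\<close> the other summand gives
          \<open>p * \<phi> * ln (real k) = l\<close>.\<close>
        moreover have "l \<le> r * (1 + \<phi> * ln (real k))"
        proof (cases "p \<le> l")
          case True
          then have "r * (1 + \<phi> * ln (real k)) = p + l" by (simp add: r_def l_def algebra_simps)
          then show ?thesis using p by simp
        next
          case False
          then have "r * (1 + \<phi> * ln (real k)) = l + l * (l / p)" using p by (simp add: r_def l_def algebra_simps)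
          moreover have "0 \<le> l * (l / p)" using l p by simp
          ultimately show ?thesis by linarith
        qed
        ultimately have "- r * ln e \<le> - \<phi> * p * ln (real k)" by (simp add: l_def)
        then show ?thesis using e k by (simp add: powr_def)
      qed
      finally show "1 / d powr r * (?C * N powr r) \<le> 2 * real k powr (- \<phi> * p)" by simp
    qed
    finally show ?thesis .
  qed
qed

lemma (in kernel_version) large_entry_prob:
  assumes "K > 0" "i \<in> I" "j \<in> I" "i \<noteq> j"
  shows "emeasure (PiM I (\<lambda>_. unif)) {x \<in> space (PiM I (\<lambda>_. unif)). K < l1norm (U0 (x i, x j))}
    \<le> ennreal (N powr p * K powr (- p))"
proof -
  let ?P = "PiM I (\<lambda>_. unif)" and ?u = "\<lambda>z. ennreal (l1norm (U0 z) powr p)"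
  have U0m: "(\<lambda>z. l1norm (U0 z)) \<in> borel_measurable (unif \<Otimes>\<^sub>M unif)"
    unfolding measurable_cong_sets[OF sets_unif_pair refl] by simp
  have [measurable]: "(\<lambda>x. l1norm (U0 (x i, x j))) \<in> borel_measurable ?P"
    using measurable_kernel_component[OF U0m] assms by auto
  have "emeasure ?P {x \<in> space ?P. K < l1norm (U0 (x i, x j))}
      \<le> emeasure ?P {x \<in> space ?P. 1 \<le> ennreal (K powr (- p)) * ?u (x i, x j)}"
  proof (intro emeasure_mono subsetI)
    fix x assume x: "x \<in> {x \<in> space ?P. K < l1norm (U0 (x i, x j))}"
    then have "K powr p \<le> l1norm (U0 (x i, x j)) powr p" using assms p by (intro powr_mono2) auto
    then have "1 \<le> K powr (- p) * l1norm (U0 (x i, x j)) powr p"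
      using assms(1) by (simp add: powr_minus_divide)
    then have "ennreal 1 \<le> ennreal (K powr (- p)) * ?u (x i, x j)"
      by (simp only: ennreal_mult[symmetric] powr_ge_zero ennreal_leI)
    then show "x \<in> {x \<in> space ?P. 1 \<le> ennreal (K powr (- p)) * ?u (x i, x j)}" using x by simp
  qed measurable
  also have "\<dots> \<le> ennreal (K powr (- p)) * (\<integral>\<^sup>+x. ?u (x i, x j) * indicator (space ?P) x \<partial>?P)"
    by (rule nn_integral_Markov_inequality) auto
  also have "\<dots> = ennreal (K powr (- p)) * (\<integral>\<^sup>+x. ?u (x i, x j) \<partial>?P)"
    by (intro arg_cong2[where f = times] refl nn_integral_cong) simp
  also have "(\<integral>\<^sup>+x. ?u (x i, x j) \<partial>?P) = (\<integral>\<^sup>+y. (\<integral>\<^sup>+x. ?u (x, y) \<partial>unif) \<partial>unif)"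
  proof (rule nn_integral_PiM_pair[OF prob_space_unif assms(2-4)])
    show "?u \<in> borel_measurable (unif \<Otimes>\<^sub>M unif)"
      unfolding measurable_cong_sets[OF sets_unif_pair refl] by simp
  qed
  also have "\<dots> = ennreal (N powr p)" unfolding nn_moment[symmetric] by (rule nn_integral_unif_pair) simp
  finally show ?thesis by (simp add: ennreal_mult mult.commute)
qed

text \<open>Outside the bad events no sampled entry is truncated, so the matrices sampled from
  \<open>U0\<close> and from its truncation coincide. At most k^2 entries, each bad with probability
  at most \<open>k powr (- \<phi> * p - 2)\<close>, add one multiple of
  \<open>k powr (- \<phi> * p)\<close> to the \<open>2 ^ CARD('n) * 2\<close> multiples from the
  signs.\<close>

lemma (in kernel_version) sampled_cut_bound:
  assumes k: "k \<ge> 2" and p3: "p > 3" and phi: "\<phi> > 0" and L: "\<phi> * p * ln (real k) \<ge> 2"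
    and t: "t = 16 * exp 1 * sqrt (exp 1) * sqrt (\<phi> * p * ln (real k)) * real k powr (\<phi> - 1 / 2) * N"
  shows "emeasure (PiM {1..k} (\<lambda>_. unif)) {x \<in> space (PiM {1..k} (\<lambda>_. unif)).
      cut_norm U + N * real k powr (- 1 / 4) + t
        < Max ((\<lambda>s. diag_free_cut (\<lambda>z. s \<bullet> U0 z) {1..k} x) ` signs) / (real k)\<^sup>2}
    \<le> ennreal (2 ^ (CARD('n) + 2) * real k powr (- \<phi> * p))"
proof -
  note One_nat_def [simp del]
  let ?P = "PiM {1..k} (\<lambda>_::nat. unif)" and ?I = "{1..k}"
  \<comment> \<open>Truncation at level \<open>K\<close> alters a sampled entry with probability at most \<open>k powr (- \<phi> * p - 2)\<close>,
    but the cut norm of \<open>U\<close> by at most \<open>N * k powr (- 1 / 4)\<close>.\<close>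
  define K where "K = (if N = 0 then 1 else N * real k powr (\<phi> + 2 / p))"
  have k0: "real k > 0" "real k \<ge> 1" using k by auto
  have K: "K > 0" using N_nonneg k0 by (auto simp: K_def)
  have Kp: "N powr p * K powr (- p) \<le> real k powr (- \<phi> * p - 2)"
  proof (cases "N = 0")
    case False
    then have "N powr p * K powr (- p) = (N powr p * N powr (- p)) * (real k powr (\<phi> + 2 / p)) powr (- p)"
      by (simp add: K_def powr_mult)
    also have "\<dots> = (real k powr (\<phi> + 2 / p)) powr (- p)"
      using False N_nonneg by (simp flip: powr_add)
    also have "\<dots> = real k powr (- \<phi> * p - 2)" using p3 by (simp add: powr_powr algebra_simps)
    finally show ?thesis by simp
  qed simp
  have tail: "tail_mass K \<le> N * real k powr (- 1 / 4)"
  proof (rule order.trans[OF tail_mass_le[OF K]], cases "N = 0")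
    case False
    then have "N powr p * K powr (1 - p) = (N powr p * N powr (1 - p)) * (real k powr (\<phi> + 2 / p)) powr (1 - p)"
      by (simp add: K_def powr_mult)
    also have "\<dots> = N * real k powr ((\<phi> + 2 / p) * (1 - p))"
      using False N_nonneg by (simp flip: powr_add add: powr_powr)
    also have "\<dots> \<le> N * real k powr (- 1 / 4)"
    proof (intro mult_left_mono powr_mono N_nonneg)
      \<comment> \<open>The exponent is even at most -1; a term of order
        \<open>k powr (- 1 / 4)\<close> is within the claimed bound.\<close>
      have "(\<phi> + 2 / p) * (1 - p) = \<phi> * (1 - p) + 2 / p - 2" using p3 by (simp add: field_simps)
      moreover have "\<phi> * (1 - p) \<le> 0" using phi p3 by (intro mult_nonneg_nonpos) auto
      moreover have "2 / p \<le> 1" using p3 by simp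
      ultimately show "(\<phi> + 2 / p) * (1 - p) \<le> - 1 / 4" by linarith
    qed (use k0 in auto)
    finally show "N powr p * K powr (1 - p) \<le> N * real k powr (- 1 / 4)" .
  qed simp
  define bad_entry where "bad_entry q = {x \<in> space ?P. K < l1norm (U0 (x (fst q), x (snd q)))}" for q :: "nat \<times> nat"
  define bad_sign where "bad_sign s = {x \<in> space ?P. (real k)\<^sup>2 * (cut_norm U + tail_mass K + t)
      < diag_free_cut (\<lambda>z. s \<bullet> trunc K z) ?I x}" for s :: "real ^ 'n"
  \<comment> \<open>Diagonal pairs are left out: the step function is 0 there, and two equal points
    are not a uniform pair.\<close>
  define D where "D = {q \<in> ?I \<times> ?I. fst q \<noteq> snd q}"
  have D: "finite D" "card D \<le> k\<^sup>2"
  proof -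
    have "D \<subseteq> ?I \<times> ?I" "finite (?I \<times> ?I)" by (auto simp: D_def)
    then show "finite D" "card D \<le> k\<^sup>2"
      using card_mono[of "?I \<times> ?I" D] by (auto intro: finite_subset simp: power2_eq_square)
  qed
  have U0m: "(\<lambda>z. l1norm (U0 z)) \<in> borel_measurable (unif \<Otimes>\<^sub>M unif)"
    unfolding measurable_cong_sets[OF sets_unif_pair refl] by simp
  have entry_sets: "bad_entry q \<in> sets ?P" if "q \<in> D" for q
  proof -
    have [measurable]: "(\<lambda>x. l1norm (U0 (x (fst q), x (snd q)))) \<in> borel_measurable ?P"
      using measurable_kernel_component[OF U0m, of "fst q" ?I "snd q"] that by (auto simp: D_def)
    show ?thesis unfolding bad_entry_def by measurable
  qed
  have sign_sets: "bad_sign s \<in> sets ?P" for s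
  proof -
    have "(\<lambda>z. s \<bullet> trunc K z) \<in> borel_measurable (unif \<Otimes>\<^sub>M unif)"
      unfolding measurable_cong_sets[OF sets_unif_pair refl] by simp
    then have [measurable]: "diag_free_cut (\<lambda>z. s \<bullet> trunc K z) ?I \<in> borel_measurable ?P"
      by (rule measurable_diag_free_cut) simp
    show ?thesis unfolding bad_sign_def by measurable
  qed
  have sub: "{x \<in> space ?P. cut_norm U + N * real k powr (- 1 / 4) + t
        < Max ((\<lambda>s. diag_free_cut (\<lambda>z. s \<bullet> U0 z) ?I x) ` signs) / (real k)\<^sup>2}
      \<subseteq> (\<Union>s\<in>signs. bad_sign s) \<union> (\<Union>q\<in>D. bad_entry q)"
  proof (intro subsetI, rule ccontr)
    fix x assume x: "x \<in> {x \<in> space ?P. cut_norm U + N * real k powr (- 1 / 4) + t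
        < Max ((\<lambda>s. diag_free_cut (\<lambda>z. s \<bullet> U0 z) ?I x) ` signs) / (real k)\<^sup>2}"
      and good: "x \<notin> (\<Union>s\<in>signs. bad_sign s) \<union> (\<Union>q\<in>D. bad_entry q)"
    have sp: "x \<in> space ?P" using x by simp
    have entry: "trunc K (x i, x j) = U0 (x i, x j)" if "i \<in> ?I" "j \<in> ?I" "i \<noteq> j" for i j
    proof -
      have "(i, j) \<in> D" using that by (simp add: D_def)
      then have "x \<notin> bad_entry (i, j)" using good by blast
      then show ?thesis using sp by (simp add: bad_entry_def trunc_def)
    qed
    have cut_eq: "diag_free_cut (\<lambda>z. s \<bullet> U0 z) ?I x = diag_free_cut (\<lambda>z. s \<bullet> trunc K z) ?I x" for s
      unfolding diag_free_cut_def
    proof (intro arg_cong[where f = Max] image_cong refl)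
      fix q assume "q \<in> Pow ?I \<times> Pow ?I"
      then obtain S T where q: "q = (S, T)" "S \<subseteq> ?I" "T \<subseteq> ?I" by auto
      have "(\<Sum>i\<in>S. \<Sum>j\<in>T. if i = j then 0 else s \<bullet> U0 (x i, x j)) = (\<Sum>i\<in>S. \<Sum>j\<in>T. if i = j then 0 else s \<bullet> trunc K (x i, x j))"
      proof (intro sum.cong refl)
        fix i j assume "i \<in> S" "j \<in> T"
        then have "i \<in> ?I" "j \<in> ?I" using q by blast+
        then show "(if i = j then 0 else s \<bullet> U0 (x i, x j)) = (if i = j then 0 else s \<bullet> trunc K (x i, x j))"
          using entry[of i j] by (cases "i = j") simp_all
      qed
      then show "(case q of (S, T) \<Rightarrow> \<Sum>i\<in>S. \<Sum>j\<in>T. if i = j then 0 else s \<bullet> U0 (x i, x j))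
          = (case q of (S, T) \<Rightarrow> \<Sum>i\<in>S. \<Sum>j\<in>T. if i = j then 0 else s \<bullet> trunc K (x i, x j))"
        by (simp add: q)
    qed
    have "Max ((\<lambda>s. diag_free_cut (\<lambda>z. s \<bullet> U0 z) ?I x) ` signs) \<le> (real k)\<^sup>2 * (cut_norm U + tail_mass K + t)"
    proof (rule Max.boundedI)
      fix a assume "a \<in> (\<lambda>s. diag_free_cut (\<lambda>z. s \<bullet> U0 z) ?I x) ` signs"
      then obtain s where s: "s \<in> signs" "a = diag_free_cut (\<lambda>z. s \<bullet> U0 z) ?I x" by blast
      have "x \<notin> bad_sign s" using good s by blast
      then show "a \<le> (real k)\<^sup>2 * (cut_norm U + tail_mass K + t)"
        using sp s(2) cut_eq[of s] by (simp add: bad_sign_def)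
    qed auto
    then have "Max ((\<lambda>s. diag_free_cut (\<lambda>z. s \<bullet> U0 z) ?I x) ` signs) / (real k)\<^sup>2 \<le> cut_norm U + tail_mass K + t"
      using k0 by (simp add: pos_divide_le_eq mult.commute)
    then show False using x tail by simp
  qed
  have "emeasure ?P {x \<in> space ?P. cut_norm U + N * real k powr (- 1 / 4) + t
        < Max ((\<lambda>s. diag_free_cut (\<lambda>z. s \<bullet> U0 z) ?I x) ` signs) / (real k)\<^sup>2}
      \<le> emeasure ?P ((\<Union>s\<in>signs. bad_sign s) \<union> (\<Union>q\<in>D. bad_entry q))"
    using D entry_sets sign_sets by (intro emeasure_mono sub sets.Un sets.finite_UN) auto
  also have "\<dots> \<le> emeasure ?P (\<Union>s\<in>signs. bad_sign s) + emeasure ?P (\<Union>q\<in>D. bad_entry q)"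
    using D entry_sets sign_sets by (intro emeasure_subadditive sets.finite_UN) auto
  also have "\<dots> \<le> (\<Sum>s\<in>signs. emeasure ?P (bad_sign s)) + (\<Sum>q\<in>D. emeasure ?P (bad_entry q))"
    using D entry_sets sign_sets by (intro add_mono emeasure_subadditive_finite) auto
  also have "\<dots> \<le> (\<Sum>s\<in>(signs :: (real ^ 'n) set). ennreal (2 * real k powr (- \<phi> * p))) + (\<Sum>q\<in>D. ennreal (real k powr (- \<phi> * p - 2)))"
  proof (intro add_mono sum_mono)
    fix s :: "real ^ 'n" assume "s \<in> signs"
    then show "emeasure ?P (bad_sign s) \<le> ennreal (2 * real k powr (- \<phi> * p))"
      unfolding bad_sign_def using k p3 K by (intro sampled_tail[OF _ _ L _ _ t]) auto
  next
    fix q assume "q \<in> D"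
    then have "emeasure ?P (bad_entry q) \<le> ennreal (N powr p * K powr (- p))"
      unfolding bad_entry_def by (intro large_entry_prob K) (auto simp: D_def)
    also have "\<dots> \<le> ennreal (real k powr (- \<phi> * p - 2))" by (intro ennreal_leI Kp)
    finally show "emeasure ?P (bad_entry q) \<le> ennreal (real k powr (- \<phi> * p - 2))" .
  qed
  also have "\<dots> = ennreal (2 ^ CARD('n) * (2 * real k powr (- \<phi> * p)) + real (card D) * real k powr (- \<phi> * p - 2))"
  proof -
    have "(\<Sum>s\<in>(signs :: (real ^ 'n) set). ennreal (2 * real k powr (- \<phi> * p))) + (\<Sum>q\<in>D. ennreal (real k powr (- \<phi> * p - 2)))
        = ennreal ((\<Sum>s\<in>(signs :: (real ^ 'n) set). 2 * real k powr (- \<phi> * p)) + (\<Sum>q\<in>D. real k powr (- \<phi> * p - 2)))"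
      by (subst ennreal_plus) (auto simp: sum_ennreal intro!: sum_nonneg simp del: sum_constant)
    then show ?thesis by (simp add: card_signs)
  qed
  also have "\<dots> \<le> ennreal (2 ^ (CARD('n) + 2) * real k powr (- \<phi> * p))"
  proof (rule ennreal_leI)
    have "real (card D) * real k powr (- \<phi> * p - 2) \<le> (real k)\<^sup>2 * real k powr (- \<phi> * p - 2)"
      using D by (intro mult_right_mono) (auto simp flip: of_nat_power)
    also have "\<dots> = real k powr (- \<phi> * p)"
    proof -
      have "(real k)\<^sup>2 = real k powr 2" using k0 by simp
      then show ?thesis by (simp only: powr_add[symmetric]) simp
    qed
    also have "\<dots> \<le> 2 ^ CARD('n) * (2 * real k powr (- \<phi> * p))"
    proof -
      have "1 * real k powr (- \<phi> * p) \<le> (2 ^ CARD('n) * 2) * real k powr (- \<phi> * p)"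
      proof (rule mult_right_mono)
        have "(1::real) \<le> 2 ^ CARD('n)" by (rule one_le_power) simp
        then show "(1::real) \<le> 2 ^ CARD('n) * 2" by linarith
      qed simp
      then show ?thesis by simp
    qed
    finally show "2 ^ CARD('n) * (2 * real k powr (- \<phi> * p)) + real (card D) * real k powr (- \<phi> * p - 2)
        \<le> 2 ^ (CARD('n) + 2) * real k powr (- \<phi> * p)" by (simp add: power_add)
  qed
  finally show ?thesis .
qed

text \<open>\<open>U\<close> is merely Lebesgue measurable, so the event of the theorem need not lie
  in \<open>sets M\<close>. It differs from a measurable event inside a null set and is therefore
  measured by the completion.\<close>

lemma measure_completion_AE_eq:
  assumes A0: "A0 \<in> sets M" and A: "A \<subseteq> space M" and ae: "AE x in M. x \<in> A0 \<longleftrightarrow> x \<in> A"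
  shows "measure (completion M) A = measure M A0"
proof -
  have ae': "AE x in completion M. x \<in> A0 \<longleftrightarrow> x \<in> A" using ae by (simp add: AE_completion_iff)
  have A': "A \<in> sets (completion M)"
    using A0 A by (intro completion.in_sets_AE[OF ae']) auto
  have "measure (completion M) A = measure (completion M) A0"
    by (rule measure_eq_AE) (use ae' A' A0 in auto)
  then show ?thesis using A0 by simp
qed

text \<open>Distinct sample points form a uniform pair in the square and avoid a given null set
  almost surely. Equal indices would place the pair on the diagonal, a null set on which
  \<open>U\<close> and \<open>U0\<close> may differ.\<close>

lemma (in kernel_version) sampled_points_AE:
  assumes "i \<in> I" "j \<in> I" "i \<noteq> j"
  shows "AE x in PiM I (\<lambda>_. unif). U (x i, x j) = U0 (x i, x j)"
proof -
  obtain E where E: "{z. \<not> (z \<in> unit_square \<longrightarrow> U z = U0 z)} \<subseteq> E" "E \<in> null_sets lborel"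
    using U0_eq by (auto elim!: AE_E simp: null_sets_def)
  have Es [measurable]: "E \<in> sets borel" using E(2) by auto
  \<comment> \<open>The outside of the square is included because \<open>U\<close> and
    \<open>U0\<close> are compared only inside it; \<open>unif\<close> gives the outside no
    mass.\<close>
  let ?f = "\<lambda>z. indicator (E \<union> - unit_square) z :: ennreal"
  have fm: "?f \<in> borel_measurable (unif \<Otimes>\<^sub>M unif)"
    unfolding measurable_cong_sets[OF sets_unif_pair refl] by measurable
  have "(\<integral>\<^sup>+x. ?f (x i, x j) \<partial>PiM I (\<lambda>_. unif)) = (\<integral>\<^sup>+y. (\<integral>\<^sup>+x. ?f (x, y) \<partial>unif) \<partial>unif)"
    by (rule nn_integral_PiM_pair[OF prob_space_unif assms fm])
  also have "\<dots> = (\<integral>\<^sup>+z. ?f z * indicator unit_square z \<partial>lborel)"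
    by (rule nn_integral_unif_pair) measurable
  also have "\<dots> \<le> (\<integral>\<^sup>+z. indicator E z \<partial>lborel)"
    by (intro nn_integral_mono) (auto simp: indicator_def)
  also have "\<dots> = 0" using E(2) by auto
  finally have "(\<integral>\<^sup>+x. ?f (x i, x j) \<partial>PiM I (\<lambda>_. unif)) = 0" by simp
  moreover have "(\<lambda>x. ?f (x i, x j)) \<in> borel_measurable (PiM I (\<lambda>_. unif))"
    using assms by (intro measurable_compose[OF _ fm] measurable_Pair measurable_component_singleton)
  ultimately have "AE x in PiM I (\<lambda>_. unif). ?f (x i, x j) = 0"
    by (subst (asm) nn_integral_0_iff_AE)
  then show ?thesis
  proof eventually_elim
    case (elim x)
    then have "(x i, x j) \<notin> E" "(x i, x j) \<in> unit_square" by (auto simp: indicator_def split: if_splits)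
    then show ?case using E(1) by blast
  qed
qed

theorem theorem8p3:
  fixes M :: "'a measure"
    and X :: "nat \<Rightarrow> 'a \<Rightarrow> real"
    and U :: "real \<times> real \<Rightarrow> real ^ 'n"
    and k :: nat and p \<phi> :: real
  assumes "k \<ge> 2" and "CARD('n) \<ge> 2" and "p > 3" and "\<phi> > 0"
    and "Lp_kernel p U"
    and "prob_space M"
    and "prob_space.indep_vars M (\<lambda>_. borel) X {1..k}"
    and "\<And>i. i \<in> {1..k} \<Longrightarrow> distr M borel (X i) = uniform_measure lborel {0..1}"
  shows "measure (completion M)
      {\<omega> \<in> space M.
        cut_norm (sampled_step k U (\<lambda>i. X i \<omega>)) - cut_norm U
        \<le> 10 * (cut_norm U + 30 * Lr_norm p U
              + 6 * sqrt (2 * \<phi> * p) * (Lr_norm 1 U + 2 * Lr_norm p U)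
                  * (sqrt (ln (real k)) / real k powr ((p - 3) / (4 * p) - \<phi>)))
            * real k powr (- (1 / 4) + 1 / (4 * p))}
    \<ge> 1 - 2 ^ (CARD('n) + 2) * real CARD('n)
          * real k powr (- \<phi> * p + (real CARD('n) - 1) * (p - 1) / (4 * p))"
    (is "measure _ ?A \<ge> 1 - ?q")
\<comment> \<open>In the nontrivial case, \<open>?q < 1\<close> forces
  \<open>\<phi> * p * ln (real k) \<ge> 2\<close>, and so moments of order at least 2 are
  available.\<close>
proof (cases "?q \<ge> 1")
  case True
  then show ?thesis using measure_nonneg[of "completion M" ?A] by linarith
next
  case False
  note One_nat_def [simp del]
  interpret M: prob_space M by fact
  obtain U0 :: "real \<times> real \<Rightarrow> real ^ 'n" where U0: "\<And>i. (\<lambda>z. U0 z $ i) \<in> borel_measurable borel"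
    "AE z in lborel. z \<in> unit_square \<longrightarrow> U z = U0 z"
    using Lp_kernel_borel_version[OF assms(5)] by blast
  interpret kernel_version U U0 p
    using assms U0 by unfold_locales auto
  define I where "I = {1..k}"
  have I: "finite I" "I \<noteq> {}" using assms(1) by (auto simp: I_def)
  have k: "k > 0" "real k > 0" "real k \<ge> 1" using assms(1) by auto
  have lnk: "ln (real k) \<ge> 0" using k by simp
  let ?P = "PiM I (\<lambda>_. unif)"
  \<comment> \<open>Points of \<open>PiM I\<close> are \<open>undefined\<close> outside
    \<open>I\<close>, hence the restriction.\<close>
  define Xr where "Xr \<omega> = (\<lambda>i\<in>I. X i \<omega>)" for \<omega>
  have Xm: "X i \<in> borel_measurable M" if "i \<in> I" for i
    using assms(7) that unfolding M.indep_vars_def I_def by blast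
  have Xr_m: "Xr \<in> measurable M ?P"
    unfolding Xr_def[abs_def] using Xm by (intro measurable_restrict) (simp add: measurable_cong_sets[OF refl sets_unif])
  have Xr_distr: "distr M ?P Xr = ?P"
  proof -
    have "distr M (PiM I (\<lambda>_. borel)) Xr = PiM I (\<lambda>i. distr M borel (X i))"
      using M.indep_vars_iff_distr_eq_PiM'[of I X "\<lambda>_. borel"] I Xm assms(7)
      by (simp add: Xr_def[abs_def] I_def[symmetric])
    also have "\<dots> = ?P" using assms(8) by (intro PiM_cong) (auto simp: I_def)
    also have "distr M (PiM I (\<lambda>_. borel)) Xr = distr M ?P Xr"
      by (intro distr_cong refl sets_PiM_cong) auto
    finally show ?thesis .
  qed
  define Y where "Y x = Max ((\<lambda>s. diag_free_cut (\<lambda>z. s \<bullet> U0 z) I x) ` signs) / (real k)\<^sup>2" for x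
  have Ym [measurable]: "Y \<in> borel_measurable ?P"
    unfolding Y_def[abs_def]
  proof (intro borel_measurable_divide borel_measurable_Max measurable_diag_free_cut I borel_measurable_const)
    fix s :: "real ^ 'n"
    show "(\<lambda>z. s \<bullet> U0 z) \<in> borel_measurable (unif \<Otimes>\<^sub>M unif)"
      unfolding measurable_cong_sets[OF sets_unif_pair refl] by simp
  qed simp
  have YX [measurable]: "(\<lambda>\<omega>. Y (Xr \<omega>)) \<in> borel_measurable M"
    by (rule measurable_compose[OF Xr_m Ym])
  have ae: "AE \<omega> in M. cut_norm (sampled_step k U (\<lambda>i. X i \<omega>)) = Y (Xr \<omega>)"
  proof -
    have "AE x in ?P. \<forall>q\<in>I \<times> I. fst q \<noteq> snd q \<longrightarrow> U (x (fst q), x (snd q)) = U0 (x (fst q), x (snd q))"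
    proof (rule AE_finite_allI)
      fix q assume "q \<in> I \<times> I"
      then show "AE x in ?P. fst q \<noteq> snd q \<longrightarrow> U (x (fst q), x (snd q)) = U0 (x (fst q), x (snd q))"
        using sampled_points_AE[of "fst q" I "snd q"] by (cases "fst q = snd q") auto
    qed (use I in simp)
    then have "AE x in distr M ?P Xr. \<forall>q\<in>I \<times> I. fst q \<noteq> snd q \<longrightarrow> U (x (fst q), x (snd q)) = U0 (x (fst q), x (snd q))"
      unfolding Xr_distr .
    from AE_distrD[OF Xr_m this] show ?thesis
    proof eventually_elim
      case (elim \<omega>)
      have "diag_free_cut (\<lambda>z. s \<bullet> U z) {1..k} (\<lambda>i. X i \<omega>) = diag_free_cut (\<lambda>z. s \<bullet> U0 z) I (Xr \<omega>)" for s
        unfolding diag_free_cut_def I_def[symmetric]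
      proof (intro arg_cong[where f = Max] image_cong refl)
        fix q assume "q \<in> Pow I \<times> Pow I"
        then obtain S T where q: "q = (S, T)" "S \<subseteq> I" "T \<subseteq> I" by auto
        have "(\<Sum>i\<in>S. \<Sum>j\<in>T. if i = j then 0 else s \<bullet> U (X i \<omega>, X j \<omega>))
            = (\<Sum>i\<in>S. \<Sum>j\<in>T. if i = j then 0 else s \<bullet> U0 (Xr \<omega> i, Xr \<omega> j))"
        proof (intro sum.cong refl)
          fix i j assume "i \<in> S" "j \<in> T"
          then have ij: "i \<in> I" "j \<in> I" using q by auto
          then show "(if i = j then 0 else s \<bullet> U (X i \<omega>, X j \<omega>)) = (if i = j then 0 else s \<bullet> U0 (Xr \<omega> i, Xr \<omega> j))"
            using bspec[OF elim, of "(i, j)"] by (auto simp: Xr_def)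
        qed
        then show "(case q of (S, T) \<Rightarrow> \<Sum>i\<in>S. \<Sum>j\<in>T. if i = j then 0 else s \<bullet> U (X i \<omega>, X j \<omega>))
            = (case q of (S, T) \<Rightarrow> \<Sum>i\<in>S. \<Sum>j\<in>T. if i = j then 0 else s \<bullet> U0 (Xr \<omega> i, Xr \<omega> j))"
          by (simp add: q)
      qed
      then show ?case unfolding cut_norm_sampled_step[OF k(1)] Y_def by simp
    qed
  qed
  define t where "t = 16 * exp 1 * sqrt (exp 1) * sqrt (\<phi> * p * ln (real k)) * real k powr (\<phi> - 1 / 2) * N"
  define c where "c = 10 * (cut_norm U + 30 * N + 6 * sqrt (2 * \<phi> * p) * (Lr_norm 1 U + 2 * N)
      * (sqrt (ln (real k)) / real k powr ((p - 3) / (4 * p) - \<phi>))) * real k powr (- (1 / 4) + 1 / (4 * p))"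
  \<comment> \<open>The summand with \<open>300 * N\<close> absorbs the truncation error, and the
    one with \<open>120 * sqrt (2 * \<phi> * p) * N\<close> absorbs \<open>t\<close>; the other
    summands are nonnegative.\<close>
  have c_ge: "N * real k powr (- 1 / 4) + t \<le> c"
  proof -
    let ?k = "real k powr (- (1 / 4) + 1 / (4 * p))"
    let ?w = "sqrt (ln (real k)) / real k powr ((p - 3) / (4 * p) - \<phi>)"
    have w0: "?w \<ge> 0" using lnk by simp
    have N1: "Lr_norm 1 U \<ge> 0" by (simp add: Lr_norm_def)
    have "N * real k powr (- 1 / 4) \<le> 300 * N * ?k"
    proof -
      have "real k powr (- 1 / 4) \<le> ?k" using k assms(3) by (intro powr_mono) auto
      then have "N * real k powr (- 1 / 4) \<le> N * ?k" using N_nonneg by (intro mult_left_mono) auto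
      moreover have "0 \<le> N * ?k" using N_nonneg by simp
      ultimately show ?thesis by linarith
    qed
    moreover have "t \<le> 120 * sqrt (2 * \<phi> * p) * N * ?w * ?k"
    proof -
      \<comment> \<open>120 is 10 * 6 * 2, the coefficient of \<open>N\<close> in the claimed bound;
        the left-hand side is about 72.\<close>
      have e: "16 * exp 1 * sqrt (exp 1) \<le> (120 :: real)"
      proof -
        have "exp 1 \<le> (272 / 100 :: real)" using e_less_272 by simp
        moreover from this have "sqrt (exp 1) \<le> (2 :: real)" by (intro real_le_lsqrt) auto
        ultimately have "exp 1 * sqrt (exp 1) \<le> (272 / 100) * (2 :: real)" by (intro mult_mono) auto
        then show ?thesis by simp
      qed
      have s: "sqrt (\<phi> * p * ln (real k)) \<le> sqrt (2 * \<phi> * p) * sqrt (ln (real k))"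
        using assms(3,4) lnk by (simp add: real_sqrt_mult[symmetric] mult_right_mono)
      have e2: "real k powr (\<phi> - 1 / 2) \<le> ?k / real k powr ((p - 3) / (4 * p) - \<phi>)"
      proof -
        have "?k / real k powr ((p - 3) / (4 * p) - \<phi>) = real k powr (- (1 / 4) + 1 / (4 * p) - ((p - 3) / (4 * p) - \<phi>))"
          by (simp add: powr_diff)
        also have "\<dots> \<ge> real k powr (\<phi> - 1 / 2)"
        proof (rule powr_mono)
          \<comment> \<open>The exponents of the claim combine to this value, so the claimed rate
            exceeds that of \<open>t\<close> by the factor \<open>k powr (1 / p)\<close>.\<close>
          have "- (1 / 4) + 1 / (4 * p) - ((p - 3) / (4 * p) - \<phi>) = \<phi> - 1 / 2 + 1 / p"
            using assms(3) by (simp add: field_simps)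
          then show "\<phi> - 1 / 2 \<le> - (1 / 4) + 1 / (4 * p) - ((p - 3) / (4 * p) - \<phi>)" using assms(3) by simp
        qed (use k in simp)
        finally show ?thesis .
      qed
      have "t \<le> 120 * (sqrt (2 * \<phi> * p) * sqrt (ln (real k))) * (?k / real k powr ((p - 3) / (4 * p) - \<phi>)) * N"
        unfolding t_def using assms(3,4) lnk
        by (intro mult_right_mono[OF _ N_nonneg] mult_mono e s e2) auto
      then show ?thesis by (simp add: mult_ac)
    qed
    moreover have "c = 10 * cut_norm U * ?k + 300 * N * ?k + 60 * sqrt (2 * \<phi> * p) * Lr_norm 1 U * ?w * ?k
        + 120 * sqrt (2 * \<phi> * p) * N * ?w * ?k"
      unfolding c_def by (simp add: algebra_simps)
    moreover have "0 \<le> 10 * cut_norm U * ?k" using cut_norm_nonneg by simp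
    moreover have "0 \<le> 60 * sqrt (2 * \<phi> * p) * Lr_norm 1 U * ?w * ?k"
      using N1 w0 assms(3,4) by (intro mult_nonneg_nonneg) auto
    ultimately show ?thesis by linarith
  qed
  have q_ge: "2 ^ (CARD('n) + 2) * real k powr (- \<phi> * p) \<le> ?q"
  proof -
    have "(2 ^ (CARD('n) + 2) * 1) * real k powr (- \<phi> * p) \<le> ?q"
    proof (intro mult_mono powr_mono)
      show "- \<phi> * p \<le> - \<phi> * p + (real CARD('n) - 1) * (p - 1) / (4 * p)"
        using assms(2,3) by simp
    qed (use k assms(2) in auto)
    then show ?thesis by simp
  qed
  \<comment> \<open>Otherwise \<open>k powr (- \<phi> * p)\<close> is at least
    \<open>exp (- 2)\<close>, hence at least 1/8, and the power of 2 is at least 16 because the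
    dimension is at least 2. Then \<open>?q\<close> would be at least 2.\<close>
  have L: "\<phi> * p * ln (real k) \<ge> 2"
  proof (rule ccontr)
    assume "\<not> \<phi> * p * ln (real k) \<ge> 2"
    then have "exp (- 2) \<le> real k powr (- \<phi> * p)" using k by (simp add: powr_def)
    moreover have "1 / 8 \<le> exp (- 2 :: real)"
    proof -
      have "exp 1 \<le> (272 / 100 :: real)" using e_less_272 by simp
      then have "exp 1 * exp 1 \<le> (272 / 100) * (272 / 100 :: real)" by (intro mult_mono) auto
      then have "exp 2 \<le> (8 :: real)" by (simp flip: exp_add)
      then show ?thesis by (simp add: exp_minus field_simps)
    qed
    moreover have "(16 :: real) \<le> 2 ^ (CARD('n) + 2)"
      using power_increasing[of 4 "CARD('n) + 2" "2 :: real"] assms(2) by simp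
    ultimately have "16 * (1 / 8) \<le> 2 ^ (CARD('n) + 2) * real k powr (- \<phi> * p)"
      by (intro mult_mono) auto
    then show False using q_ge False by linarith
  qed
  define bad where "bad = {x \<in> space ?P. cut_norm U + N * real k powr (- 1 / 4) + t < Y x}"
  have bad_sets: "bad \<in> sets ?P" unfolding bad_def by measurable
  have bad_le: "measure M (Xr -` bad \<inter> space M) \<le> ?q"
  proof -
    have "emeasure M (Xr -` bad \<inter> space M) = emeasure ?P bad"
      using emeasure_distr[OF Xr_m bad_sets] by (simp add: Xr_distr)
    also have "\<dots> \<le> ennreal (2 ^ (CARD('n) + 2) * real k powr (- \<phi> * p))"
      unfolding bad_def Y_def I_def by (rule sampled_cut_bound[OF assms(1,3,4) L t_def])
    also have "\<dots> \<le> ennreal ?q" by (intro ennreal_leI q_ge)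
    finally have "emeasure M (Xr -` bad \<inter> space M) \<le> ennreal ?q" .
    moreover have "?q \<ge> 0" by simp
    ultimately show ?thesis by (simp add: M.emeasure_eq_measure)
  qed
  define A0 where "A0 = {\<omega> \<in> space M. Y (Xr \<omega>) - cut_norm U \<le> c}"
  have A0: "A0 \<in> sets M" unfolding A0_def by measurable
  have "1 - ?q \<le> 1 - measure M (Xr -` bad \<inter> space M)" using bad_le by linarith
  also have "\<dots> = measure M (space M - (Xr -` bad \<inter> space M))"
    using measurable_sets[OF Xr_m bad_sets] by (rule M.prob_compl[symmetric])
  also have "\<dots> \<le> measure M A0"
  proof (rule M.finite_measure_mono[OF _ A0], rule subsetI)
    fix \<omega> assume w: "\<omega> \<in> space M - (Xr -` bad \<inter> space M)"
    then have "Xr \<omega> \<in> space ?P" using measurable_space[OF Xr_m] by blast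
    then show "\<omega> \<in> A0" using w c_ge by (auto simp: A0_def bad_def)
  qed
  also have "\<dots> = measure (completion M) {\<omega> \<in> space M. cut_norm (sampled_step k U (\<lambda>i. X i \<omega>)) - cut_norm U \<le> c}"
    by (rule measure_completion_AE_eq[OF A0, symmetric])
       (use ae in \<open>auto simp: A0_def elim: eventually_mono\<close>)
  finally show ?thesis unfolding c_def .
qed

end
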